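(* The equation $w=z+1$ describes an elliptic curve in the box variety $\mathcal B=\overline{\mathbb H\times\mathbb H/\Delta(4,8)}$ (namely the closure of the image of $\{(z,w)\in\mathbb H\times\mathbb H:\ w=z+1\}$), which also can be defined by the equations $$W_1=W_2,\quad Z_1=Z_2,\quad\sqrt2\,W_1=Z_3,\quad W_3^2+Z_3^2-C^2=0,\quad 2Z_2^2+Z_3^2-2C^2=0.$$ Applying the group $\Delta(1,2)$ one gets $48$ elliptic curves.
   Context: $\mathbb H$ is the upper half plane, $\mathbb H^*=\mathbb H\cup\mathbb Q\cup\{\infty\}$, and $\Gamma[N]=\ker(\mathrm{SL}(2,\mathbb Z)\to\mathrm{SL}(2,\mathbb Z/N\mathbb Z))$. For $N\mid N'$, $$\Delta(N,N')=\{(M_1,M_2)\in\Gamma[N]\times\Gamma[N]:\ M_1\equiv M_2\bmod N'\},$$ acting componentwise on $\mathbb H^*\times\mathbb H^*$. The group $\Delta(4,8)$ is normal in $\Delta(1,2)$, so $\Delta(1,2)$ acts on $\overline{\mathbb H\times\mathbb H/\Delta(4,8)}=(\mathbb H^*\times\mathbb H^* )/\Delta(4,8)$. "Elliptic curve" here means a smooth curve of genus one. This surface is identified with the box variety $\mathcal B=\mathrm{proj}(B\otimes_{\mathbb Q}\mathbb C)\subset\mathbb P^6$, where $B=\mathbb Q[Z_1,Z_2,Z_3,W_1,W_2,W_3,C]$ (generators of degree one) has defining relations $W_1^2+W_2^2=Z_3^2$, $W_1^2+W_3^2=Z_2^2$, $W_2^2+W_3^2=Z_1^2$, $W_1^2+W_2^2+W_3^2=C^2$,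 via $Z_1=\vartheta_{01}(z)\vartheta_{01}(w)$, $Z_2=\vartheta_{00}(z)\vartheta_{00}(w)$, $Z_3=\vartheta_{10}(z)\vartheta_{10}(w)$, $C=\vartheta_{00}(2z)\vartheta_{00}(2w)+\vartheta_{10}(2z)\vartheta_{10}(2w)$, $W_1=\vartheta_{10}(2z)\vartheta_{00}(2w)+\vartheta_{00}(2z)\vartheta_{10}(2w)$, $W_2=\mathrm i(\vartheta_{10}(2z)\vartheta_{00}(2w)-\vartheta_{00}(2z)\vartheta_{10}(2w))$, $W_3=\vartheta_{00}(2z)\vartheta_{00}(2w)-\vartheta_{10}(2z)\vartheta_{10}(2w)$, where $\vartheta_{ab}(z)=\sum_{n\in\mathbb Z}e^{\pi\mathrm i((n+a/2)^2z+b(n+a/2))}$. *)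

theory Defs
  imports
    "HOL-Analysis.Analysis"
    "HOL-Library.Function_Algebras"
    "HOL-Computational_Algebra.Polynomial"
    "HOL-Number_Theory.Cong"
begin

section \<open>Complex projective space\<close>

text \<open>A point of the projective space with homogeneous coordinates indexed by \<open>'n\<close>
  (so of dimension \<open>CARD('n) - 1\<close>) is a complex line through the origin of \<open>complex ^ 'n\<close>.\<close>

typedef ('n::finite) proj = "{range (\<lambda>c. c *s x) | x :: complex ^ 'n. x \<noteq> 0}"
proof -
  have "(\<chi> i. (1 :: complex)) \<noteq> (0 :: complex ^ 'n)"
    by (simp add: vec_eq_iff)
  then show ?thesis
    by blast
qed

text \<open>The point with homogeneous coordinates \<open>x\<close>; meaningful only for \<open>x \<noteq> 0\<close>.\<close>

definition pt :: "complex ^ 'n \<Rightarrow> ('n::finite) proj" where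
  "pt x = Abs_proj (range (\<lambda>c. c *s x))"

text \<open>The topology is the quotient topology of \<open>complex ^ 'n\<close> without the origin.\<close>

instantiation proj :: (finite) topological_space
begin

definition open_proj :: "'a proj set \<Rightarrow> bool" where
  "open_proj U \<longleftrightarrow> open {x :: complex ^ 'a. x \<noteq> 0 \<and> pt x \<in> U}"

instance
proof
  have "{x :: complex ^ 'a. x \<noteq> 0 \<and> pt x \<in> UNIV} = - {0}"
    by auto
  then show "open (UNIV :: 'a proj set)"
    by (simp only: open_proj_def open_Compl closed_singleton)
next
  fix S T :: "'a proj set"
  assume "open S" "open T"
  moreover have "{x. x \<noteq> 0 \<and> pt x \<in> S \<inter> T} =
      {x. x \<noteq> 0 \<and> pt x \<in> S} \<inter> {x. x \<noteq> 0 \<and> pt x \<in> T}"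
    by auto
  ultimately show "open (S \<inter> T)"
    by (simp only: open_proj_def open_Int)
next
  fix K :: "'a proj set set"
  assume "\<forall>S\<in>K. open S"
  moreover have "{x. x \<noteq> 0 \<and> pt x \<in> \<Union>K} = (\<Union>S\<in>K. {x. x \<noteq> 0 \<and> pt x \<in> S})"
    by auto
  ultimately show "open (\<Union>K)"
    by (simp only: open_proj_def open_UN)
qed

end

section \<open>Projective curves and their genus\<close>

text \<open>Forms of degree \<open>d\<close>, as polynomial functions (over an infinite field these determine
  the polynomial).\<close>

definition forms :: "nat \<Rightarrow> (complex ^ 'n::finite \<Rightarrow> complex) set" where
  "forms d = {F. \<exists>c. F = (\<lambda>x. \<Sum>e | sum e UNIV = d. c e * (\<Prod>i\<in>UNIV. x $ i ^ e i))}"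

definition vanishing_forms :: "nat \<Rightarrow> ('n::finite) proj set \<Rightarrow> (complex ^ 'n \<Rightarrow> complex) set" where
  "vanishing_forms d S = {F \<in> forms d. \<forall>x. x \<noteq> 0 \<and> pt x \<in> S \<longrightarrow> F x = 0}"

definition zariski_closed :: "('n::finite) proj set \<Rightarrow> bool" where
  "zariski_closed S \<longleftrightarrow>
     (\<forall>x. x \<noteq> 0 \<and> (\<forall>d. \<forall>F\<in>vanishing_forms d S. F x = 0) \<longrightarrow> pt x \<in> S)"

definition irreducible_closed :: "('n::finite) proj set \<Rightarrow> bool" where
  "irreducible_closed S \<longleftrightarrow> zariski_closed S \<and> S \<noteq> {} \<and>
     (\<forall>A B. zariski_closed A \<and> zariski_closed B \<and> S = A \<union> B \<longrightarrow> S = A \<or> S = B)"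

text \<open>Krull dimension one: chains of irreducible closed subsets have length at most one, and
  this length occurs.\<close>

definition projective_curve :: "('n::finite) proj set \<Rightarrow> bool" where
  "projective_curve S \<longleftrightarrow> irreducible_closed S \<and>
     (\<exists>Y. irreducible_closed Y \<and> Y \<subset> S) \<and>
     \<not> (\<exists>Y Y'. irreducible_closed Y \<and> irreducible_closed Y' \<and> Y \<subset> Y' \<and> Y' \<subset> S)"

definition gradient :: "(complex ^ 'n::finite \<Rightarrow> complex) \<Rightarrow> complex ^ 'n \<Rightarrow> complex ^ 'n" where
  "gradient F x = (\<chi> i. deriv (\<lambda>t. F (x + t *s axis i 1)) 0)"

text \<open>Jacobian criterion for a curve in the projective space of dimension \<open>CARD('n) - 1\<close>: the
  Jacobian matrix of the homogeneous ideal has rank equal to the codimension \<open>CARD('n) - 2\<close>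
  at every point.\<close>

definition smooth_projective_curve :: "('n::finite) proj set \<Rightarrow> bool" where
  "smooth_projective_curve S \<longleftrightarrow> projective_curve S \<and>
     (\<forall>x. x \<noteq> 0 \<and> pt x \<in> S \<longrightarrow>
        vec.dim (\<Union>d. (\<lambda>F. gradient F x) ` vanishing_forms d S) + 2 = CARD('n))"

interpretation cfun: vector_space "\<lambda>(c::complex) (F :: 'a \<Rightarrow> complex) x. c * F x"
  by unfold_locales (auto simp: fun_eq_iff algebra_simps)

text \<open>The degree \<open>d\<close> part of the homogeneous coordinate ring, i.e. \<open>forms d\<close> modulo
  \<open>vanishing_forms d S\<close>, is realised as the space of restrictions of forms to the cone over
  \<open>S\<close>, extended by zero.\<close>

definition hilbert_function :: "('n::finite) proj set \<Rightarrow> nat \<Rightarrow> nat" where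
  "hilbert_function S d =
     cfun.dim ((\<lambda>F (x :: complex ^ 'n). if x \<noteq> 0 \<and> pt x \<in> S then F x else 0) ` forms d)"

definition hilbert_polynomial :: "('n::finite) proj set \<Rightarrow> rat poly" where
  "hilbert_polynomial S =
     (THE P. \<forall>\<^sub>F d in sequentially. of_nat (hilbert_function S d) = poly P (of_nat d))"

text \<open>The arithmetic genus of a curve, \<open>(-1) ^ 1 * (P 0 - 1)\<close> for its Hilbert polynomial \<open>P\<close>;
  for smooth curves it is the genus.\<close>

definition curve_genus :: "('n::finite) proj set \<Rightarrow> rat" where
  "curve_genus S = 1 - poly (hilbert_polynomial S) 0"

definition elliptic_curve :: "('n::finite) proj set \<Rightarrow> bool" where
  "elliptic_curve S \<longleftrightarrow> smooth_projective_curve S \<and> curve_genus S = 1"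

section \<open>The groups\<close>

definition Gamma :: "int \<Rightarrow> (int ^ 2 ^ 2) set" where
  "Gamma N = {M. det M = 1 \<and> (\<forall>i j. [M $ i $ j = mat 1 $ i $ j] (mod N))}"

definition Delta :: "int \<Rightarrow> int \<Rightarrow> ((int ^ 2 ^ 2) \<times> (int ^ 2 ^ 2)) set" where
  "Delta N N' = {(M1, M2). M1 \<in> Gamma N \<and> M2 \<in> Gamma N \<and>
     (\<forall>i j. [M1 $ i $ j = M2 $ i $ j] (mod N'))}"

definition moebius :: "int ^ 2 ^ 2 \<Rightarrow> complex \<Rightarrow> complex" where
  "moebius M z = (of_int (M $ 1 $ 1) * z + of_int (M $ 1 $ 2)) /
                 (of_int (M $ 2 $ 1) * z + of_int (M $ 2 $ 2))"

section \<open>The box variety and its theta parametrisation\<close>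

datatype coord = Z1 | Z2 | Z3 | W1 | W2 | W3 | C

instance coord :: finite
proof
  have "(UNIV :: coord set) = {Z1, Z2, Z3, W1, W2, W3, C}"
    using coord.exhaust by blast
  then show "finite (UNIV :: coord set)"
    by (metis finite.emptyI finite.insertI)
qed

definition box_variety :: "coord proj set" where
  "box_variety = {pt x | x. x \<noteq> 0 \<and>
     (x $ W1)\<^sup>2 + (x $ W2)\<^sup>2 = (x $ Z3)\<^sup>2 \<and>
     (x $ W1)\<^sup>2 + (x $ W3)\<^sup>2 = (x $ Z2)\<^sup>2 \<and>
     (x $ W2)\<^sup>2 + (x $ W3)\<^sup>2 = (x $ Z1)\<^sup>2 \<and>
     (x $ W1)\<^sup>2 + (x $ W2)\<^sup>2 + (x $ W3)\<^sup>2 = (x $ C)\<^sup>2}"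

definition upper_half_plane :: "complex set" where
  "upper_half_plane = {z. Im z > 0}"

definition theta :: "nat \<Rightarrow> nat \<Rightarrow> complex \<Rightarrow> complex" where
  "theta a b z = (\<Sum>\<^sub>\<infinity>n\<in>(UNIV :: int set).
     exp (of_real pi * \<i> * ((of_int n + of_nat a / 2)\<^sup>2 * z + of_nat b * (of_int n + of_nat a / 2))))"

definition theta_coord :: "complex \<Rightarrow> complex \<Rightarrow> coord \<Rightarrow> complex" where
  "theta_coord z w i = (case i of
     Z1 \<Rightarrow> theta 0 1 z * theta 0 1 w
   | Z2 \<Rightarrow> theta 0 0 z * theta 0 0 w
   | Z3 \<Rightarrow> theta 1 0 z * theta 1 0 w
   | C \<Rightarrow> theta 0 0 (2 * z) * theta 0 0 (2 * w) + theta 1 0 (2 * z) * theta 1 0 (2 * w)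
   | W1 \<Rightarrow> theta 1 0 (2 * z) * theta 0 0 (2 * w) + theta 0 0 (2 * z) * theta 1 0 (2 * w)
   | W2 \<Rightarrow> \<i> * (theta 1 0 (2 * z) * theta 0 0 (2 * w) - theta 0 0 (2 * z) * theta 1 0 (2 * w))
   | W3 \<Rightarrow> theta 0 0 (2 * z) * theta 0 0 (2 * w) - theta 1 0 (2 * z) * theta 1 0 (2 * w))"

text \<open>Through this map on representatives, the compactification of the quotient of the
  product of two upper half planes by \<open>Delta 4 8\<close> is identified with \<open>box_variety\<close>.\<close>

definition theta_map :: "complex \<Rightarrow> complex \<Rightarrow> coord proj" where
  "theta_map z w = pt (\<chi> i. theta_coord z w i)"

text \<open>The action of \<open>Delta 1 2\<close> on the compactified quotient, transported to the box variety.
  The image of \<open>theta_map\<close> is dense in the box variety, so the continuous map is unique.\<close>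

definition box_action :: "(int ^ 2 ^ 2) \<times> (int ^ 2 ^ 2) \<Rightarrow> coord proj \<Rightarrow> coord proj" where
  "box_action M = (SOME f. continuous_on box_variety f \<and> f ` box_variety \<subseteq> box_variety \<and>
     (\<forall>z\<in>upper_half_plane. \<forall>w\<in>upper_half_plane.
        f (theta_map z w) = theta_map (moebius (fst M) z) (moebius (snd M) w)))"

definition shift_curve :: "coord proj set" where
  "shift_curve =
     closure {theta_map z w | z w. z \<in> upper_half_plane \<and> w \<in> upper_half_plane \<and> w = z + 1}"

end

theory Submission
  imports Defs "HOL-Complex_Analysis.Complex_Analysis"
begin

text \<open>Put \<open>a = theta 0 0 (2 * z)\<close>, \<open>b = theta 1 0 (2 * z)\<close> and \<open>y = theta 0 0 z * theta 0 1 z\<close>. On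
  \<open>w = z + 1\<close> all theta coordinates are linear in \<open>a\<^sup>2\<close>, \<open>a * b\<close>, \<open>b\<^sup>2\<close> and \<open>y\<close>, and
  \<open>y\<^sup>2 = a ^ 4 - b ^ 4\<close>. So the curve lies in a linearly embedded copy of the intersection of the
  quadrics \<open>t\<^sub>1 t\<^sub>3 = t\<^sub>2\<^sup>2\<close> and \<open>t\<^sub>4\<^sup>2 = t\<^sub>1\<^sup>2 - t\<^sub>3\<^sup>2\<close> in three-dimensional projective space. A form of
  degree \<open>d\<close> restricts to \<open>P s + y * Q s\<close> on the affine part \<open>y\<^sup>2 = 1 - s ^ 4\<close>, with \<open>P\<close> and \<open>Q\<close> of
  degree at most \<open>2 * d\<close> and \<open>2 * d - 2\<close>; hence the Hilbert function is \<open>4 * d\<close> and the genus is one.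

  For the closure one needs that \<open>b / a\<close> takes all values other than \<open>0\<close> and the fourth roots of
  unity. The octahedral invariant of \<open>b / a\<close> is invariant under the modular group; by the growth at
  the cusp its image is open and closed, so it is onto.

  \<open>Delta 1 2\<close> is generated by \<open>(S, S)\<close>, \<open>(T, T)\<close>, \<open>(1, T\<^sup>2)\<close> and \<open>(1, -1)\<close>, and each generator acts by a
  monomial matrix. These permute transitively 48 curves, which are given by six shapes of linear
  equations with three signs each.\<close>

unbundle no Formal_Power_Series.fps_syntax

section \<open>Theta series\<close>

text \<open>The inversion \<open>z\<close> to \<open>- 1 / z\<close> is the analytic obstacle. It is
  treated in the two-variable function \<open>jtheta\<close>: for a fixed modulus, the quasi-periods
  in \<open>u\<close> determine all Fourier coefficients from the constant one, so a function with
  the same quasi-periods is a multiple of \<open>jtheta\<close>. The multiple stays unspecified; as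
  points are projective, it only has to be nonzero and common to the theta constants at
  \<open>z\<close>. A sign that could depend on \<open>z\<close> enters only with the doubled
  argument, and continuity makes it constant. The ratio \<open>b / a\<close> fixes a point of the
  curve up to the sign of \<open>y\<close>. So surjectivity has two halves: one for the ratio,
  through its modular invariant, and one for the sign, through a substitution that flips it.
  Smoothness and genus concern all forms that vanish on the curve. Division by the two quadrics
  gives a normal form that is zero for such forms, while the discarded part has controlled
  gradients; the Jacobian rank and the Hilbert function are read off from it.
  \<open>box_action\<close> is a choice among extensions. It must agree with the map of a monomial
  matrix on the closure of the theta points of the curve, because projective space is
  Hausdorff.\<close>

definition jtheta :: "complex \<Rightarrow> complex \<Rightarrow> complex" where
  "jtheta u t = (\<Sum>\<^sub>\<infinity>n\<in>(UNIV :: int set). exp (of_real pi * \<i> * (of_int n ^ 2 * t + 2 * of_int n * u)))"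

lemma int_geometric_summable_on:
  fixes r :: real
  assumes "0 \<le> r" "r < 1"
  shows "(\<lambda>n::int. r ^ nat \<bar>n\<bar>) summable_on UNIV"
proof -
  have nat: "(\<lambda>n::nat. r ^ n) summable_on UNIV"
    using assms by (intro summable_nonneg_imp_summable_on) (auto intro: summable_geometric)
  have 1: "(\<lambda>n::int. r ^ nat \<bar>n\<bar>) summable_on range int"
    by (subst summable_on_reindex) (use nat in \<open>auto simp: o_def\<close>)
  have 2: "(\<lambda>n::int. r ^ nat \<bar>n\<bar>) summable_on range (\<lambda>n. - int n)"
    by (subst summable_on_reindex) (use nat in \<open>auto simp: o_def inj_on_def\<close>)
  have "range int \<union> range (\<lambda>n. - int n) = UNIV"
    by (auto simp: image_iff) (metis int_cases2)
  with summable_on_union[OF 1 2] show ?thesis by simp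
qed

lemma gauss_majorant_summable_on:
  fixes d B :: real
  assumes "d > 0"
  shows "(\<lambda>n::int. exp (- pi * d * of_int n ^ 2 + 2 * pi * B * \<bar>of_int n\<bar>)) summable_on UNIV"
proof -
  \<comment> \<open>Completing the square: \<open>K\<close> is the maximum over real
    \<open>x\<close> of \<open>- pi * d * x\<^sup>2 + (2 * pi * B + 1) * x\<close>. So the exponent
    is at most \<open>K - \<bar>n\<bar>\<close>, which gives a geometric majorant.\<close>
  define K where "K = (2 * pi * B + 1) ^ 2 / (4 * pi * d)"
  have *: "exp (- pi * d * of_int n ^ 2 + 2 * pi * B * \<bar>of_int n\<bar>) \<le> exp K * exp (-1) ^ nat \<bar>n\<bar>" for n :: int
  proof -
    let ?x = "\<bar>of_int n\<bar> :: real"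
    have "0 \<le> (2 * pi * d * ?x - (2 * pi * B + 1)) ^ 2 / (4 * pi * d)"
      using assms by auto
    also have "\<dots> = pi * d * ?x ^ 2 - (2 * pi * B + 1) * ?x + K"
      unfolding K_def using assms by (simp add: field_simps power2_eq_square)
    finally have "- pi * d * of_int n ^ 2 + 2 * pi * B * ?x \<le> K - ?x"
      by (simp add: algebra_simps)
    moreover have "exp (K - ?x) = exp K * exp (-1) ^ nat \<bar>n\<bar>"
      by (simp add: exp_of_nat_mult[symmetric] exp_add[symmetric])
    ultimately show ?thesis
      by (metis exp_le_cancel_iff)
  qed
  have "(\<lambda>n::int. exp K * exp (-1) ^ nat \<bar>n\<bar>) summable_on UNIV"
    by (intro summable_on_cmult_right int_geometric_summable_on) auto
  then show ?thesis
    by (rule summable_on_comparison_test) (use * in auto)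
qed

lemma norm_jtheta_term:
  "norm (exp (of_real pi * \<i> * (of_int n ^ 2 * t + 2 * of_int n * u))) =
   exp (- pi * Im t * of_int n ^ 2 - 2 * pi * Im u * of_int n)"
  by (simp add: norm_exp_eq_Re algebra_simps flip: of_int_power)

lemma norm_jtheta_term_le:
  assumes "d \<le> Im t" "\<bar>Im u\<bar> \<le> B"
  shows "norm (exp (of_real pi * \<i> * (of_int n ^ 2 * t + 2 * of_int n * u))) \<le>
    exp (- pi * d * of_int n ^ 2 + 2 * pi * B * \<bar>of_int n\<bar>)"
proof -
  have "- (Im u * of_int n) \<le> \<bar>Im u\<bar> * \<bar>of_int n\<bar>"
    by (metis abs_ge_minus_self abs_mult)
  also have "\<dots> \<le> B * \<bar>of_int n\<bar>"
    using assms by (intro mult_right_mono) auto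
  finally have 1: "2 * pi * (- (Im u * of_int n)) \<le> 2 * pi * (B * \<bar>of_int n\<bar>)"
    by (intro mult_left_mono) auto
  have 2: "pi * (d * of_int n ^ 2) \<le> pi * (Im t * of_int n ^ 2)"
    using assms by (intro mult_left_mono mult_right_mono) auto
  show ?thesis
  proof -
    have "- pi * Im t * of_int n ^ 2 - 2 * pi * Im u * of_int n =
        - (pi * (Im t * of_int n ^ 2)) + 2 * pi * (- (Im u * of_int n))"
      by (simp add: algebra_simps)
    also have "\<dots> \<le> - (pi * (d * of_int n ^ 2)) + 2 * pi * (B * \<bar>of_int n\<bar>)"
      using 1 2 by linarith
    also have "\<dots> = - pi * d * of_int n ^ 2 + 2 * pi * B * \<bar>of_int n\<bar>"
      by (simp add: algebra_simps)
    finally show ?thesis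
      unfolding norm_jtheta_term exp_le_cancel_iff .
  qed
qed

lemma jtheta_abs_summable:
  assumes "Im t > 0"
  shows "(\<lambda>n::int. norm (exp (of_real pi * \<i> * (of_int n ^ 2 * t + 2 * of_int n * u)))) summable_on UNIV"
  by (rule summable_on_comparison_test[OF gauss_majorant_summable_on[OF assms, of "\<bar>Im u\<bar>"]])
    (rule norm_jtheta_term_le[OF order_refl order_refl], rule norm_ge_zero)

lemma jtheta_uniform_limit:
  assumes "d > 0" "\<And>x. x \<in> Y \<Longrightarrow> d \<le> Im (t x)" "\<And>x. x \<in> Y \<Longrightarrow> \<bar>Im (u x)\<bar> \<le> B"
  shows "uniform_limit Y
     (\<lambda>X x. \<Sum>n\<in>X. exp (of_real pi * \<i> * (of_int n ^ 2 * t x + 2 * of_int n * u x)))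
     (\<lambda>x. jtheta (u x) (t x)) (finite_subsets_at_top UNIV)"
  unfolding jtheta_def
  by (rule Weierstrass_m_test_general[OF _ gauss_majorant_summable_on[OF assms(1), of B]])
    (rule norm_jtheta_term_le; use assms in blast)

text \<open>The convergence is locally uniform: on a closed disc inside \<open>X\<close> the
  continuous functions \<open>Im (t x)\<close> and \<open>\<bar>Im (u x)\<bar>\<close> attain a
  positive minimum and a maximum, which serve as the \<open>d\<close> and \<open>B\<close> of one
  majorant.\<close>

lemma jtheta_holomorphic_on [holomorphic_intros]:
  assumes X: "open X" and u: "u holomorphic_on X" and t: "t holomorphic_on X"
    and pos: "\<And>x. x \<in> X \<Longrightarrow> Im (t x) > 0"
  shows "(\<lambda>x. jtheta (u x) (t x)) holomorphic_on X"
proof -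
  have "(\<lambda>x. jtheta (u x) (t x)) field_differentiable at z" if z: "z \<in> X" for z
  proof -
    obtain r where r: "r > 0" "cball z r \<subseteq> X"
      using X z open_contains_cball by blast
    have ut: "continuous_on (cball z r) u" "continuous_on (cball z r) t"
      using u t r by (meson holomorphic_on_imp_continuous_on continuous_on_subset)+
    have "compact ((\<lambda>x. Im (t x)) ` cball z r)"
      by (intro compact_continuous_image continuous_intros ut) auto
    then obtain x0 where x0: "x0 \<in> cball z r" "\<And>x. x \<in> cball z r \<Longrightarrow> Im (t x0) \<le> Im (t x)"
      using compact_attains_inf[of "(\<lambda>x. Im (t x)) ` cball z r"] r by (auto simp del: mem_cball)
    have "compact ((\<lambda>x. \<bar>Im (u x)\<bar>) ` cball z r)"
      by (intro compact_continuous_image continuous_intros ut) auto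
    then obtain x1 where x1: "\<And>x. x \<in> cball z r \<Longrightarrow> \<bar>Im (u x)\<bar> \<le> \<bar>Im (u x1)\<bar>"
      using compact_attains_sup[of "(\<lambda>x. \<bar>Im (u x)\<bar>) ` cball z r"] r by (auto simp del: mem_cball)
    have lim: "uniform_limit (cball z r)
      (\<lambda>X x. \<Sum>n\<in>X. exp (of_real pi * \<i> * (of_int n ^ 2 * t x + 2 * of_int n * u x)))
      (\<lambda>x. jtheta (u x) (t x)) (finite_subsets_at_top UNIV)"
      by (rule jtheta_uniform_limit[where d = "Im (t x0)" and B = "\<bar>Im (u x1)\<bar>"])
        (use x0 x1 pos r in auto)
    have uh: "u holomorphic_on ball z r" "t holomorphic_on ball z r"
      using u t r by (meson ball_subset_cball holomorphic_on_subset)+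
    have "(\<lambda>x. jtheta (u x) (t x)) holomorphic_on ball z r"
      by (rule holomorphic_uniform_limit[OF _ lim])
        (auto intro!: always_eventually continuous_intros holomorphic_intros ut uh
          simp: finite_subsets_at_top_neq_bot)
    then show ?thesis
      using r by (simp add: holomorphic_on_imp_differentiable_at)
  qed
  then show ?thesis
    using X field_differentiable_at_within holomorphic_on_def by blast
qed

lemma jtheta_add_one: "jtheta (u + 1) t = jtheta u t"
proof -
  have "exp (of_real pi * \<i> * (of_int n ^ 2 * t + 2 * of_int n * (u + 1))) =
        exp (of_real pi * \<i> * (of_int n ^ 2 * t + 2 * of_int n * u))" for n :: int
  proof -
    have "of_real pi * \<i> * (of_int n ^ 2 * t + 2 * of_int n * (u + 1)) =
      of_real pi * \<i> * (of_int n ^ 2 * t + 2 * of_int n * u) + \<i> * (of_int n * (of_real pi * 2))"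
      by (simp add: algebra_simps)
    then show ?thesis by (simp only: exp_plus_2pin)
  qed
  then show ?thesis unfolding jtheta_def by simp
qed

text \<open>By completing the square in \<open>n\<close>, the summand of index \<open>n\<close> at
  \<open>u + t\<close> is a fixed exponential times the summand of index \<open>n + 1\<close> at
  \<open>u\<close>.\<close>

lemma jtheta_add_period:
  "jtheta (u + t) t = exp (- (of_real pi * \<i> * (t + 2 * u))) * jtheta u t"
proof -
  let ?f = "\<lambda>n::int. exp (of_real pi * \<i> * (of_int n ^ 2 * t + 2 * of_int n * u))"
  have bij: "bij_betw (\<lambda>n::int. n + 1) UNIV UNIV"
    by (rule bij_betwI[of _ _ _ "\<lambda>n. n - 1"]) auto
  have "exp (of_real pi * \<i> * (of_int n ^ 2 * t + 2 * of_int n * (u + t))) =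
        exp (- (of_real pi * \<i> * (t + 2 * u))) * ?f (n + 1)" for n :: int
    unfolding exp_add[symmetric] by (rule arg_cong[of _ _ exp]) (simp add: algebra_simps power2_eq_square)
  then have "jtheta (u + t) t = (\<Sum>\<^sub>\<infinity>n\<in>UNIV. exp (- (of_real pi * \<i> * (t + 2 * u))) * ?f (n + 1))"
    unfolding jtheta_def by simp
  also have "\<dots> = exp (- (of_real pi * \<i> * (t + 2 * u))) * (\<Sum>\<^sub>\<infinity>n\<in>UNIV. ?f (n + 1))"
    by (rule infsum_cmult_right')
  also have "(\<Sum>\<^sub>\<infinity>n\<in>UNIV. ?f (n + 1)) = jtheta u t"
    unfolding jtheta_def by (rule infsum_reindex_bij_betw[OF bij])
  finally show ?thesis .
qed

subsection \<open>The mean of a periodic entire function\<close>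

text \<open>The constant Fourier coefficient, that is the integral of \<open>f\<close> from
  \<open>v\<close> to \<open>v + 1\<close>, expressed as the increment of a primitive. In this form
  linearity, shifts and uniqueness are facts about derivatives.\<close>

definition has_mean :: "(complex \<Rightarrow> complex) \<Rightarrow> complex \<Rightarrow> bool" where
  "has_mean f c \<longleftrightarrow> (\<exists>F. (\<forall>v. (F has_field_derivative f v) (at v)) \<and> (\<forall>v. F (v + 1) - F v = c))"

lemma has_mean_exists:
  assumes "f holomorphic_on UNIV" "\<And>v. f (v + 1) = f v"
  obtains c where "has_mean f c"
proof -
  obtain F where F: "\<And>v. (F has_field_derivative f v) (at v)"
    using holomorphic_convex_primitive'[of UNIV f] assms(1) by auto
  have "((\<lambda>v. F (v + 1) - F v) has_field_derivative 0) (at v)" for v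
  proof -
    have "((\<lambda>v. F (v + 1)) has_field_derivative f (v + 1)) (at v)"
      using F[of "v + 1"] by (simp add: DERIV_shift)
    from DERIV_diff[OF this F[of v]] show ?thesis
      by (simp add: assms(2))
  qed
  then obtain c where "\<And>v. F (v + 1) - F v = c"
    using has_field_derivative_zero_constant[of UNIV "\<lambda>v. F (v + 1) - F v"] by auto
  with F that show ?thesis
    unfolding has_mean_def by blast
qed

lemma has_mean_unique:
  assumes "has_mean f c" "has_mean f d"
  shows "c = d"
proof -
  obtain F G where F: "\<And>v. (F has_field_derivative f v) (at v)" "\<And>v. F (v + 1) - F v = c"
    and G: "\<And>v. (G has_field_derivative f v) (at v)" "\<And>v. G (v + 1) - G v = d"
    using assms unfolding has_mean_def by metis
  have "((\<lambda>v. F v - G v) has_field_derivative 0) (at v)" for v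
    using DERIV_diff[OF F(1)[of v] G(1)[of v]] by simp
  then obtain k where k: "\<And>v. F v - G v = k"
    using has_field_derivative_zero_constant[of UNIV "\<lambda>v. F v - G v"] by auto
  have "c - d = (F 1 - G 1) - (F 0 - G 0)"
    using F(2)[of 0] G(2)[of 0] by (simp flip: F(2)[of 0] G(2)[of 0])
  then show ?thesis by (simp add: k)
qed

lemma has_mean_iff: "has_mean f c \<Longrightarrow> has_mean f d \<longleftrightarrow> d = c"
  using has_mean_unique by blast

lemma has_mean_diff:
  assumes "has_mean f c" "has_mean g d"
  shows "has_mean (\<lambda>v. f v - g v) (c - d)"
proof -
  obtain F G where F: "\<And>v. (F has_field_derivative f v) (at v)" "\<And>v. F (v + 1) - F v = c"
    and G: "\<And>v. (G has_field_derivative g v) (at v)" "\<And>v. G (v + 1) - G v = d"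
    using assms unfolding has_mean_def by metis
  have "(F (v + 1) - G (v + 1)) - (F v - G v) = c - d" for v
    using F(2)[of v] G(2)[of v] by (simp add: algebra_simps)
  then show ?thesis
    unfolding has_mean_def using F(1) G(1) by (intro exI[of _ "\<lambda>v. F v - G v"]) (auto intro: DERIV_diff)
qed

lemma has_mean_cmult:
  assumes "has_mean f c"
  shows "has_mean (\<lambda>v. k * f v) (k * c)"
proof -
  obtain F where F: "\<And>v. (F has_field_derivative f v) (at v)" "\<And>v. F (v + 1) - F v = c"
    using assms unfolding has_mean_def by metis
  then show ?thesis
    unfolding has_mean_def
    by (intro exI[of _ "\<lambda>v. k * F v"]) (auto intro: DERIV_cmult simp flip: right_diff_distrib)
qed

lemma has_mean_const: "has_mean (\<lambda>v. k) k"
  unfolding has_mean_def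
  by (intro exI[of _ "\<lambda>v. k * v"]) (auto intro!: derivative_eq_intros simp: algebra_simps)

lemma has_mean_zero_iff: "k \<noteq> 0 \<Longrightarrow> has_mean (\<lambda>v. k * f v) 0 \<longleftrightarrow> has_mean f 0"
  using has_mean_cmult[of f 0 k] has_mean_cmult[of "\<lambda>v. k * f v" 0 "inverse k"] by auto

lemma has_mean_shift:
  assumes "has_mean f c"
  shows "has_mean (\<lambda>v. f (v + t)) c"
proof -
  obtain F where F: "\<And>v. (F has_field_derivative f v) (at v)" "\<And>v. F (v + 1) - F v = c"
    using assms unfolding has_mean_def by metis
  have "F (v + 1 + t) - F (v + t) = c" for v
    using F(2)[of "v + t"] by (simp add: algebra_simps)
  then show ?thesis
    unfolding has_mean_def using F(1)
    by (intro exI[of _ "\<lambda>v. F (v + t)"]) (simp flip: DERIV_shift)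
qed

lemma exp_2pi_i_add_int: "exp (2 * of_real pi * \<i> * of_int n * (v + 1)) = exp (2 * of_real pi * \<i> * of_int n * v)"
proof -
  have "2 * of_real pi * \<i> * of_int n * (v + 1) = 2 * of_real pi * \<i> * of_int n * v + \<i> * (of_int n * (of_real pi * 2))"
    by (simp add: algebra_simps)
  then show ?thesis by (simp only: exp_plus_2pin)
qed

lemma has_mean_exp:
  assumes "n \<noteq> (0 :: int)"
  shows "has_mean (\<lambda>v. exp (2 * of_real pi * \<i> * of_int n * v)) 0"
proof -
  let ?k = "2 * of_real pi * \<i> * of_int n :: complex"
  have "?k \<noteq> 0" using assms by simp
  then have "((\<lambda>v. exp (?k * v) / ?k) has_field_derivative exp (?k * v)) (at v)" for v
    by (auto intro!: derivative_eq_intros)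
  moreover have "exp (?k * (v + 1)) / ?k - exp (?k * v) / ?k = 0" for v
    by (simp only: exp_2pi_i_add_int) simp
  ultimately show ?thesis
    unfolding has_mean_def by (intro exI[of _ "\<lambda>v. exp (?k * v) / ?k"]) simp
qed

text \<open>The mean is the increment of a primitive over a unit segment of the line
  \<open>Im v = s\<close>, whatever \<open>s\<close> is. Moving this line is what yields exponential
  decay of Fourier coefficients.\<close>

lemma has_mean_norm_le:
  assumes "has_mean f c" and le: "\<And>v. Im v = s \<Longrightarrow> norm (f v) \<le> B"
  shows "norm c \<le> B"
proof -
  obtain F where F: "\<And>v. (F has_field_derivative f v) (at v)" "\<And>v. F (v + 1) - F v = c"
    using assms unfolding has_mean_def by metis
  let ?a = "Complex 0 s"
  have "norm (F (?a + 1) - F ?a) \<le> B * norm (?a + 1 - ?a)"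
  proof (rule field_differentiable_bound[of "{v. Im v = s}" F f])
    show "convex {v. Im v = s}"
      using convex_hyperplane[of \<i> s] by (simp add: inner_complex_def)
  qed (auto intro: has_field_derivative_at_within F le)
  then show ?thesis by (simp add: F(2))
qed

lemma periodic_of_int:
  fixes f :: "complex \<Rightarrow> 'a"
  assumes "\<And>v. f (v + 1) = f v"
  shows "f (v + of_int n) = f v"
proof (induction n arbitrary: v rule: int_induct[where k = 0])
  case (step1 i)
  then show ?case using assms[of "v + of_int i"] by (simp add: add_ac)
next
  case (step2 i)
  then show ?case using assms[of "v + of_int (i - 1)"] by (simp add: algebra_simps)
qed simp

lemma periodic_bounded_on_line:
  fixes f :: "complex \<Rightarrow> complex"
  assumes "continuous_on UNIV f" "\<And>v. f (v + 1) = f v"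
  obtains B where "\<And>v. Im v = s \<Longrightarrow> norm (f v) \<le> B"
proof -
  have "compact ((\<lambda>x. f (Complex x s)) ` {0..1})"
    by (intro compact_continuous_image continuous_on_compose2[OF assms(1)])
      (auto simp: Complex_eq intro!: continuous_intros)
  then obtain B where B: "\<And>x. x \<in> {0..1} \<Longrightarrow> norm (f (Complex x s)) \<le> B"
    by (force dest: compact_imp_bounded simp: bounded_iff)
  have "norm (f v) \<le> B" if "Im v = s" for v
  proof -
    have "v = Complex (frac (Re v)) s + of_int \<lfloor>Re v\<rfloor>"
      using that by (simp add: frac_def complex_eq_iff)
    then have "f v = f (Complex (frac (Re v)) s)"
      by (metis periodic_of_int[of f, OF assms(2)])
    then show ?thesis
      using B[of "frac (Re v)"] frac_lt_1[of "Re v"] by simp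
  qed
  with that show ?thesis by blast
qed

text \<open>The factor in front of \<open>f v\<close> is a periodic substitute for
  \<open>v - u\<close>. It vanishes exactly at the integer translates of \<open>u\<close>, to first
  order, and there \<open>g v = g u\<close> by periodicity; so the singularities are removable and
  the quotient is periodic again.\<close>

lemma periodic_difference_quotient:
  assumes g: "g holomorphic_on UNIV" and per: "\<And>v. g (v + 1) = g v"
  obtains f where "f holomorphic_on UNIV" "\<And>v. f (v + 1) = f v"
    "\<And>v. (1 - exp (2 * of_real pi * \<i> * (v - u))) * f v = g v - g u"
proof -
  define w where "w v = exp (2 * of_real pi * \<i> * (v - u))" for v
  \<comment> \<open>The constant \<open>- 2 * of_real pi * \<i>\<close> is the derivative of
    \<open>1 - w v\<close> at \<open>u\<close>, so the value prescribed at the zeros is the limit of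
    the quotient.\<close>
  define f where "f v = (if w v = 1 then deriv g u / (- 2 * of_real pi * \<i>) else (g v - g u) / (1 - w v))" for v
  have w1: "w v = 1 \<longleftrightarrow> (\<exists>m::int. v = u + of_int m)" for v
  proof
    assume "w v = 1"
    then obtain n :: int where n: "Im v = Im u" "2 * pi * (Re v - Re u) = 2 * pi * of_int n"
      unfolding w_def exp_eq_1 by (auto simp: algebra_simps)
    from n(2) have "Re v - Re u = of_int n" by simp
    with n(1) show "\<exists>m::int. v = u + of_int m"
      by (intro exI[of _ n]) (simp add: complex_eq_iff)
  next
    assume "\<exists>m::int. v = u + of_int m"
    then show "w v = 1"
      unfolding w_def exp_eq_1 by auto
  qed
  have wper: "w (v + 1) = w v" for v
    unfolding w_def using exp_2pi_i_add_int[of 1 "v - u"] by (simp add: algebra_simps)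
  have whol: "w holomorphic_on UNIV"
    unfolding w_def by (intro holomorphic_intros)
  have fper: "f (v + 1) = f v" for v
    by (simp add: f_def wper per)
  have eq: "(1 - w v) * f v = g v - g u" for v
    using w1[of v] periodic_of_int[of g, OF per] by (auto simp: f_def)
  define e where "e v = 1 - w v" for v
  have ehol: "e holomorphic_on UNIV"
    unfolding e_def by (intro holomorphic_intros whol)
  have de: "deriv e u = - 2 * of_real pi * \<i>"
    unfolding e_def w_def by (rule DERIV_imp_deriv) (auto intro!: derivative_eq_intros)
  have wu: "w u = 1" by (simp add: w_def)
  have e0: "e u = 0" by (simp add: e_def wu)
  \<comment> \<open>Numerator and denominator are both divided by \<open>z - u\<close>, which makes
    each of them holomorphic across \<open>u\<close>. The second has no zero in the unit ball, since
    the other integer translates of \<open>u\<close> are at distance at least one.\<close>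
  let ?G = "\<lambda>z. if z = u then deriv g u else (g z - g u) / (z - u)"
  let ?E = "\<lambda>z. if z = u then deriv e u else (e z - e u) / (z - u)"
  have GE: "?G holomorphic_on UNIV" "?E holomorphic_on UNIV"
    by (rule pole_lemma; use g ehol in simp)+
  have wn: "w v \<noteq> 1" if "v \<in> ball u 1" "v \<noteq> u" for v
  proof
    assume "w v = 1"
    then obtain m :: int where m: "v = u + of_int m" using w1 by blast
    with that have "\<bar>real_of_int m\<bar> < 1" by (simp add: dist_norm)
    with m that show False by simp
  qed
  have "f holomorphic_on ball u 1"
  proof (rule holomorphic_transform)
    show "(\<lambda>v. ?G v / ?E v) holomorphic_on ball u 1"
    proof (intro holomorphic_on_divide)
      fix z assume z: "z \<in> ball u 1"
      show "?E z \<noteq> 0"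
        using wn[OF z] by (auto simp: de wu e_def)
    qed (use GE in \<open>auto intro: holomorphic_on_subset\<close>)
    fix v assume v: "v \<in> ball u 1"
    show "?G v / ?E v = f v"
      using wn[OF v] by (auto simp: f_def de e_def wu)
  qed
  then have fu: "f field_differentiable at u"
    by (simp add: holomorphic_on_imp_differentiable_at)
  have "f field_differentiable at v" for v
  proof (cases "w v = 1")
    case True
    then obtain m :: int where m: "v = u + of_int m" using w1 by blast
    have "(f \<circ> (\<lambda>z. z - of_int m)) field_differentiable at v"
      using m fu by (intro field_differentiable_compose) (auto intro!: derivative_intros)
    moreover have "f \<circ> (\<lambda>z. z - of_int m) = f"
      using periodic_of_int[of f _ "- m", OF fper] by (auto simp: fun_eq_iff)
    ultimately show ?thesis by simp
  next
    case False
    have op: "open {v. w v \<noteq> 1}"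
      using holomorphic_on_imp_continuous_on[OF whol] by (intro open_Collect_neq) auto
    have "(\<lambda>v. (g v - g u) / (1 - w v)) holomorphic_on {v. w v \<noteq> 1}"
      using g whol by (intro holomorphic_intros) (auto intro: holomorphic_on_subset)
    then have "f holomorphic_on {v. w v \<noteq> 1}"
      by (rule holomorphic_transform) (simp add: f_def)
    then show ?thesis
      using op False by (simp add: holomorphic_on_imp_differentiable_at)
  qed
  then have "f holomorphic_on UNIV"
    by (simp add: field_differentiable_at_within holomorphic_on_def)
  with fper eq that show ?thesis unfolding w_def by blast
qed

lemma bounded_geometric_imp_zero:
  fixes d :: complex and r B :: real
  assumes "\<And>n::nat. norm d \<le> B * r ^ n" "0 \<le> r" "r < 1"
  shows "d = 0"
proof -
  have "(\<lambda>n. B * r ^ n) \<longlonglongrightarrow> B * 0"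
    using assms by (intro tendsto_intros LIMSEQ_power_zero) auto
  then have "norm d \<le> B * 0"
    by (rule LIMSEQ_le_const) (use assms in auto)
  then show ?thesis by simp
qed

text \<open>A periodic entire function \<open>g\<close> without Fourier coefficients vanishes: for the difference
  quotient \<open>f\<close> of \<open>g\<close> at \<open>u\<close>, the Fourier coefficients \<open>d n\<close> of \<open>f\<close> are constant except for a jump
  of \<open>g u\<close> at \<open>n = 0\<close>, but they tend to zero in both directions.\<close>

lemma zero_fourier_coefficients_imp_zero:
  assumes g: "g holomorphic_on UNIV" and per: "\<And>v. g (v + 1) = g v"
    and coeff: "\<And>n::int. has_mean (\<lambda>v. g v * exp (2 * of_real pi * \<i> * of_int n * v)) 0"
  shows "g u = 0"
proof -
  obtain f where f: "f holomorphic_on UNIV" "\<And>v. f (v + 1) = f v"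
    and fg: "\<And>v. (1 - exp (2 * of_real pi * \<i> * (v - u))) * f v = g v - g u"
    using periodic_difference_quotient[OF g per] by blast
  define W where "W n v = exp (2 * of_real pi * \<i> * of_int n * (v - u))" for n :: int and v
  have W_split: "W n v = exp (- (2 * of_real pi * \<i> * of_int n * u)) * exp (2 * of_real pi * \<i> * of_int n * v)" for n v
    unfolding W_def exp_add[symmetric] by (rule arg_cong[of _ _ exp]) (simp add: algebra_simps)
  have Wper: "W n (v + 1) = W n v" for n v
    by (simp add: W_split exp_2pi_i_add_int)
  have "\<exists>c. has_mean (\<lambda>v. f v * W n v) c" for n
  proof -
    have "(\<lambda>v. f v * W n v) holomorphic_on UNIV"
      unfolding W_def by (intro holomorphic_intros f)
    from has_mean_exists[OF this] show ?thesis by (metis f(2) Wper)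
  qed
  then obtain d where d: "\<And>n. has_mean (\<lambda>v. f v * W n v) (d n)" by metis
  have gW: "has_mean (\<lambda>v. g v * W n v) 0" for n
    using has_mean_cmult[OF coeff[of n], of "exp (- (2 * of_real pi * \<i> * of_int n * u))"]
    by (simp add: W_split algebra_simps)
  have W0: "has_mean (W n) (if n = 0 then 1 else 0)" for n
  proof (cases "n = 0")
    case True
    then show ?thesis using has_mean_const[of 1] by (simp add: W_def[abs_def])
  next
    case False
    then show ?thesis
      using has_mean_cmult[OF has_mean_exp[OF False], of "exp (- (2 * of_real pi * \<i> * of_int n * u))"]
      by (simp add: W_split[abs_def])
  qed
  have jump: "d n - d (n + 1) = - (if n = 0 then g u else 0)" for n
  proof -
    have "f v * W n v - f v * W (n + 1) v = g v * W n v - g u * W n v" for v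
    proof -
      define E where "E = exp (2 * of_real pi * \<i> * (v - u))"
      have "W (n + 1) v = E * W n v"
        unfolding W_def E_def exp_add[symmetric] by (rule arg_cong[of _ _ exp]) (simp add: algebra_simps)
      then have "f v * W n v - f v * W (n + 1) v = ((1 - E) * f v) * W n v"
        by (simp add: algebra_simps)
      also have "(1 - E) * f v = g v - g u" unfolding E_def by (rule fg)
      finally show ?thesis by (simp add: algebra_simps)
    qed
    then have "has_mean (\<lambda>v. g v * W n v - g u * W n v) (d n - d (n + 1))"
      using has_mean_diff[OF d[of n] d[of "n + 1"]] by simp
    moreover have "has_mean (\<lambda>v. g v * W n v - g u * W n v) (0 - g u * (if n = 0 then 1 else 0))"
      by (intro has_mean_diff gW has_mean_cmult W0)
    ultimately show ?thesis
      using has_mean_unique by fastforce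
  qed
  \<comment> \<open>On each horizontal line \<open>f\<close> is bounded by periodicity and
    \<open>W n\<close> has constant modulus. Taking \<open>s = 1\<close> gives decay for large
    positive \<open>n\<close>, and \<open>s = - 1\<close> for large negative
    \<open>n\<close>.\<close>
  have bound: "\<exists>B. \<forall>n. norm (d n) \<le> B * exp (- 2 * pi * of_int n * s)" for s
  proof -
    obtain B where B: "\<And>v. Im v = Im u + s \<Longrightarrow> norm (f v) \<le> B"
      using periodic_bounded_on_line[OF holomorphic_on_imp_continuous_on[OF f(1)] f(2)] by blast
    have "norm (d n) \<le> B * exp (- 2 * pi * of_int n * s)" for n
    proof (rule has_mean_norm_le[OF d])
      fix v assume v: "Im v = Im u + s"
      have "norm (W n v) = exp (- 2 * pi * of_int n * s)"
        unfolding W_def norm_exp_eq_Re using v by simp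
      then show "norm (f v * W n v) \<le> B * exp (- 2 * pi * of_int n * s)"
        using B[OF v] by (simp add: norm_mult)
    qed
    then show ?thesis by blast
  qed
  have dpos: "d (int n + 1) = d 1" for n
  proof (induction n)
    case (Suc n)
    then show ?case using jump[of "int n + 1"] by (simp add: algebra_simps)
  qed simp
  have dneg: "d (- int n) = d 0" for n
  proof (induction n)
    case (Suc n)
    then show ?case using jump[of "- int (Suc n)"] by (simp add: algebra_simps)
  qed simp
  have e1: "exp (- 2 * pi) < 1" by simp
  have "d 1 = 0"
  proof -
    obtain B where B: "\<And>n. norm (d n) \<le> B * exp (- 2 * pi * of_int n * 1)" using bound by metis
    have "norm (d 1) \<le> (B * exp (- 2 * pi)) * exp (- 2 * pi) ^ n" for n
      using B[of "int n + 1"] unfolding dpos by (simp add: exp_of_nat_mult[symmetric] exp_add[symmetric] algebra_simps)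
    then show ?thesis by (rule bounded_geometric_imp_zero) simp_all
  qed
  moreover have "d 0 = 0"
  proof -
    obtain B where B: "\<And>n. norm (d n) \<le> B * exp (- 2 * pi * of_int n * (- 1))" using bound by metis
    have "norm (d 0) \<le> B * exp (- 2 * pi) ^ n" for n
      using B[of "- int n"] unfolding dneg by (simp add: exp_of_nat_mult[symmetric] algebra_simps)
    then show ?thesis by (rule bounded_geometric_imp_zero) simp_all
  qed
  ultimately show ?thesis using jump[of 0] by simp
qed

text \<open>Replacing \<open>v\<close> by \<open>v + t\<close> keeps the mean. By quasi-periodicity
  it turns the Fourier coefficient of index \<open>n\<close> into a nonzero multiple of the one of
  index \<open>n - 1\<close>, so the vanishing of one coefficient spreads to all.\<close>

lemma theta_like_mean_zero_imp_zero:
  assumes h: "h holomorphic_on UNIV" and per: "\<And>v. h (v + 1) = h v"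
    and qper: "\<And>v. h (v + t) = exp (- (of_real pi * \<i> * (t + 2 * v))) * h v"
    and mean: "has_mean h 0"
  shows "h u = 0"
proof -
  let ?e = "\<lambda>(n::int) v. exp (2 * of_real pi * \<i> * of_int n * v)"
  have step: "has_mean (\<lambda>v. h v * ?e n v) 0 \<longleftrightarrow> has_mean (\<lambda>v. h v * ?e (n - 1) v) 0" for n
  proof -
    let ?k = "exp (of_real pi * \<i> * t * (2 * of_int n - 1))"
    have eq: "h (v + t) * ?e n (v + t) = ?k * (h v * ?e (n - 1) v)" for v
    proof -
      have "h (v + t) * ?e n (v + t) = h v * (exp (- (of_real pi * \<i> * (t + 2 * v))) * ?e n (v + t))"
        by (simp only: qper mult_ac)
      also have "exp (- (of_real pi * \<i> * (t + 2 * v))) * ?e n (v + t) = ?k * ?e (n - 1) v"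
        unfolding exp_add[symmetric] by (rule arg_cong[of _ _ exp]) (simp add: algebra_simps)
      finally show ?thesis by (simp only: mult_ac)
    qed
    obtain c where c: "has_mean (\<lambda>v. h v * ?e n v) c"
    proof (rule has_mean_exists)
      show "(\<lambda>v. h v * ?e n v) holomorphic_on UNIV"
        by (intro holomorphic_intros h)
      show "h (v + 1) * ?e n (v + 1) = h v * ?e n v" for v
        by (simp only: per exp_2pi_i_add_int)
    qed
    have c': "has_mean (\<lambda>v. ?k * (h v * ?e (n - 1) v)) c"
      using has_mean_shift[OF c, of t] by (simp only: eq)
    show ?thesis
      using has_mean_iff[OF c, of 0] has_mean_iff[OF c', of 0]
      unfolding has_mean_zero_iff[OF exp_not_eq_zero] by (rule trans[OF _ sym])
  qed
  have "has_mean (\<lambda>v. h v * ?e n v) 0" for n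
  proof (induction n rule: int_induct[where k = 0])
    case base
    then show ?case using mean by simp
  next
    case (step1 i)
    then show ?case using step[of "i + 1"] by simp
  next
    case (step2 i)
    then show ?case using step[of i] by simp
  qed
  from zero_fourier_coefficients_imp_zero[OF h per this] show ?thesis .
qed

text \<open>Of the summands only the one with \<open>n = 0\<close> has a nonzero mean. The
  interchange with the sum is an estimate: finite partial sums are uniformly close to
  \<open>jtheta\<close> on the real line, and \<open>has_mean_norm_le\<close> carries the error over
  to the means.\<close>

lemma has_mean_jtheta:
  assumes t: "Im t > 0"
  shows "has_mean (\<lambda>u. jtheta u t) 1"
proof -
  obtain c where c: "has_mean (\<lambda>u. jtheta u t) c"
  proof (rule has_mean_exists)
    show "(\<lambda>u. jtheta u t) holomorphic_on UNIV"
      using t by (intro holomorphic_intros) auto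
  qed (auto simp: jtheta_add_one)
  let ?f = "\<lambda>n::int. \<lambda>u. exp (of_real pi * \<i> * (of_int n ^ 2 * t + 2 * of_int n * u))"
  have mean: "has_mean (?f n) (if n = 0 then 1 else 0)" for n
  proof (cases "n = 0")
    case True
    then show ?thesis using has_mean_const[of 1] by simp
  next
    case False
    have "?f n u = exp (of_real pi * \<i> * of_int n ^ 2 * t) * exp (2 * of_real pi * \<i> * of_int n * u)" for u
      unfolding exp_add[symmetric] by (rule arg_cong[of _ _ exp]) (simp add: algebra_simps)
    then show ?thesis
      using has_mean_cmult[OF has_mean_exp[OF False], of "exp (of_real pi * \<i> * of_int n ^ 2 * t)"] False by simp
  qed
  have sum_mean: "has_mean (\<lambda>u. \<Sum>n\<in>X. ?f n u) (\<Sum>n\<in>X. if n = 0 then 1 else 0)" if "finite X" for X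
    using that
  proof (induction X)
    case empty
    then show ?case using has_mean_const[of 0] by simp
  next
    case (insert x X)
    have "has_mean (\<lambda>u. ?f x u - (-1) * (\<Sum>n\<in>X. ?f n u)) ((if x = 0 then 1 else 0) - (-1) * (\<Sum>n\<in>X. if n = 0 then 1 else 0))"
      by (intro has_mean_diff has_mean_cmult mean insert.IH)
    then show ?case
      by (simp only: sum.insert[OF insert.hyps] mult_minus1 diff_minus_eq_add)
  qed
  have "norm (c - 1) \<le> e" if "e > 0" for e
  proof -
    have "uniform_limit {u. Im u = 0} (\<lambda>X x. \<Sum>n\<in>X. ?f n x) (\<lambda>x. jtheta x t) (finite_subsets_at_top UNIV)"
      by (rule jtheta_uniform_limit[OF t, where B = 0]) auto
    from uniform_limitD[OF this \<open>e > 0\<close>]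
    obtain X where X: "finite X" "\<And>Y. finite Y \<Longrightarrow> X \<subseteq> Y \<Longrightarrow> \<forall>x\<in>{u. Im u = 0}. dist (\<Sum>n\<in>Y. ?f n x) (jtheta x t) < e"
      unfolding eventually_finite_subsets_at_top by auto
    let ?Y = "insert 0 X"
    have Y: "finite ?Y" "X \<subseteq> ?Y" using X by auto
    have "has_mean (\<lambda>u. jtheta u t - (\<Sum>n\<in>?Y. ?f n u)) (c - (\<Sum>n\<in>?Y. if n = 0 then 1 else 0))"
      by (intro has_mean_diff c sum_mean Y)
    also have "(\<Sum>n\<in>?Y. if n = 0 then 1 else 0) = (1 :: complex)"
      using Y by (simp add: sum.delta)
    finally show ?thesis
      by (rule has_mean_norm_le[where s = 0])
        (use X(2)[OF Y] in \<open>auto simp: dist_norm norm_minus_commute less_imp_le\<close>)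
  qed
  then have "c = 1"
    by (metis dense_ge norm_le_zero_iff right_minus_eq)
  with c show ?thesis by simp
qed

lemma jtheta_not_identically_zero:
  assumes "Im t > 0"
  obtains u where "jtheta u t \<noteq> 0"
proof -
  have "\<not> (\<forall>u. jtheta u t = 0)"
  proof
    assume "\<forall>u. jtheta u t = 0"
    then have "(\<lambda>u. jtheta u t) = (\<lambda>u. 0)" by auto
    then show False
      using has_mean_jtheta[OF assms] has_mean_iff[OF has_mean_const[of 0], of 1] by simp
  qed
  with that show ?thesis by blast
qed

text \<open>Since \<open>jtheta\<close> has mean one, subtracting the multiple given by the mean of
  \<open>h\<close> leaves a function of the same type with mean zero.\<close>

lemma theta_like_unique:
  assumes h: "h holomorphic_on UNIV" and per: "\<And>v. h (v + 1) = h v"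
    and qper: "\<And>v. h (v + t) = exp (- (of_real pi * \<i> * (t + 2 * v))) * h v"
    and t: "Im t > 0"
  shows "\<exists>k. \<forall>u. h u = k * jtheta u t"
proof -
  obtain k where k: "has_mean h k" using has_mean_exists[OF h per] .
  have "h u - k * jtheta u t = 0" for u
  proof (rule theta_like_mean_zero_imp_zero[where t = t and h = "\<lambda>u. h u - k * jtheta u t"])
    show "(\<lambda>u. h u - k * jtheta u t) holomorphic_on UNIV"
      using t by (intro holomorphic_intros h) auto
    show "has_mean (\<lambda>u. h u - k * jtheta u t) 0"
      using has_mean_diff[OF k has_mean_cmult[OF has_mean_jtheta[OF t], of k]] by simp
  qed (simp_all add: per qper jtheta_add_one jtheta_add_period right_diff_distrib mult.left_commute)
  then show ?thesis by auto
qed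

text \<open>The factor \<open>k\<close> is \<open>csqrt (- \<i> * t)\<close>.\<close>

lemma jtheta_inversion:
  assumes t: "Im t > 0"
  obtains k where "k \<noteq> 0"
    "\<And>u. exp (- (of_real pi * \<i> * u ^ 2 / t)) * jtheta (u / t) (- 1 / t) = k * jtheta u t"
proof -
  have t0: "t \<noteq> 0" using t by auto
  have t': "Im (- 1 / t) > 0"
    using t by (simp add: Im_divide cmod_power2 divide_pos_pos power2_eq_square sum_squares_gt_zero_iff)
  \<comment> \<open>Multiplication by \<open>t\<close> takes the lattice of the modulus
    \<open>- 1 / t\<close> to that of \<open>t\<close> and exchanges the two periods. The Gaussian
    factor absorbs the difference of the multipliers, so that \<open>?h\<close> has the
    quasi-periods of \<open>jtheta u t\<close>.\<close>
  let ?h = "\<lambda>u. exp (- (of_real pi * \<i> * u ^ 2 / t)) * jtheta (u / t) (- 1 / t)"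
  have minus_one: "jtheta (v - 1) s = jtheta v s" for v s
    using jtheta_add_one[of "v - 1" s] by simp
  have "\<exists>k. \<forall>u. ?h u = k * jtheta u t"
  proof (rule theta_like_unique[of ?h, OF _ _ _ t])
    show "?h holomorphic_on UNIV"
      using t' t0 by (intro holomorphic_intros) auto
    fix v
    have "?h v = ?h (v + 1)"
    proof -
      have "jtheta (v / t) (- 1 / t) = jtheta ((v + 1) / t + (- 1 / t)) (- 1 / t)"
        using t0 by (simp add: field_simps)
      also have "\<dots> = exp (- (of_real pi * \<i> * (- 1 / t + 2 * ((v + 1) / t)))) * jtheta ((v + 1) / t) (- 1 / t)"
        by (rule jtheta_add_period)
      finally have "?h v = (exp (- (of_real pi * \<i> * v ^ 2 / t)) * exp (- (of_real pi * \<i> * (- 1 / t + 2 * ((v + 1) / t))))) * jtheta ((v + 1) / t) (- 1 / t)"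
        by simp
      also have "exp (- (of_real pi * \<i> * v ^ 2 / t)) * exp (- (of_real pi * \<i> * (- 1 / t + 2 * ((v + 1) / t)))) = exp (- (of_real pi * \<i> * (v + 1) ^ 2 / t))"
        unfolding exp_add[symmetric] using t0 by (intro arg_cong[of _ _ exp]) (simp add: field_simps power2_eq_square)
      finally show ?thesis .
    qed
    then show "?h (v + 1) = ?h v" by simp
    have "jtheta ((v + t) / t) (- 1 / t) = jtheta (v / t) (- 1 / t)"
      using t0 jtheta_add_one[of "v / t"] by (simp add: add_divide_distrib)
    moreover have "exp (- (of_real pi * \<i> * (v + t) ^ 2 / t)) = exp (- (of_real pi * \<i> * (t + 2 * v))) * exp (- (of_real pi * \<i> * v ^ 2 / t))"
      unfolding exp_add[symmetric] using t0 by (intro arg_cong[of _ _ exp]) (simp add: field_simps power2_eq_square)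
    ultimately show "?h (v + t) = exp (- (of_real pi * \<i> * (t + 2 * v))) * ?h v"
      by simp
  qed
  then obtain k where k: "\<And>u. ?h u = k * jtheta u t" by blast
  have "k \<noteq> 0"
  proof
    assume "k = 0"
    obtain u where "jtheta u (- 1 / t) \<noteq> 0" using jtheta_not_identically_zero[OF t'] .
    with k[of "u * t"] \<open>k = 0\<close> t0 show False by simp
  qed
  with k that show ?thesis by blast
qed

subsection \<open>Theta constants\<close>

definition theta_term :: "nat \<Rightarrow> nat \<Rightarrow> complex \<Rightarrow> int \<Rightarrow> complex" where
  "theta_term a b z n = exp (of_real pi * \<i> * ((of_int n + of_nat a / 2)\<^sup>2 * z + of_nat b * (of_int n + of_nat a / 2)))"

lemma theta_eq_infsum: "theta a b z = infsum (theta_term a b z) UNIV"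
  by (simp add: theta_def theta_term_def[abs_def])

lemma theta_term_eq_jtheta_term:
  "theta_term a b z n = exp (of_real pi * \<i> * (of_nat a ^ 2 * z / 4 + of_nat a * of_nat b / 2)) *
    exp (of_real pi * \<i> * (of_int n ^ 2 * z + 2 * of_int n * (of_nat a * z / 2 + of_nat b / 2)))"
  unfolding theta_term_def exp_add[symmetric]
  by (rule arg_cong[of _ _ exp]) (simp add: field_simps power2_eq_square)

lemma theta_eq_jtheta:
  "theta a b z = exp (of_real pi * \<i> * (of_nat a ^ 2 * z / 4 + of_nat a * of_nat b / 2)) *
    jtheta (of_nat a * z / 2 + of_nat b / 2) z"
  unfolding theta_eq_infsum theta_term_eq_jtheta_term[abs_def] jtheta_def by (rule infsum_cmult_right')

lemma theta_term_abs_summable: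
  assumes "Im z > 0"
  shows "(\<lambda>n. norm (theta_term a b z n)) summable_on UNIV"
  unfolding theta_term_eq_jtheta_term[abs_def] norm_mult
  by (intro summable_on_cmult_right jtheta_abs_summable assms)

lemma theta_has_sum:
  assumes "Im z > 0"
  shows "(theta_term a b z has_sum theta a b z) UNIV"
  unfolding theta_eq_infsum
  by (rule has_sum_infsum[OF abs_summable_summable[OF theta_term_abs_summable[OF assms]]])

lemma theta_holomorphic_on [holomorphic_intros]:
  assumes "f holomorphic_on X" "open X" "\<And>x. x \<in> X \<Longrightarrow> Im (f x) > 0"
  shows "(\<lambda>x. theta a b (f x)) holomorphic_on X"
  unfolding theta_eq_jtheta using assms by (intro holomorphic_intros) auto

lemma exp_pi_i_cong:
  assumes "x - y = 2 * of_int k"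
  shows "exp (of_real pi * \<i> * x) = exp (of_real pi * \<i> * y)"
proof -
  have "of_real pi * \<i> * x = of_real pi * \<i> * y + of_real pi * \<i> * (x - y)"
    by (simp add: algebra_simps)
  also have "\<dots> = of_real pi * \<i> * y + \<i> * (of_int k * (of_real pi * 2))"
    unfolding assms by simp
  finally show ?thesis by (simp only: exp_plus_2pin)
qed

text \<open>All three rest on parity: \<open>n\<^sup>2 - n\<close> and \<open>n\<^sup>2 + n\<close>
  are even. In the third, \<open>(n + 1 / 2)\<^sup>2\<close> exceeds an even integer by
  \<open>1 / 4\<close>, which produces the eighth root of unity.\<close>

lemma theta_00_add_one: "theta 0 0 (z + 1) = theta 0 1 z"
  and theta_01_add_one: "theta 0 1 (z + 1) = theta 0 0 z"
  and theta_10_add_one: "theta 1 0 (z + 1) = exp (of_real pi * \<i> / 4) * theta 1 0 z"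
proof -
  have ev: "\<exists>k::int. of_int n ^ 2 - of_int n = (2 * of_int k :: complex)"
    "\<exists>k::int. of_int n ^ 2 + of_int n = (2 * of_int k :: complex)" for n :: int
  proof -
    have "even (n ^ 2 - n)" "even (n ^ 2 + n)" by auto
    then obtain k l where "n ^ 2 - n = 2 * k" "n ^ 2 + n = 2 * l" by (metis evenE)
    then have "of_int (n ^ 2 - n) = (of_int (2 * k) :: complex)"
      "of_int (n ^ 2 + n) = (of_int (2 * l) :: complex)" by (simp_all only:)
    then show "\<exists>k::int. of_int n ^ 2 - of_int n = (2 * of_int k :: complex)"
      "\<exists>k::int. of_int n ^ 2 + of_int n = (2 * of_int k :: complex)" by auto
  qed
  have "theta_term 0 0 (z + 1) n = theta_term 0 1 z n" for n
  proof -
    obtain k :: int where "of_int n ^ 2 - of_int n = (2 * of_int k :: complex)" using ev by blast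
    then show ?thesis
      unfolding theta_term_def by (intro exp_pi_i_cong[where k = k]) (simp add: algebra_simps)
  qed
  then have "theta_term 0 0 (z + 1) = theta_term 0 1 z" ..
  then show "theta 0 0 (z + 1) = theta 0 1 z"
    unfolding theta_eq_infsum by (simp only:)
  have "theta_term 0 1 (z + 1) n = theta_term 0 0 z n" for n
  proof -
    obtain k :: int where "of_int n ^ 2 + of_int n = (2 * of_int k :: complex)" using ev by blast
    then show ?thesis
      unfolding theta_term_def by (intro exp_pi_i_cong[where k = k]) (simp add: algebra_simps)
  qed
  then have "theta_term 0 1 (z + 1) = theta_term 0 0 z" ..
  then show "theta 0 1 (z + 1) = theta 0 0 z"
    unfolding theta_eq_infsum by (simp only:)
  have "theta_term 1 0 (z + 1) n = exp (of_real pi * \<i> / 4) * theta_term 1 0 z n" for n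
  proof -
    obtain k :: int where k: "of_int n ^ 2 + of_int n = (2 * of_int k :: complex)" using ev by blast
    have "theta_term 1 0 (z + 1) n = exp (of_real pi * \<i> * (1 / 4 + (of_int n + 1 / 2) ^ 2 * z))"
      unfolding theta_term_def
    proof (rule exp_pi_i_cong)
      show "(of_int n + of_nat 1 / 2)\<^sup>2 * (z + 1) + of_nat 0 * (of_int n + of_nat 1 / 2) -
          (1 / 4 + (of_int n + 1 / 2)\<^sup>2 * z) = 2 * of_int k"
        unfolding k[symmetric] by (simp add: field_simps power2_eq_square)
    qed
    also have "\<dots> = exp (of_real pi * \<i> / 4) * theta_term 1 0 z n"
      unfolding theta_term_def exp_add[symmetric] by (rule arg_cong[of _ _ exp]) (simp add: algebra_simps)
    finally show ?thesis .
  qed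
  then have "theta_term 1 0 (z + 1) = (\<lambda>n. exp (of_real pi * \<i> / 4) * theta_term 1 0 z n)" ..
  then show "theta 1 0 (z + 1) = exp (of_real pi * \<i> / 4) * theta 1 0 z"
    unfolding theta_eq_infsum by (simp only: infsum_cmult_right')
qed

text \<open>One factor \<open>k\<close> serves all three constants because they are, up to
  exponentials, the values of one function \<open>jtheta\<close> at \<open>0\<close> and at two half
  periods. The choice \<open>u = - 1 / 2\<close> is made because \<open>u / z\<close> is then half
  of the new modulus \<open>- 1 / z\<close>.\<close>

lemma theta_inversion:
  assumes "Im z > 0"
  obtains k where "k \<noteq> 0" "theta 0 0 (- 1 / z) = k * theta 0 0 z"
    "theta 1 0 (- 1 / z) = k * theta 0 1 z" "theta 0 1 (- 1 / z) = k * theta 1 0 z"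
proof -
  have z0: "z \<noteq> 0" using assms by auto
  obtain k where k: "k \<noteq> 0"
    "\<And>u. exp (- (of_real pi * \<i> * u ^ 2 / z)) * jtheta (u / z) (- 1 / z) = k * jtheta u z"
    using jtheta_inversion[OF assms] by blast
  have "theta 0 0 (- 1 / z) = k * theta 0 0 z"
    using k(2)[of 0] by (simp add: theta_eq_jtheta)
  moreover have "theta 1 0 (- 1 / z) = k * theta 0 1 z"
    using k(2)[of "- 1 / 2"] jtheta_add_one[of "- 1 / 2" z] z0
    by (simp add: theta_eq_jtheta field_simps power2_eq_square)
  moreover have "theta 0 1 (- 1 / z) = k * theta 1 0 z"
  proof -
    have "jtheta (1 / 2) (- 1 / z) = exp (of_real pi * \<i> * z / 4) * (exp (- (of_real pi * \<i> * (z / 2) ^ 2 / z)) * jtheta (z / 2 / z) (- 1 / z))"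
      using z0 by (simp add: exp_add[symmetric] power2_eq_square mult.assoc[symmetric] del: mult.assoc)
    also have "\<dots> = exp (of_real pi * \<i> * z / 4) * (k * jtheta (z / 2) z)" by (simp only: k(2))
    finally show ?thesis by (simp add: theta_eq_jtheta)
  qed
  ultimately show ?thesis using that k(1) by blast
qed

lemma theta_split_even_odd:
  assumes z: "Im z > 0"
  shows "theta 0 0 z = theta 0 0 (4 * z) + theta 1 0 (4 * z)"
    and "theta 0 1 z = theta 0 0 (4 * z) - theta 1 0 (4 * z)"
proof -
  have z4: "Im (4 * z) > 0" using z by simp
  have img: "range (\<lambda>n::int. 2 * n) \<union> range (\<lambda>n. 2 * n + 1) = UNIV"
    "range (\<lambda>n::int. 2 * n) \<inter> range (\<lambda>n. 2 * n + 1) = {}"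
    by (auto simp: image_iff) presburger+
  have inj: "inj (\<lambda>n::int. 2 * n)" "inj (\<lambda>n::int. 2 * n + 1)" by (auto simp: inj_def)
  have split: "(f has_sum (s + t)) UNIV"
    if "((\<lambda>n. f (2 * n)) has_sum s) UNIV" "((\<lambda>n. f (2 * n + 1)) has_sum t) UNIV"
    for f :: "int \<Rightarrow> complex" and s t
  proof -
    have "(f has_sum s) (range (\<lambda>n. 2 * n))" "(f has_sum t) (range (\<lambda>n. 2 * n + 1))"
      using that by (simp_all add: has_sum_reindex inj o_def)
    from has_sum_Un_disjoint[OF this img(2)] show ?thesis by (simp only: img)
  qed
  have odd: "exp (of_real pi * \<i> * of_int (2 * n + 1)) = -1" for n
    using exp_pi_i_cong[of "of_int (2 * n + 1)" 1 n] by simp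
  have even: "exp (of_real pi * \<i> * of_int (2 * n)) = 1" for n
    using exp_pi_i_cong[of "of_int (2 * n)" 0 n] by simp
  have t: "theta_term 0 0 z (2 * n) = theta_term 0 0 (4 * z) n"
    "theta_term 0 0 z (2 * n + 1) = theta_term 1 0 (4 * z) n" for n
    unfolding theta_term_def by (rule arg_cong[of _ _ exp]; simp add: field_simps power2_eq_square)+
  have tm: "theta_term 0 1 z m = theta_term 0 0 z m * exp (of_real pi * \<i> * of_int m)" for m
    unfolding theta_term_def exp_add[symmetric] by (rule arg_cong[of _ _ exp]) (simp add: field_simps)
  show "theta 0 0 z = theta 0 0 (4 * z) + theta 1 0 (4 * z)"
    by (rule has_sum_unique[OF theta_has_sum[OF z] split]) (simp_all add: t theta_has_sum[OF z4])
  have "(theta_term 0 1 z has_sum (theta 0 0 (4 * z) + - theta 1 0 (4 * z))) UNIV"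
    by (rule split; simp only: tm odd even t mult_1_right mult_minus_right)
      (simp_all add: has_sum_uminus theta_has_sum[OF z4])
  then show "theta 0 1 z = theta 0 0 (4 * z) - theta 1 0 (4 * z)"
    using has_sum_unique[OF theta_has_sum[OF z]] by fastforce
qed

section \<open>Products of theta series and the duplication formulas\<close>

lemma abs_summable_times:
  fixes f g :: "int \<Rightarrow> complex"
  assumes "(\<lambda>n. norm (f n)) summable_on UNIV" "(\<lambda>n. norm (g n)) summable_on UNIV"
  shows "(\<lambda>x. norm (case x of (m, n) \<Rightarrow> f m * g n)) summable_on UNIV"
proof -
  have "(\<lambda>x. norm (case x of (m, n) \<Rightarrow> f m * g n)) summable_on (UNIV \<times> UNIV)"
    unfolding Infinite_Sum.abs_summable_on_Sigma_iff
  proof (intro conjI ballI)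
    show "(\<lambda>n. norm (case (m, n) of (m, n) \<Rightarrow> f m * g n)) summable_on UNIV" for m
      using assms(2) by (simp add: norm_mult summable_on_cmult_right)
    have "(\<lambda>m. norm (f m) * (\<Sum>\<^sub>\<infinity>n. norm (g n))) summable_on UNIV"
      by (intro summable_on_cmult_left assms)
    then show "(\<lambda>m. norm (\<Sum>\<^sub>\<infinity>n. norm (case (m, n) of (m, n) \<Rightarrow> f m * g n))) summable_on UNIV"
      by (simp add: norm_mult infsum_cmult_right' infsum_nonneg abs_mult)
  qed
  then show ?thesis by simp
qed

lemma has_sum_times:
  fixes f g :: "int \<Rightarrow> complex"
  assumes "(\<lambda>n. norm (f n)) summable_on UNIV" "(\<lambda>n. norm (g n)) summable_on UNIV" "(f has_sum s) UNIV" "(g has_sum t) UNIV"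
  shows "((\<lambda>(m, n). f m * g n) has_sum (s * t)) UNIV"
proof -
  have "((\<lambda>(m, n). f m * g n) has_sum (s * t)) (UNIV \<times> UNIV)"
  proof (rule has_sum_SigmaI)
    show "((\<lambda>n. case (m, n) of (m, n) \<Rightarrow> f m * g n) has_sum (f m * t)) UNIV" for m
      using has_sum_cmult_right[OF assms(4)] by simp
    show "((\<lambda>m. f m * t) has_sum (s * t)) UNIV"
      by (intro has_sum_cmult_left assms)
    show "(\<lambda>(m, n). f m * g n) summable_on UNIV \<times> UNIV"
      using abs_summable_summable[OF abs_summable_times[OF assms(1,2)]] by simp
  qed
  then show ?thesis by simp
qed

text \<open>The sublattice of index two: \<open>(p, q)\<close> is \<open>(m + n, m - n)\<close> or \<open>(m + n + 1, m - n)\<close>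
  according to the parity of \<open>p + q\<close>.\<close>

lemma has_sum_int_rotate:
  fixes f :: "int \<times> int \<Rightarrow> complex"
  assumes "((\<lambda>(m, n). f (m + n, m - n)) has_sum s) UNIV" "((\<lambda>(m, n). f (m + n + 1, m - n)) has_sum t) UNIV"
  shows "(f has_sum (s + t)) UNIV"
proof -
  let ?g = "\<lambda>(m, n). (m + n, m - n) :: int \<times> int" and ?h = "\<lambda>(m, n). (m + n + 1, m - n) :: int \<times> int"
  have inj: "inj ?g" "inj ?h" by (auto simp: inj_def)
  have "(p, q) \<in> range ?g \<union> range ?h" for p q
  proof (cases "even (p + q)")
    case True
    then obtain m where "p + q = 2 * m" by blast
    then have "(p, q) = ?g (m, p - m)" by simp
    then show ?thesis by blast
  next
    case False
    then obtain m where "p + q = 2 * m + 1" by (elim oddE)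
    then have "(p, q) = ?h (m, p - m - 1)" by simp
    then show ?thesis by blast
  qed
  then have img: "range ?g \<union> range ?h = UNIV" by auto
  have disj: "range ?g \<inter> range ?h = {}"
    by auto presburger
  have "(f has_sum s) (range ?g)" "(f has_sum t) (range ?h)"
    using assms unfolding has_sum_reindex[OF inj(1)] has_sum_reindex[OF inj(2)]
    by (simp_all only: o_def case_prod_unfold)
  from has_sum_Un_disjoint[OF this disj] show ?thesis by (simp only: img)
qed

text \<open>A square is a double sum over pairs of indices. The rotation to
  \<open>(m + n, m - n)\<close> turns the sum of two squares into
  \<open>2 * m\<^sup>2 + 2 * n\<^sup>2\<close>, which doubles the modulus and separates the
  variables; the other coset of the sublattice contributes half-integral indices.\<close>

lemma theta_squares:
  assumes z: "Im z > 0"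
  shows "theta 0 0 z ^ 2 = theta 0 0 (2 * z) ^ 2 + theta 1 0 (2 * z) ^ 2" (is ?A)
    and "theta 0 1 z ^ 2 = theta 0 0 (2 * z) ^ 2 - theta 1 0 (2 * z) ^ 2" (is ?B)
    and "theta 1 0 z ^ 2 = 2 * theta 0 0 (2 * z) * theta 1 0 (2 * z)" (is ?C)
proof -
  have z2: "Im (2 * z) > 0" using z by simp
  have sq: "((\<lambda>(m, n). theta_term a b z m * theta_term a b z n) has_sum theta a b z ^ 2) UNIV" for a b
    unfolding power2_eq_square by (rule has_sum_times; intro theta_term_abs_summable theta_has_sum z)
  have prod: "((\<lambda>(m, n). theta_term a 0 (2 * z) m * theta_term c 0 (2 * z) n) has_sum
      (theta a 0 (2 * z) * theta c 0 (2 * z))) UNIV" for a c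
    by (rule has_sum_times; intro theta_term_abs_summable theta_has_sum z2)
  have e: "theta_term 0 0 z (m + n) * theta_term 0 0 z (m - n) = theta_term 0 0 (2 * z) m * theta_term 0 0 (2 * z) n"
     "theta_term 0 0 z (m + n + 1) * theta_term 0 0 z (m - n) = theta_term 1 0 (2 * z) m * theta_term 1 0 (2 * z) n"
     "theta_term 1 0 z (m + n) * theta_term 1 0 z (m - n) = theta_term 1 0 (2 * z) m * theta_term 0 0 (2 * z) n"
     "theta_term 1 0 z (m + n + 1) * theta_term 1 0 z (m - n) = theta_term 0 0 (2 * z) (m + 1) * theta_term 1 0 (2 * z) n" for m n
    unfolding theta_term_def exp_add[symmetric]
    by (rule arg_cong[of _ _ exp]; simp add: field_simps power2_eq_square)+
  have tm: "theta_term 0 1 z p * theta_term 0 1 z q = (theta_term 0 0 z p * theta_term 0 0 z q) * exp (of_real pi * \<i> * of_int (p + q))" for p q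
    unfolding theta_term_def exp_add[symmetric] by (rule arg_cong[of _ _ exp]) (simp add: field_simps)
  have odd: "exp (of_real pi * \<i> * of_int (m + n + 1 + (m - n))) = -1" for m n
    using exp_pi_i_cong[of "of_int (2 * m + 1)" 1 m] by simp
  have even: "exp (of_real pi * \<i> * of_int (m + n + (m - n))) = 1" for m n
    using exp_pi_i_cong[of "of_int (2 * m)" 0 m] by simp
  have "((\<lambda>(m, n). theta_term 0 0 z m * theta_term 0 0 z n) has_sum
      (theta 0 0 (2 * z) * theta 0 0 (2 * z) + theta 1 0 (2 * z) * theta 1 0 (2 * z))) UNIV"
    by (rule has_sum_int_rotate; simp only: prod.case e prod)
  then show ?A using has_sum_unique[OF sq] by (simp only: power2_eq_square)
  have "((\<lambda>(m, n). theta_term 0 1 z m * theta_term 0 1 z n) has_sum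
      (theta 0 0 (2 * z) * theta 0 0 (2 * z) + - (theta 1 0 (2 * z) * theta 1 0 (2 * z)))) UNIV"
  proof (rule has_sum_int_rotate)
    show "((\<lambda>(m, n). case (m + n, m - n) of (m, n) \<Rightarrow> theta_term 0 1 z m * theta_term 0 1 z n) has_sum theta 0 0 (2 * z) * theta 0 0 (2 * z)) UNIV"
      by (simp only: prod.case tm even e mult_1_right prod)
    have "((\<lambda>x. - (case x of (m, n) \<Rightarrow> theta_term 1 0 (2 * z) m * theta_term 1 0 (2 * z) n)) has_sum
        - (theta 1 0 (2 * z) * theta 1 0 (2 * z))) UNIV"
      using prod[of 1 1] by (simp only: has_sum_uminus minus_minus)
    then show "((\<lambda>(m, n). case (m + n + 1, m - n) of (m, n) \<Rightarrow> theta_term 0 1 z m * theta_term 0 1 z n) has_sum - (theta 1 0 (2 * z) * theta 1 0 (2 * z))) UNIV"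
      by (simp only: prod.case tm odd e mult_minus_right mult_1_right case_prod_unfold fst_conv snd_conv)
  qed
  from has_sum_unique[OF sq this] show ?B by (simp add: power2_eq_square)
  have "((\<lambda>(m, n). theta_term 1 0 z m * theta_term 1 0 z n) has_sum
      (theta 1 0 (2 * z) * theta 0 0 (2 * z) + theta 0 0 (2 * z) * theta 1 0 (2 * z))) UNIV"
  proof (rule has_sum_int_rotate)
    show "((\<lambda>(m, n). case (m + n, m - n) of (m, n) \<Rightarrow> theta_term 1 0 z m * theta_term 1 0 z n) has_sum theta 1 0 (2 * z) * theta 0 0 (2 * z)) UNIV"
      by (simp only: prod.case e prod)
    \<comment> \<open>For characteristic one the odd coset gives the integral index
      \<open>m + 1\<close> in the first factor, so the double series is reached after a
      shift.\<close>
    have bij: "bij_betw (\<lambda>(m, n). (m + 1, n)) (UNIV :: (int \<times> int) set) UNIV"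
      by (rule bij_betwI[of _ _ _ "\<lambda>(m, n). (m - 1, n)"]) auto
    show "((\<lambda>(m, n). case (m + n + 1, m - n) of (m, n) \<Rightarrow> theta_term 1 0 z m * theta_term 1 0 z n) has_sum theta 0 0 (2 * z) * theta 1 0 (2 * z)) UNIV"
      using prod[of 0 1] has_sum_reindex_bij_betw[OF bij, of "\<lambda>(m, n). theta_term 0 0 (2 * z) m * theta_term 1 0 (2 * z) n"]
      by (simp only: e case_prod_unfold fst_conv snd_conv)
  qed
  from has_sum_unique[OF sq this] show ?C by (simp add: power2_eq_square)
qed

declare One_nat_def [simp del]

subsection \<open>The modular group on the upper half plane\<close>

lemma Im_minus_inverse: "Im (- 1 / z) = Im z / (norm z)\<^sup>2"
  by (simp add: Im_divide cmod_power2)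

lemma Im_minus_inverse_pos: "Im z > 0 \<Longrightarrow> Im (- 1 / z) > 0"
  unfolding Im_minus_inverse by (intro divide_pos_pos) auto

text \<open>After a translation into the strip, inverting a point of height \<open>y\<close> gives
  height at least \<open>y / (1 / 4 + y\<^sup>2)\<close>. This at least doubles \<open>y\<close>
  when \<open>y \<le> 1 / 2\<close>, and is at least \<open>3 / 4\<close> when \<open>y\<close> lies
  between \<open>1 / 4\<close> and \<open>3 / 4\<close>; so induction on powers of two reaches the
  strip. The bound \<open>3 / 4\<close> is a rational number below the height
  \<open>sqrt 3 / 2\<close> of the corners of the usual fundamental domain.\<close>

lemma upper_half_plane_modular_induct:
  assumes z: "Im z > 0"
    and shift: "\<And>z. Im z > 0 \<Longrightarrow> P (z + 1) \<longleftrightarrow> P z"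
    and inv: "\<And>z. Im z > 0 \<Longrightarrow> P (- 1 / z) \<Longrightarrow> P z"
    and base: "\<And>z. \<bar>Re z\<bar> \<le> 1 / 2 \<Longrightarrow> Im z \<ge> 3 / 4 \<Longrightarrow> P z"
  shows "P z"
proof -
  have shift_int: "P (z + of_int n) \<longleftrightarrow> P z" if "Im z > 0" for z and n :: int
    using that
  proof (induction n arbitrary: z rule: int_induct[where k = 0])
    case (step1 i)
    then show ?case using shift[of "z + of_int i"] by (simp add: add_ac)
  next
    case (step2 i)
    then show ?case using shift[of "z + of_int (i - 1)"] by (simp add: algebra_simps)
  qed simp
  have reduce: "P z \<longleftrightarrow> P (z - of_int (round (Re z)))" if "Im z > 0" for z
    using shift_int[of "z - of_int (round (Re z))" "round (Re z)"] that by simp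
  have Re_le: "\<bar>Re (z - of_int (round (Re z)))\<bar> \<le> 1 / 2" for z
    using of_int_round_abs_le[of "Re z"] by (simp add: abs_minus_commute)
  have norm_le: "(norm (z - of_int (round (Re z))))\<^sup>2 \<le> 1 / 4 + (Im z)\<^sup>2" for z
  proof -
    have "(Re (z - of_int (round (Re z))))\<^sup>2 \<le> (1 / 2)\<^sup>2"
      using Re_le[of z] by (metis abs_le_square_iff abs_of_pos half_gt_zero_iff zero_less_one)
    then show ?thesis unfolding cmod_power2 by (simp add: power2_eq_square)
  qed
  have high: "P z" if "Im z \<ge> 3 / 4" for z
    using reduce[of z] base[of "z - of_int (round (Re z))"] Re_le[of z] that by simp
  have inv_reduce: "P z" if pos: "Im z > 0" and lb: "P (- 1 / (z - of_int (round (Re z))))" for z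
    using inv[of "z - of_int (round (Re z))"] pos lb reduce[of z] by simp
  have Im_ge: "Im (- 1 / (z - of_int (round (Re z)))) \<ge> c" if "Im z > 0" "c * (1 / 4 + (Im z)\<^sup>2) \<le> Im z" "c \<ge> 0" for z c
  proof -
    let ?v = "z - of_int (round (Re z))"
    have v1: "Im ?v = Im z" by simp
    then have "?v \<noteq> 0" using that(1) by (metis less_irrefl zero_complex.simps(2))
    with v1 have v: "Im ?v = Im z" "(norm ?v)\<^sup>2 > 0" by auto
    have "c * (norm ?v)\<^sup>2 \<le> c * (1 / 4 + (Im z)\<^sup>2)"
      using that by (intro mult_left_mono norm_le)
    also have "\<dots> \<le> Im z" by (rule that)
    finally show ?thesis
      unfolding Im_minus_inverse v(1) using v(2) by (simp only: pos_le_divide_eq)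
  qed
  have mid: "P z" if "Im z \<ge> 1 / 4" for z
  proof (cases "Im z \<ge> 3 / 4")
    case False
    have "0 \<le> (Im z - 1 / 4) * (3 / 4 - Im z)"
      using that False by (intro mult_nonneg_nonneg) auto
    then have "3 / 4 * (1 / 4 + (Im z)\<^sup>2) \<le> Im z"
      using that False by (simp add: algebra_simps power2_eq_square)
    then show ?thesis
      using that by (intro inv_reduce[OF _ high[OF Im_ge]]) auto
  qed (rule high)
  have "P z" if "Im z \<ge> (1 / 2) ^ (n + 1)" for n z
    using that
  proof (induction n arbitrary: z)
    case 0
    then show ?case by (intro mid) auto
  next
    case (Suc n)
    have pos: "Im z > 0" using Suc.prems by (meson less_le_trans zero_less_divide_1_iff zero_less_numeral zero_less_power)
    show ?case
    proof (cases "Im z \<ge> 1 / 4")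
      case False
      have "0 \<le> (1 / 2 - Im z) * (1 / 2 + Im z)"
        using pos False by (intro mult_nonneg_nonneg) auto
      then have "2 * Im z * (1 / 4 + (Im z)\<^sup>2) \<le> Im z * 1"
        using pos by (simp only: mult.assoc mult.left_commute[of 2], intro mult_left_mono) (auto simp: algebra_simps power2_eq_square)
      then have "Im (- 1 / (z - of_int (round (Re z)))) \<ge> 2 * Im z"
        using pos by (intro Im_ge[OF pos]) auto
      then show ?thesis
        using Suc.prems by (intro inv_reduce[OF pos Suc.IH]) auto
    qed (rule mid)
  qed
  moreover obtain n where "(1 / 2 :: real) ^ n < Im z"
    using real_arch_pow_inv[OF z, of "1 / 2"] by auto
  moreover have "(1 / 2 :: real) ^ (n + 1) \<le> (1 / 2) ^ n"
    by (rule power_decreasing) auto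
  ultimately show ?thesis by (meson less_imp_le order_trans)
qed

section \<open>Estimates near the cusp and nonvanishing of the theta constants\<close>

lemma has_sum_geometric_bound:
  fixes f :: "nat \<Rightarrow> complex"
  assumes "(f has_sum s) UNIV" "\<And>n. norm (f n) \<le> r ^ n" "0 \<le> r" "r \<le> 1 / 4"
  shows "norm (s - f 0) \<le> 1 / 3"
proof -
  have f: "f sums s" using assms(1) by (rule has_sum_imp_sums)
  have g: "(\<lambda>n. r ^ n) sums (1 / (1 - r))" using assms by (intro geometric_sums) auto
  have f': "(\<lambda>n. f (Suc n)) sums (s - f 0)" using f by (simp add: sums_Suc_iff)
  have g': "(\<lambda>n. r ^ Suc n) sums (1 / (1 - r) - 1)"
    using g by (subst sums_Suc_iff) simp
  have "norm (s - f 0) = norm (\<Sum>n. f (Suc n))" using f' by (simp add: sums_iff)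
  also have "\<dots> \<le> (\<Sum>n. r ^ Suc n)"
    by (rule norm_suminf_le) (use g' assms(2) in \<open>auto simp: sums_iff simp del: power_Suc\<close>)
  also have "\<dots> = 1 / (1 - r) - 1" using g' by (simp only: sums_iff)
  also have "\<dots> \<le> 1 / 3" using assms by (simp add: field_simps)
  finally show ?thesis .
qed

lemma has_sum_int_split:
  fixes f :: "int \<Rightarrow> complex"
  assumes "(f has_sum s) UNIV" "(\<lambda>n. norm (f n)) summable_on UNIV"
  obtains t u where "((\<lambda>n. f (int n)) has_sum t) UNIV" "((\<lambda>n. f (- 1 - int n)) has_sum u) UNIV" "s = t + u"
proof -
  have inj: "inj int" "inj (\<lambda>n. - 1 - int n)" by (auto simp: inj_def)
  have img: "range int \<union> range (\<lambda>n. - 1 - int n) = UNIV" "range int \<inter> range (\<lambda>n. - 1 - int n) = {}"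
  proof -
    have "m \<in> range int \<union> range (\<lambda>n. - 1 - int n)" for m
    proof (cases "m \<ge> 0")
      case True
      then have "m = int (nat m)" by simp
      then show ?thesis by blast
    next
      case False
      then have "m = - 1 - int (nat (- 1 - m))" by simp
      then show ?thesis by blast
    qed
    then show "range int \<union> range (\<lambda>n. - 1 - int n) = UNIV" by auto
  qed auto
  have f: "f summable_on UNIV" using assms(1) summable_on_def by blast
  obtain t u where tu: "(f has_sum t) (range int)" "(f has_sum u) (range (\<lambda>n. - 1 - int n))"
    using summable_on_subset_banach[OF f] by (metis subset_UNIV summable_on_def)
  have "(f has_sum (t + u)) UNIV"
    using has_sum_Un_disjoint[OF tu img(2)] by (simp only: img)
  then have "s = t + u" using has_sum_unique assms(1) by blast
  moreover have "((\<lambda>n. f (int n)) has_sum t) UNIV" "((\<lambda>n. f (- 1 - int n)) has_sum u) UNIV"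
    using tu unfolding has_sum_reindex[OF inj(1)] has_sum_reindex[OF inj(2)] by (simp_all only: o_def)
  ultimately show ?thesis using that by blast
qed

lemma exp_high_le:
  assumes "y \<ge> 3 / 4"
  shows "exp (- pi * y) \<le> 1 / 4"
proof -
  have "9 / 4 \<le> pi * y"
    using mult_mono[of 3 pi "3 / 4" y] assms pi_gt3 by simp
  have "(4 :: real) \<le> (1 + 9 / 8) ^ 2" by (simp add: power2_eq_square)
  also have "\<dots> \<le> exp (9 / 8) ^ 2" using exp_ge_add_one_self[of "9 / 8"] by (intro power_mono) auto
  also have "\<dots> = exp (9 / 4)" by (simp add: exp_of_nat_mult[symmetric] power2_eq_square exp_add[symmetric])
  also have "\<dots> \<le> exp (pi * y)" using \<open>9 / 4 \<le> pi * y\<close> by simp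
  finally show ?thesis by (simp add: exp_minus field_simps)
qed

text \<open>The terms of index \<open>n\<close> and \<open>- n\<close> agree, so the series is
  \<open>1\<close> plus twice its positive half. That half is dominated by a geometric series of
  ratio at most \<open>1 / 4\<close>, hence has norm at most \<open>1 / 3\<close>.\<close>

lemma theta_0_high:
  assumes "Im z \<ge> 3 / 4"
  shows "norm (theta 0 b z) \<ge> 1 / 3"
proof -
  have pos: "Im z > 0" using assms by simp
  obtain t u where tu: "((\<lambda>n. theta_term 0 b z (int n)) has_sum t) UNIV"
    "((\<lambda>n. theta_term 0 b z (- 1 - int n)) has_sum u) UNIV" "theta 0 b z = t + u"
    using has_sum_int_split[OF theta_has_sum[OF pos] theta_term_abs_summable[OF pos]] .
  have even: "theta_term 0 b z (- n) = theta_term 0 b z n" for n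
    unfolding theta_term_def by (rule exp_pi_i_cong[where k = "- int b * n"]) simp
  have "((\<lambda>n. theta_term 0 b z (int (Suc n))) has_sum (t - theta_term 0 b z 0)) UNIV"
  proof -
    have "((\<lambda>n. theta_term 0 b z (int n)) has_sum (t - theta_term 0 b z (int 0))) (UNIV - {0})"
      by (intro has_sum_Diff tu) (auto simp: has_sum_finite_iff)
    moreover have "UNIV - {0} = range Suc" by (auto simp: image_iff) (metis not0_implies_Suc)
    ultimately show ?thesis by (simp add: has_sum_reindex o_def)
  qed
  moreover have "theta_term 0 b z (- 1 - int n) = theta_term 0 b z (int (Suc n))" for n
    using even[of "int (Suc n)"] by (simp add: algebra_simps)
  ultimately have "u = t - theta_term 0 b z 0"
    using tu(2) has_sum_unique by fastforce
  moreover have t0: "theta_term 0 b z 0 = 1" by (simp add: theta_term_def)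
  ultimately have eq: "theta 0 b z = 1 + 2 * (t - 1)" using tu(3) by simp
  have "norm (t - theta_term 0 b z (int 0)) \<le> 1 / 3"
  proof (rule has_sum_geometric_bound[OF tu(1)])
    fix n
    have "norm (theta_term 0 b z (int n)) = exp (- pi * Im z * real n ^ 2)"
      unfolding theta_term_def norm_exp_eq_Re by (simp flip: of_nat_power)
    also have "\<dots> \<le> exp (real n * (- pi * Im z))"
    proof -
      have "real n \<le> real n ^ 2" by (cases n) (auto simp: power2_eq_square)
      then have "pi * Im z * real n \<le> pi * Im z * real n ^ 2"
        using pos by (intro mult_left_mono) auto
      then show ?thesis by (simp add: mult_ac)
    qed
    also have "\<dots> = exp (- pi * Im z) ^ n" by (rule exp_of_nat_mult)
    finally show "norm (theta_term 0 b z (int n)) \<le> exp (- pi * Im z) ^ n" .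
  qed (use exp_high_le[OF assms] in auto)
  then have "2 * norm (t - 1) \<le> 2 / 3" by (simp add: t0)
  then have "norm (2 * (t - 1)) \<le> 2 / 3" by (simp only: norm_mult norm_numeral)
  moreover have "norm (1 :: complex) \<le> norm (theta 0 b z) + norm (2 * (t - 1))"
    using norm_triangle_ineq4[of "theta 0 b z" "2 * (t - 1)"] by (simp add: eq)
  ultimately show ?thesis by simp
qed

text \<open>The terms of index \<open>n\<close> and \<open>- 1 - n\<close> agree. Once the leading
  exponential \<open>exp (pi * \<i> * z / 4)\<close> is factored out, half of the series starts with
  \<open>1\<close> and its remainder has norm at most \<open>1 / 3\<close>.\<close>

lemma theta_10_high:
  assumes "Im z \<ge> 3 / 4"
  shows "theta 1 0 z \<noteq> 0" "norm (theta 1 0 z) \<le> 3 * exp (- pi * Im z / 4)"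
proof -
  have pos: "Im z > 0" using assms by simp
  let ?e = "exp (of_real pi * \<i> * z / 4)"
  obtain t u where tu: "((\<lambda>n. theta_term 1 0 z (int n)) has_sum t) UNIV"
    "((\<lambda>n. theta_term 1 0 z (- 1 - int n)) has_sum u) UNIV" "theta 1 0 z = t + u"
    using has_sum_int_split[OF theta_has_sum[OF pos] theta_term_abs_summable[OF pos]] .
  have "theta_term 1 0 z (- 1 - int n) = theta_term 1 0 z (int n)" for n
    unfolding theta_term_def by (rule arg_cong[of _ _ exp]) (simp add: field_simps power2_eq_square)
  then have "u = t" using tu(1,2) has_sum_unique by fastforce
  then have eq: "theta 1 0 z = 2 * t" using tu(3) by simp
  define g where "g n = exp (of_real pi * \<i> * (z * of_nat (n * (n + 1))))" for n :: nat
  have "theta_term 1 0 z (int n) = ?e * g n" for n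
    unfolding theta_term_def g_def exp_add[symmetric]
    by (rule arg_cong[of _ _ exp]) (simp add: field_simps power2_eq_square)
  then have "((\<lambda>n. ?e * g n) has_sum t) UNIV" using tu(1) by simp
  then have "((\<lambda>n. inverse ?e * (?e * g n)) has_sum (inverse ?e * t)) UNIV"
    by (rule has_sum_cmult_right)
  then have g: "(g has_sum (inverse ?e * t)) UNIV"
    by (simp add: mult.assoc[symmetric])
  have "norm (inverse ?e * t - g 0) \<le> 1 / 3"
  proof (rule has_sum_geometric_bound[OF g])
    fix n
    have "norm (g n) = exp (- pi * Im z * real (n * (n + 1)))"
      unfolding g_def norm_exp_eq_Re by (simp add: mult.assoc del: of_nat_mult of_nat_add)
    also have "\<dots> \<le> exp (real n * (- pi * Im z))"
    proof -
      have "real n \<le> real (n * (n + 1))" by (simp add: algebra_simps)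
      then have "pi * Im z * real n \<le> pi * Im z * real (n * (n + 1))"
        using pos by (intro mult_left_mono) auto
      then show ?thesis by (simp add: mult_ac)
    qed
    also have "\<dots> = exp (- pi * Im z) ^ n" by (rule exp_of_nat_mult)
    finally show "norm (g n) \<le> exp (- pi * Im z) ^ n" .
  qed (use exp_high_le[OF assms] in auto)
  then have v: "norm (inverse ?e * t - 1) \<le> 1 / 3" by (simp add: g_def)
  define v where "v = inverse ?e * t"
  have tv: "t = ?e * v" by (simp add: v_def mult.assoc[symmetric])
  have "v \<noteq> 0" using v by (auto simp: v_def)
  then show "theta 1 0 z \<noteq> 0" by (simp add: eq tv)
  have "norm v \<le> 4 / 3" using v norm_triangle_sub[of v 1] by (simp add: v_def)
  then have "2 * (norm ?e * norm v) \<le> 2 * (norm ?e * (4 / 3))" by (intro mult_left_mono) auto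
  also have "\<dots> \<le> 3 * norm ?e" by simp
  also have "norm ?e = exp (- pi * Im z / 4)" by (simp add: norm_exp_eq_Re)
  finally show "norm (theta 1 0 z) \<le> 3 * exp (- pi * Im z / 4)"
    by (simp add: eq tv norm_mult)
qed

text \<open>Translation and inversion permute the three constants up to nonzero factors. So the
  conjunction, unlike its single members, is a property to which the modular induction
  applies.\<close>

lemma theta_nonzero:
  assumes "Im z > 0"
  shows "theta 0 0 z \<noteq> 0" "theta 0 1 z \<noteq> 0" "theta 1 0 z \<noteq> 0"
proof -
  have "theta 0 0 z \<noteq> 0 \<and> theta 0 1 z \<noteq> 0 \<and> theta 1 0 z \<noteq> 0"
  proof (rule upper_half_plane_modular_induct[OF assms])
    fix z assume z: "Im z > 0"
    show "(theta 0 0 (z + 1) \<noteq> 0 \<and> theta 0 1 (z + 1) \<noteq> 0 \<and> theta 1 0 (z + 1) \<noteq> 0) \<longleftrightarrow>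
        (theta 0 0 z \<noteq> 0 \<and> theta 0 1 z \<noteq> 0 \<and> theta 1 0 z \<noteq> 0)"
      unfolding theta_00_add_one theta_01_add_one theta_10_add_one by auto
    obtain k where "k \<noteq> 0" "theta 0 0 (- 1 / z) = k * theta 0 0 z"
      "theta 1 0 (- 1 / z) = k * theta 0 1 z" "theta 0 1 (- 1 / z) = k * theta 1 0 z"
      using theta_inversion[OF z] .
    then show "theta 0 0 (- 1 / z) \<noteq> 0 \<and> theta 0 1 (- 1 / z) \<noteq> 0 \<and> theta 1 0 (- 1 / z) \<noteq> 0 \<Longrightarrow>
        theta 0 0 z \<noteq> 0 \<and> theta 0 1 z \<noteq> 0 \<and> theta 1 0 z \<noteq> 0"
      by simp
  next
    fix z :: complex assume "Im z \<ge> 3 / 4"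
    then show "theta 0 0 z \<noteq> 0 \<and> theta 0 1 z \<noteq> 0 \<and> theta 1 0 z \<noteq> 0"
      using theta_0_high[of z 0] theta_0_high[of z 1] theta_10_high(1)[of z] by auto
  qed
  then show "theta 0 0 z \<noteq> 0" "theta 0 1 z \<noteq> 0" "theta 1 0 z \<noteq> 0" by auto
qed

lemma theta_double_add_one:
  "theta 0 0 (2 * (z + 1)) = theta 0 0 (2 * z)"
  "theta 1 0 (2 * (z + 1)) = \<i> * theta 1 0 (2 * z)"
proof -
  have e: "2 * (z + 1) = 2 * z + 1 + 1" by simp
  show "theta 0 0 (2 * (z + 1)) = theta 0 0 (2 * z)"
    unfolding e theta_00_add_one theta_01_add_one ..
  have "exp (of_real pi * \<i> / 4) * exp (of_real pi * \<i> / 4) = cis (pi / 2)"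
    unfolding exp_add[symmetric] cis_conv_exp by (rule arg_cong[of _ _ exp]) simp
  then show "theta 1 0 (2 * (z + 1)) = \<i> * theta 1 0 (2 * z)"
    unfolding e theta_10_add_one by (simp only: mult.assoc[symmetric] cis_pi_half)
qed

text \<open>The sign \<open>e\<close> is in fact \<open>1\<close>; it matters only that it does not depend on \<open>z\<close>.\<close>

lemma theta_inversion_uniform:
  obtains e k where "e ^ 2 = (1 :: complex)" "\<And>z. Im z > 0 \<Longrightarrow> k z \<noteq> 0"
    "\<And>z. Im z > 0 \<Longrightarrow> theta 0 0 (- 1 / z) = k z * theta 0 0 z"
    "\<And>z. Im z > 0 \<Longrightarrow> theta 1 0 (- 1 / z) = k z * theta 0 1 z"
    "\<And>z. Im z > 0 \<Longrightarrow> theta 0 1 (- 1 / z) = k z * theta 1 0 z"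
    "\<And>z. Im z > 0 \<Longrightarrow> of_real (sqrt 2) * theta 0 0 (2 * (- 1 / z)) = e * k z * (theta 0 0 (2 * z) + theta 1 0 (2 * z))"
    "\<And>z. Im z > 0 \<Longrightarrow> of_real (sqrt 2) * theta 1 0 (2 * (- 1 / z)) = e * k z * (theta 0 0 (2 * z) - theta 1 0 (2 * z))"
proof -
  define k where "k z = theta 0 0 (- 1 / z) / theta 0 0 z" for z
  \<comment> \<open>\<open>E\<close> compares the unknown factors at \<open>z / 2\<close> and at
    \<open>z\<close>. Its square turns out to be one, and a continuous function with values
    \<open>1\<close> and \<open>- 1\<close> is constant on the connected half plane.\<close>
  define E where "E z = of_real (sqrt 2) * k (z / 2) / k z" for z
  have inv: "k z \<noteq> 0 \<and> theta 0 0 (- 1 / z) = k z * theta 0 0 z \<and>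
     theta 1 0 (- 1 / z) = k z * theta 0 1 z \<and> theta 0 1 (- 1 / z) = k z * theta 1 0 z" if z: "Im z > 0" for z
  proof -
    obtain l where "l \<noteq> 0" "theta 0 0 (- 1 / z) = l * theta 0 0 z"
      "theta 1 0 (- 1 / z) = l * theta 0 1 z" "theta 0 1 (- 1 / z) = l * theta 1 0 z"
      using theta_inversion[OF z] .
    then show ?thesis using theta_nonzero[OF z] by (simp add: k_def)
  qed
  \<comment> \<open>The point \<open>2 * (- 1 / z)\<close> is the inversion of \<open>z / 2\<close>,
    and the splitting by parity expresses theta at \<open>z / 2\<close> through theta at
    \<open>4 * (z / 2) = 2 * z\<close>.\<close>
  have half: "theta 0 0 (2 * (- 1 / z)) = k (z / 2) * (theta 0 0 (2 * z) + theta 1 0 (2 * z)) \<and>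
     theta 1 0 (2 * (- 1 / z)) = k (z / 2) * (theta 0 0 (2 * z) - theta 1 0 (2 * z))" if z: "Im z > 0" for z
  proof -
    have z2: "Im (z / 2) > 0" using z by simp
    have "4 * (z / 2) = 2 * z" "- 1 / (z / 2) = 2 * (- 1 / z)" by simp_all
    then show ?thesis
      using inv[OF z2] theta_split_even_odd[OF z2] by (simp only:)
  qed
  have sq2: "complex_of_real (sqrt 2) ^ 2 = 2" by (simp flip: of_real_power)
  have E2: "E z ^ 2 = 1" if z: "Im z > 0" for z
  proof -
    have "(k z * theta 0 0 z) ^ 2 = theta 0 0 (2 * (- 1 / z)) ^ 2 + theta 1 0 (2 * (- 1 / z)) ^ 2"
      using inv[OF z] theta_squares(1)[OF Im_minus_inverse_pos[OF z]] by (simp only:)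
    also have "\<dots> = 2 * k (z / 2) ^ 2 * (theta 0 0 (2 * z) ^ 2 + theta 1 0 (2 * z) ^ 2)"
      using half[OF z] by (simp only:) (simp add: power2_eq_square algebra_simps)
    also have "theta 0 0 (2 * z) ^ 2 + theta 1 0 (2 * z) ^ 2 = theta 0 0 z ^ 2"
      using theta_squares(1)[OF z] by simp
    finally have "k z ^ 2 = 2 * k (z / 2) ^ 2"
      using theta_nonzero(1)[OF z] by (simp add: power_mult_distrib)
    then have "E z ^ 2 = k z ^ 2 / k z ^ 2"
      by (simp only: E_def power_divide power_mult_distrib sq2)
    then show ?thesis
      using inv[OF z] by simp
  qed
  have op: "open {z. Im z > 0}" by (rule open_halfspace_Im_gt)
  have "k holomorphic_on {z. Im z > 0}"
    unfolding k_def
    by (intro holomorphic_intros op Im_minus_inverse_pos) (auto simp: theta_nonzero)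
  then have k_cont: "continuous_on {z. Im z > 0} k" by (rule holomorphic_on_imp_continuous_on)
  have "continuous_on {z. Im z > 0} E"
    unfolding E_def
    by (intro continuous_intros k_cont continuous_on_compose2[OF k_cont]) (auto dest: inv)
  moreover have "E ` {z. Im z > 0} \<subseteq> {1, -1}"
    using E2 by (auto simp: power2_eq_1_iff)
  then have "finite (E ` {z. Im z > 0})" by (rule finite_subset) simp
  moreover have "connected {z. Im z > 0}"
    by (intro convex_connected convex_halfspace_Im_gt)
  ultimately have "E constant_on {z. Im z > 0}"
    by (intro continuous_finite_range_constant)
  then obtain e where e: "\<And>z. Im z > 0 \<Longrightarrow> E z = e"
    unfolding constant_on_def by auto
  have e2: "e ^ 2 = 1" using e[of \<i>] E2[of \<i>] by simp
  have kk: "of_real (sqrt 2) * k (z / 2) = e * k z" if z: "Im z > 0" for z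
    using e[OF z] inv[OF z] by (simp add: E_def field_simps)
  show ?thesis
  proof (rule that[of e k])
    fix z :: complex assume z: "Im z > 0"
    show "of_real (sqrt 2) * theta 0 0 (2 * (- 1 / z)) = e * k z * (theta 0 0 (2 * z) + theta 1 0 (2 * z))"
      "of_real (sqrt 2) * theta 1 0 (2 * (- 1 / z)) = e * k z * (theta 0 0 (2 * z) - theta 1 0 (2 * z))"
      using half[OF z] by (simp_all only: mult.assoc[symmetric] kk[OF z])
  qed (use e2 inv in blast)+
qed

subsection \<open>Surjectivity of the theta quotient\<close>

definition theta_ratio :: "complex \<Rightarrow> complex" where
  "theta_ratio z = theta 1 0 (2 * z) / theta 0 0 (2 * z)"

lemma theta_double_nonzero:
  assumes "Im z > 0"
  shows "theta 0 0 (2 * z) \<noteq> 0" "theta 1 0 (2 * z) \<noteq> 0"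
  using theta_nonzero[of "2 * z"] assms by simp_all

lemma theta_fourth_powers:
  assumes "Im z > 0"
  shows "(theta 0 0 z * theta 0 1 z) ^ 2 = theta 0 0 (2 * z) ^ 4 - theta 1 0 (2 * z) ^ 4"
  unfolding power_mult_distrib theta_squares(1,2)[OF assms]
  by (simp add: algebra_simps power2_eq_square power4_eq_xxxx)

lemma theta_ratio_nonzero:
  assumes "Im z > 0"
  shows "theta_ratio z \<noteq> 0" "theta_ratio z ^ 4 \<noteq> 1"
proof -
  show "theta_ratio z \<noteq> 0" using theta_double_nonzero[OF assms] by (simp add: theta_ratio_def)
  have "theta 0 0 (2 * z) ^ 4 - theta 1 0 (2 * z) ^ 4 \<noteq> 0"
    using theta_nonzero[OF assms] by (simp flip: theta_fourth_powers[OF assms])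
  then show "theta_ratio z ^ 4 \<noteq> 1"
    using theta_double_nonzero[OF assms] by (simp add: theta_ratio_def power_divide)
qed

lemma power4_neq_one_imp:
  fixes x :: complex
  assumes "x ^ 4 \<noteq> 1"
  shows "1 + x \<noteq> 0" "1 - x \<noteq> 0" "1 + x ^ 2 \<noteq> 0" "1 + \<i> * x \<noteq> 0" "1 - \<i> * x \<noteq> 0"
proof -
  have f: "1 - x ^ 4 = (1 + x) * (1 - x) * (1 + x ^ 2)" "1 + x ^ 2 = (1 + \<i> * x) * (1 - \<i> * x)"
    by (simp_all add: algebra_simps power2_eq_square power4_eq_xxxx)
  have "1 - x ^ 4 \<noteq> 0" using assms by simp
  then show nz: "1 + x \<noteq> 0" "1 - x \<noteq> 0" "1 + x ^ 2 \<noteq> 0"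
    unfolding f(1) mult_eq_0_iff by blast+
  from nz(3) show "1 + \<i> * x \<noteq> 0" "1 - \<i> * x \<noteq> 0"
    unfolding f(2) mult_eq_0_iff by blast+
qed

lemma cayley_involution:
  fixes x :: complex
  assumes "1 + x \<noteq> 0"
  shows "(1 - (1 - x) / (1 + x)) / (1 + (1 - x) / (1 + x)) = x"
proof -
  have d: "(1 - (2 / d - 1)) / (1 + (2 / d - 1)) = d - 1" if "d \<noteq> 0" for d :: complex
    using that by (simp add: field_simps)
  have "(1 - x) / (1 + x) = (2 - (1 + x)) / (1 + x)" by simp
  also have "\<dots> = 2 / (1 + x) - 1"
    by (simp only: diff_divide_distrib divide_self[OF assms])
  finally show ?thesis
    using d[OF assms] by (simp only: add_diff_cancel_left')
qed

lemma theta_ratio_add_one: "theta_ratio (z + 1) = \<i> * theta_ratio z"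
  unfolding theta_ratio_def theta_double_add_one by simp

lemma theta_ratio_inversion:
  assumes z: "Im z > 0"
  shows "theta_ratio (- 1 / z) = (1 - theta_ratio z) / (1 + theta_ratio z)"
proof -
  obtain e k where ek: "e ^ 2 = (1 :: complex)" "k z \<noteq> 0"
    and 1: "of_real (sqrt 2) * theta 0 0 (2 * (- 1 / z)) = e * k z * (theta 0 0 (2 * z) + theta 1 0 (2 * z))"
    and 2: "of_real (sqrt 2) * theta 1 0 (2 * (- 1 / z)) = e * k z * (theta 0 0 (2 * z) - theta 1 0 (2 * z))"
    using theta_inversion_uniform z by metis
  have "e * k z \<noteq> 0" using ek by auto
  have "theta_ratio (- 1 / z) = (of_real (sqrt 2) * theta 1 0 (2 * (- 1 / z))) / (of_real (sqrt 2) * theta 0 0 (2 * (- 1 / z)))"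
    by (simp add: theta_ratio_def)
  also have "\<dots> = (theta 0 0 (2 * z) - theta 1 0 (2 * z)) / (theta 0 0 (2 * z) + theta 1 0 (2 * z))"
    unfolding 1 2 using \<open>e * k z \<noteq> 0\<close> by (rule nonzero_mult_divide_mult_cancel_left)
  also have "\<dots> = (theta 0 0 (2 * z) * (1 - theta_ratio z)) / (theta 0 0 (2 * z) * (1 + theta_ratio z))"
    using theta_double_nonzero[OF z] by (simp add: theta_ratio_def algebra_simps)
  also have "\<dots> = (1 - theta_ratio z) / (1 + theta_ratio z)"
    using theta_double_nonzero(1)[OF z] by (rule nonzero_mult_divide_mult_cancel_left)
  finally show ?thesis .
qed

text \<open>The invariant of the octahedral group generated by \<open>x \<mapsto> \<i> * x\<close> and
  \<open>x \<mapsto> (1 - x) / (1 + x)\<close>, in terms of \<open>s = x ^ 4\<close>.\<close>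

definition octahedral_invariant :: "complex \<Rightarrow> complex" where
  "octahedral_invariant s = (1 + 14 * s + s ^ 2) ^ 3 / (s * (1 - s) ^ 4)"

text \<open>In homogeneous form, numerator and denominator are octahedral forms and reproduce
  themselves up to constants: the quadratic factor picks up \<open>16\<close>, hence
  \<open>16 ^ 3\<close> after cubing, and the denominator picks up \<open>8 ^ 4\<close>, which is
  the same number.\<close>

lemma octahedral_invariant_involution:
  assumes "x \<noteq> 0" "x ^ 4 \<noteq> 1"
  shows "octahedral_invariant (((1 - x) / (1 + x)) ^ 4) = octahedral_invariant (x ^ 4)"
proof -
  note nz = power4_neq_one_imp[OF assms(2)]
  define p q where "p = (1 + x) ^ 4" and "q = (1 - x) ^ 4"
  have p0: "p \<noteq> 0" "q \<noteq> 0" using nz by (auto simp: p_def q_def)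
  have s: "((1 - x) / (1 + x)) ^ 4 = q / p" by (simp add: power_divide p_def q_def)
  have pq1: "p ^ 2 + 14 * q * p + q ^ 2 = 16 * (1 + 14 * x ^ 4 + (x ^ 4) ^ 2)"
    unfolding p_def q_def by algebra
  have pq2: "p - q = 8 * x * (1 + x ^ 2)"
    unfolding p_def q_def by algebra
  have pq3: "p * q = ((1 + x) * (1 - x)) ^ 4" unfolding p_def q_def by algebra
  have pq0: "p - q \<noteq> 0" using pq2 assms nz by auto
  have cancel: "(N / p ^ 2) ^ 3 / (q / p * (D / p) ^ 4) = N ^ 3 / (p * q * D ^ 4)" if "p \<noteq> 0" for p q N D :: complex
  proof -
    have "(p ^ 2) ^ 3 = p * p ^ 5" "p * p ^ 4 = p ^ 5" by algebra+
    then have "(N / p ^ 2) ^ 3 = (N ^ 3 / p) / p ^ 5" "q / p * (D / p) ^ 4 = q * D ^ 4 / p ^ 5"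
      by (simp_all add: power_divide)
    then show ?thesis using that by simp
  qed
  have "octahedral_invariant (q / p) = (p ^ 2 + 14 * q * p + q ^ 2) ^ 3 / (p * q * (p - q) ^ 4)"
  proof -
    have "1 + 14 * (q / p) + (q / p) ^ 2 = (p ^ 2 + 14 * q * p + q ^ 2) / p ^ 2"
      using p0 by (simp add: field_simps power2_eq_square)
    moreover have "1 - q / p = (p - q) / p" using p0 by (simp add: field_simps)
    ultimately have "octahedral_invariant (q / p) = ((p ^ 2 + 14 * q * p + q ^ 2) / p ^ 2) ^ 3 / (q / p * ((p - q) / p) ^ 4)"
      unfolding octahedral_invariant_def by (simp only:)
    also have "\<dots> = (p ^ 2 + 14 * q * p + q ^ 2) ^ 3 / (p * q * (p - q) ^ 4)"
      by (rule cancel[OF p0(1)])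
    finally show ?thesis .
  qed
  also have "\<dots> = (16 * (1 + 14 * x ^ 4 + (x ^ 4) ^ 2)) ^ 3 / (((1 + x) * (1 - x)) ^ 4 * (8 * x * (1 + x ^ 2)) ^ 4)"
    unfolding pq1 pq2 pq3 ..
  also have "((1 + x) * (1 - x)) ^ 4 * (8 * x * (1 + x ^ 2)) ^ 4 = 16 ^ 3 * (x ^ 4 * (1 - x ^ 4) ^ 4)"
    by algebra
  also have "(16 * (1 + 14 * x ^ 4 + (x ^ 4) ^ 2)) ^ 3 / (16 ^ 3 * (x ^ 4 * (1 - x ^ 4) ^ 4)) = octahedral_invariant (x ^ 4)"
    unfolding octahedral_invariant_def power_mult_distrib[of 16] by simp
  finally show ?thesis by (simp only: s)
qed

lemma theta_ratio_small:
  assumes "e > 0"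
  obtains Y where "\<And>z. Im z \<ge> Y \<Longrightarrow> Im z > 0 \<and> norm (theta_ratio z) < e"
proof
  fix z assume z: "Im z \<ge> max 1 (ln (9 / e) + 1)"
  have "norm (theta_ratio z) \<le> 3 * exp (- pi * Im (2 * z) / 4) / (1 / 3)"
    unfolding theta_ratio_def norm_divide
    using theta_10_high(2)[of "2 * z"] theta_0_high[of "2 * z" 0] z by (intro frac_le) auto
  also have "\<dots> = 9 * exp (- pi * Im z / 2)" by simp
  also have "\<dots> \<le> 9 * exp (- Im z)"
    using z mult_right_mono[of 2 pi "Im z"] pi_gt3 by simp
  also have "\<dots> < 9 * exp (- ln (9 / e))" using z by simp
  also have "\<dots> = e" using assms by (simp add: exp_minus)
  finally show "Im z > 0 \<and> norm (theta_ratio z) < e" using z by simp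
qed

lemma octahedral_invariant_large:
  assumes "s \<noteq> 0" "norm s \<le> 1 / 100"
  shows "norm (octahedral_invariant s) \<ge> 1 / (16 * norm s)"
proof -
  have "norm (14 * s + s ^ 2) \<le> norm (14 * s) + norm (s ^ 2)" by (rule norm_triangle_ineq)
  also have "\<dots> \<le> 14 * norm s + norm s * 1"
    unfolding norm_mult norm_power power2_eq_square using assms by (intro add_mono mult_left_mono) auto
  also have "\<dots> \<le> 1 / 2" using assms by simp
  finally have "norm (1 + 14 * s + s ^ 2) \<ge> 1 / 2"
    using norm_triangle_ineq4[of "1 + 14 * s + s ^ 2" "14 * s + s ^ 2"] by simp
  then have num: "norm ((1 + 14 * s + s ^ 2) ^ 3) \<ge> (1 / 2) ^ 3"
    unfolding norm_power by (intro power_mono) auto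
  have "norm (1 - s) \<le> 1 + norm s" using norm_triangle_ineq4[of 1 s] by simp
  then have "norm (1 - s) ^ 4 \<le> (101 / 100) ^ 4" using assms by (intro power_mono) auto
  also have "\<dots> \<le> 2" by (simp add: power4_eq_xxxx)
  finally have "norm (s * (1 - s) ^ 4) \<le> norm s * 2"
    unfolding norm_mult norm_power by (intro mult_left_mono) auto
  moreover have "s \<noteq> 1" using assms by auto
  then have "norm (s * (1 - s) ^ 4) > 0" using assms by simp
  ultimately have "(1 / 2) ^ 3 / (norm s * 2) \<le> norm ((1 + 14 * s + s ^ 2) ^ 3) / norm (s * (1 - s) ^ 4)"
    using num by (intro frac_le) auto
  then show ?thesis
    unfolding octahedral_invariant_def norm_divide using assms by (simp add: power3_eq_cube field_simps)
qed

text \<open>The function \<open>J\<close> is one sixteenth of the modular invariant of Klein.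
  Openness of the image is the open mapping theorem. For closedness, every value of \<open>J\<close>
  is taken in the strip, where a bounded value forces a bounded height.\<close>

lemma theta_invariant_surj:
  obtains z where "Im z > 0" "octahedral_invariant (theta_ratio z ^ 4) = c"
proof -
  define H where "H = {z. Im z > 0}"
  define J where "J z = octahedral_invariant (theta_ratio z ^ 4)" for z
  have H: "open H" "connected H"
    by (simp_all add: H_def open_halfspace_Im_gt convex_connected convex_halfspace_Im_gt)
  have ratio_hol: "theta_ratio holomorphic_on H"
    unfolding theta_ratio_def using H
    by (intro holomorphic_intros) (auto simp: H_def theta_double_nonzero)
  have hol: "J holomorphic_on H"
    unfolding J_def octahedral_invariant_def using theta_ratio_nonzero
    by (intro holomorphic_intros ratio_hol) (auto simp: H_def)
  have large: "\<exists>Y. \<forall>z. Im z \<ge> Y \<longrightarrow> Im z > 0 \<and> norm (J z) > B" for B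
  proof -
    define e where "e = min (1 / 100) (1 / (16 * (\<bar>B\<bar> + 1)))"
    have e: "e > 0" "e \<le> 1 / 100" "e \<le> 1 / (16 * (\<bar>B\<bar> + 1))" by (auto simp: e_def)
    obtain Y where Y: "\<And>z. Im z \<ge> Y \<Longrightarrow> Im z > 0 \<and> norm (theta_ratio z) < e"
      using theta_ratio_small[OF e(1)] by blast
    have "norm (J z) > B" if z: "Im z \<ge> Y" for z
    proof -
      let ?s = "theta_ratio z ^ 4"
      have s0: "?s \<noteq> 0" using theta_ratio_nonzero Y[OF z] by simp
      have "norm ?s = norm (theta_ratio z) * norm (theta_ratio z) ^ 3"
        unfolding norm_power by algebra
      also have "\<dots> \<le> norm (theta_ratio z) * 1"
        using Y[OF z] e by (intro mult_left_mono power_le_one) auto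
      finally have s: "norm ?s < e" using Y[OF z] by simp
      have "\<bar>B\<bar> + 1 = 1 / (16 * (1 / (16 * (\<bar>B\<bar> + 1))))" by simp
      also have "\<dots> \<le> 1 / (16 * norm ?s)"
        using s e s0 by (intro frac_le mult_left_mono) (auto simp del: norm_power)
      also have "\<dots> \<le> norm (J z)"
        unfolding J_def using s s0 e by (intro octahedral_invariant_large) auto
      finally show ?thesis by linarith
    qed
    with Y show ?thesis by blast
  qed
  have nconst: "\<not> J constant_on H"
  proof
    assume "J constant_on H"
    then obtain c where c: "\<And>z. z \<in> H \<Longrightarrow> J z = c" unfolding constant_on_def by auto
    obtain Y where "\<And>z. Im z \<ge> Y \<Longrightarrow> Im z > 0 \<and> norm (J z) > norm c" using large by metis
    from this[of "Complex 0 Y"] c[of "Complex 0 Y"] show False by (simp add: H_def)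
  qed
  have opn: "open (J ` H)"
    by (rule open_mapping_thm[OF hol H(1,2) H(1) order_refl nconst])
  have strip: "\<exists>d. \<bar>Re d\<bar> \<le> 1 / 2 \<and> Im d \<ge> 3 / 4 \<and> J d = J z" if "z \<in> H" for z
  proof -
    have "Im z > 0" using that by (simp add: H_def)
    then show ?thesis
    proof (rule upper_half_plane_modular_induct)
      fix z assume z: "Im z > 0"
      have "J (z + 1) = J z" by (simp add: J_def theta_ratio_add_one power_mult_distrib)
      then show "(\<exists>d. \<bar>Re d\<bar> \<le> 1 / 2 \<and> 3 / 4 \<le> Im d \<and> J d = J (z + 1)) \<longleftrightarrow>
          (\<exists>d. \<bar>Re d\<bar> \<le> 1 / 2 \<and> 3 / 4 \<le> Im d \<and> J d = J z)" by simp
      have "J (- 1 / z) = J z"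
        unfolding J_def theta_ratio_inversion[OF z]
        by (rule octahedral_invariant_involution[OF theta_ratio_nonzero[OF z]])
      then show "\<exists>d. \<bar>Re d\<bar> \<le> 1 / 2 \<and> 3 / 4 \<le> Im d \<and> J d = J (- 1 / z) \<Longrightarrow>
          \<exists>d. \<bar>Re d\<bar> \<le> 1 / 2 \<and> 3 / 4 \<le> Im d \<and> J d = J z" by simp
    qed blast
  qed
  have "closed (J ` H)"
    unfolding closure_subset_eq[symmetric]
  proof
    fix c assume c: "c \<in> closure (J ` H)"
    \<comment> \<open>Above height \<open>Y\<close> no value of \<open>J\<close> lies in
      \<open>ball c 1\<close>. So near \<open>c\<close> the image coincides with the image of a
      compact rectangle.\<close>
    obtain Y where Y: "\<And>z. Im z \<ge> Y \<Longrightarrow> norm (J z) > norm c + 1" using large by metis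
    define D where "D = {z. \<bar>Re z\<bar> \<le> 1 / 2 \<and> 3 / 4 \<le> Im z \<and> Im z \<le> Y}"
    have "D = cbox (Complex (- 1 / 2) (3 / 4)) (Complex (1 / 2) Y)"
      by (auto simp: D_def in_cbox_complex_iff)
    then have "compact D" by simp
    have DH: "D \<subseteq> H" by (auto simp: D_def H_def)
    have "compact (J ` D)"
      using \<open>compact D\<close> holomorphic_on_imp_continuous_on[OF hol] DH
      by (intro compact_continuous_image) (auto intro: continuous_on_subset)
    then have cl: "closed (J ` D)" by (rule compact_imp_closed)
    have "J ` H \<inter> ball c 1 \<subseteq> J ` D"
    proof
      fix v assume v: "v \<in> J ` H \<inter> ball c 1"
      then obtain d where d: "\<bar>Re d\<bar> \<le> 1 / 2" "Im d \<ge> 3 / 4" "J d = v" using strip by blast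
      have "norm v \<le> norm c + norm (c - v)" using norm_triangle_sub[of v c] by (simp add: norm_minus_commute)
      then have "norm v < norm c + 1" using v by (simp add: dist_norm)
      then have "Im d \<le> Y" using Y[of d] d by (smt (verit))
      then show "v \<in> J ` D" using d by (auto simp: D_def)
    qed
    moreover have "c \<in> closure (J ` H \<inter> ball c 1)"
      using c unfolding closure_approachable
    proof (intro allI impI)
      fix e :: real assume *: "\<forall>e>0. \<exists>y\<in>J ` H. dist y c < e" and "e > 0"
      then obtain y where "y \<in> J ` H" "dist y c < min e 1" by (metis min_less_iff_conj zero_less_one)
      then show "\<exists>y\<in>J ` H \<inter> ball c 1. dist y c < e" by (auto simp: dist_commute)
    qed
    ultimately have "c \<in> J ` D" using cl closure_minimal by blast
    then show "c \<in> J ` H" using DH by blast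
  qed
  moreover have "J \<i> \<in> J ` H" by (auto simp: H_def)
  ultimately have "J ` H = UNIV"
    using opn clopen[of "J ` H"] by blast
  then have "c \<in> J ` H" by simp
  with that show ?thesis by (auto simp: H_def J_def)
qed

text \<open>For given \<open>w\<close> this is an equation of degree six in \<open>s\<close>. The
  octahedral orbit of \<open>w\<close> consists of 24 points, and multiplication by
  \<open>\<i>\<close> groups them into six classes with common fourth powers, which are the six
  roots.\<close>

lemma octahedral_invariant_eqD:
  assumes "octahedral_invariant s = octahedral_invariant (w ^ 4)" "s \<noteq> 0" "s \<noteq> 1" "w \<noteq> 0" "w ^ 4 \<noteq> 1"
  shows "s = w ^ 4 \<or> s = (1 / w) ^ 4 \<or> s = ((1 - w) / (1 + w)) ^ 4 \<or> s = ((1 + w) / (1 - w)) ^ 4 \<or>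
     s = ((1 - \<i> * w) / (1 + \<i> * w)) ^ 4 \<or> s = ((1 + \<i> * w) / (1 - \<i> * w)) ^ 4"
proof -
  define v where "v = w ^ 2"
  have "(1 + 14 * s + s ^ 2) ^ 3 * (w ^ 4 * (1 - w ^ 4) ^ 4) = (1 + 14 * w ^ 4 + (w ^ 4) ^ 2) ^ 3 * (s * (1 - s) ^ 4)"
    using assms unfolding octahedral_invariant_def by (subst (asm) frac_eq_eq) auto
  moreover have w4: "w ^ 4 = v ^ 2" unfolding v_def by algebra
  ultimately have 1: "(1 + 14 * s + s ^ 2) ^ 3 * (v ^ 2 * (1 - v ^ 2) ^ 4) = (1 + 14 * v ^ 2 + (v ^ 2) ^ 2) ^ 3 * (s * (1 - s) ^ 4)"
    by (simp only:)
  \<comment> \<open>With \<open>v = w\<^sup>2\<close>, the roots of \<open>?q v\<close> in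
    \<open>s\<close> are the fourth powers of \<open>(1 - w) / (1 + w)\<close> and of its inverse;
    \<open>?q (- v)\<close> is the same for \<open>\<i> * w\<close>.\<close>
  let ?q = "\<lambda>v. (1 - v) ^ 4 * (s ^ 2 + 1) - 2 * s * (1 + 28 * v + 70 * v ^ 2 + 28 * v ^ 3 + v ^ 4)"
  \<comment> \<open>Both invariants are symmetric under inversion of their argument, so they are
    written with \<open>m = 1 + s\<^sup>2\<close> and, for \<open>e = v\<^sup>2\<close>,
    \<open>n = 1 + e\<^sup>2\<close>. The first factor contains the roots \<open>s = e\<close> and
    \<open>s * e = 1\<close>. The second is a difference of squares, because \<open>e\<close> and
    \<open>n + 2 * e = (1 + v\<^sup>2)\<^sup>2\<close> are squares.\<close>
  have factor: "(m + 14 * s) ^ 3 * (e * (n - 2 * e) ^ 2) - (n + 14 * e) ^ 3 * (s * (m - 2 * s) ^ 2) =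
      (m * e - n * s) * (((n + 6 * e) * m - 2 * s * (n + 70 * e)) ^ 2 - 16 * (n + 2 * e) * e * (m + 14 * s) ^ 2)"
    for m n e s :: complex
    by algebra
  define m n where "m = 1 + s ^ 2" and "n = 1 + (v ^ 2) ^ 2"
  have mn: "1 + 14 * s + s ^ 2 = m + 14 * s" "1 + 14 * v ^ 2 + (v ^ 2) ^ 2 = n + 14 * v ^ 2"
    "(1 - s) ^ 4 = (m - 2 * s) ^ 2" "(1 - v ^ 2) ^ 4 = (n - 2 * v ^ 2) ^ 2"
    "(s - v ^ 2) * (v ^ 2 * s - 1) = m * v ^ 2 - n * s"
    unfolding m_def n_def by algebra+
  have q1: "?q v = ((n + 6 * v ^ 2) * m - 2 * s * (n + 70 * v ^ 2)) - 4 * (1 + v ^ 2) * v * (m + 14 * s)"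
    "?q (- v) = ((n + 6 * v ^ 2) * m - 2 * s * (n + 70 * v ^ 2)) + 4 * (1 + v ^ 2) * v * (m + 14 * s)"
    unfolding m_def n_def by algebra+
  have n2: "n + 2 * v ^ 2 = (1 + v ^ 2) ^ 2" unfolding n_def by algebra
  have "?q v * ?q (- v) = ((n + 6 * v ^ 2) * m - 2 * s * (n + 70 * v ^ 2)) ^ 2 - 16 * (n + 2 * v ^ 2) * v ^ 2 * (m + 14 * s) ^ 2"
    unfolding q1 n2 by algebra
  then have "(1 + 14 * s + s ^ 2) ^ 3 * (v ^ 2 * (1 - v ^ 2) ^ 4) - (1 + 14 * v ^ 2 + (v ^ 2) ^ 2) ^ 3 * (s * (1 - s) ^ 4) =
      (s - v ^ 2) * (v ^ 2 * s - 1) * (?q v * ?q (- v))"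
    unfolding mn using factor by (simp only:)
  then have "(s - v ^ 2) * (v ^ 2 * s - 1) * (?q v * ?q (- v)) = 0"
    using 1 by (simp only: diff_self)
  moreover have q: "?q (w ^ 2) = ((1 + w) ^ 4 * s - (1 - w) ^ 4) * ((1 - w) ^ 4 * s - (1 + w) ^ 4)" for w :: complex
    by algebra
  have "- v = (\<i> * w) ^ 2" by (simp add: v_def power_mult_distrib)
  then have "?q (- v) = ((1 + \<i> * w) ^ 4 * s - (1 - \<i> * w) ^ 4) * ((1 - \<i> * w) ^ 4 * s - (1 + \<i> * w) ^ 4)"
    using q[of "\<i> * w"] by (simp only:)
  ultimately have "s - v ^ 2 = 0 \<or> v ^ 2 * s - 1 = 0 \<or> (1 + w) ^ 4 * s - (1 - w) ^ 4 = 0 \<or> (1 - w) ^ 4 * s - (1 + w) ^ 4 = 0 \<or>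
     (1 + \<i> * w) ^ 4 * s - (1 - \<i> * w) ^ 4 = 0 \<or> (1 - \<i> * w) ^ 4 * s - (1 + \<i> * w) ^ 4 = 0"
    using q[of w] unfolding v_def[symmetric] by (simp only: mult_eq_0_iff) blast
  then show ?thesis
    using power4_neq_one_imp[OF assms(5)] assms(4) unfolding w4[symmetric] power_divide
    by (simp add: field_simps)
qed

lemma power4_eqD:
  fixes x y :: complex
  assumes "x ^ 4 = y ^ 4"
  obtains n :: nat where "y = \<i> ^ n * x"
proof -
  have "(y - x) * (y + x) * (y - \<i> * x) * (y + \<i> * x) = 0"
  proof -
    have "(y - \<i> * x) * (y + \<i> * x) = y ^ 2 + x ^ 2"
      by (simp add: algebra_simps power2_eq_square)
    then have "(y - x) * (y + x) * (y - \<i> * x) * (y + \<i> * x) = (y - x) * (y + x) * (y ^ 2 + x ^ 2)"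
      by (simp only: mult.assoc)
    also have "\<dots> = y ^ 4 - x ^ 4" by algebra
    finally show ?thesis by (simp add: assms)
  qed
  then consider "y = x" | "y = - x" | "y = \<i> * x" | "y = - (\<i> * x)"
    by (auto simp: eq_neg_iff_add_eq_0)
  then show ?thesis
  proof cases
    case 1 then show ?thesis using that[of 0] by simp
  next
    case 2 then show ?thesis using that[of 2] by simp
  next
    case 3 then show ?thesis using that[of 1] by simp
  next
    case 4 then show ?thesis using that[of 3] by (simp add: power3_eq_cube)
  qed
qed

text \<open>The range \<open>R\<close> is stable under the octahedral generators and contains some
  value with the invariant of \<open>w\<close>. Equality of invariants puts \<open>w\<close> in the
  orbit of that value.\<close>

lemma theta_ratio_surj:
  assumes w: "w \<noteq> 0" "w ^ 4 \<noteq> 1"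
  obtains z where "Im z > 0" "theta_ratio z = w"
proof -
  define R where "R = theta_ratio ` {z. Im z > 0}"
  have R_nz: "x \<noteq> 0" "x ^ 4 \<noteq> 1" if "x \<in> R" for x
    using that theta_ratio_nonzero by (auto simp: R_def)
  have R_i: "\<i> * x \<in> R" if x: "x \<in> R" for x
  proof -
    obtain z where z: "Im z > 0" "x = theta_ratio z" using x by (auto simp: R_def)
    then have "theta_ratio (z + 1) \<in> R" by (auto simp: R_def)
    then show ?thesis by (simp add: z theta_ratio_add_one)
  qed
  have R_pow: "\<i> ^ n * x \<in> R" if x: "x \<in> R" for x n
    by (induction n) (use x R_i in \<open>auto simp: mult.assoc\<close>)
  have R4: "y \<in> R" if x: "x \<in> R" and xy: "x ^ 4 = y ^ 4" for x y
  proof -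
    obtain n where "y = \<i> ^ n * x" using power4_eqD[OF xy] .
    then show ?thesis using R_pow[OF x] by (simp only:)
  qed
  have R_inv: "(1 - x) / (1 + x) \<in> R" if x: "x \<in> R" for x
  proof -
    obtain z where z: "Im z > 0" "x = theta_ratio z" using x by (auto simp: R_def)
    have "theta_ratio (- 1 / z) \<in> R"
      unfolding R_def using Im_minus_inverse_pos[OF z(1)] by blast
    then show ?thesis by (simp only: z theta_ratio_inversion[OF z(1)])
  qed
  have R_inv': "x \<in> R" if "(1 - x) / (1 + x) \<in> R" "1 + x \<noteq> 0" for x
    using R_inv[OF that(1)] by (simp only: cayley_involution[OF that(2)])
  have R_neg: "x \<in> R" if "- x \<in> R" for x
    by (rule R4[OF that]) simp
  have R_ii: "x \<in> R" if "\<i> * x \<in> R" for x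
    by (rule R4[OF that]) (simp add: power_mult_distrib)
  note nz = power4_neq_one_imp[OF w(2)]
  obtain z where z: "Im z > 0" "octahedral_invariant (theta_ratio z ^ 4) = octahedral_invariant (w ^ 4)"
    using theta_invariant_surj .
  let ?x = "theta_ratio z"
  have x: "?x \<in> R" using z by (auto simp: R_def)
  have "?x ^ 4 = w ^ 4 \<or> ?x ^ 4 = (1 / w) ^ 4 \<or> ?x ^ 4 = ((1 - w) / (1 + w)) ^ 4 \<or> ?x ^ 4 = ((1 + w) / (1 - w)) ^ 4 \<or>
     ?x ^ 4 = ((1 - \<i> * w) / (1 + \<i> * w)) ^ 4 \<or> ?x ^ 4 = ((1 + \<i> * w) / (1 - \<i> * w)) ^ 4"
    using theta_ratio_nonzero[OF z(1)] by (intro octahedral_invariant_eqD z w) auto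
  then have "w \<in> R"
  proof (elim disjE)
    assume "?x ^ 4 = (1 / w) ^ 4"
    then have "1 / w \<in> R" by (rule R4[OF x])
    \<comment> \<open>Inversion of \<open>w\<close> is composed of the available maps: the transform
      of \<open>1 / w\<close> is the negative of the transform of \<open>w\<close>, so a sign change
      followed by the transform gives \<open>w\<close>.\<close>
    then have "(1 - 1 / w) / (1 + 1 / w) \<in> R" by (rule R_inv)
    then have "- (- ((1 - 1 / w) / (1 + 1 / w))) \<in> R" by (simp only: minus_minus)
    then have 1: "- ((1 - 1 / w) / (1 + 1 / w)) \<in> R" by (rule R_neg)
    have "1 - 1 / w = (w - 1) / w" "1 + 1 / w = (1 + w) / w"
      using w(1) by (simp_all add: diff_divide_distrib add_divide_distrib)
    then have "(1 - 1 / w) / (1 + 1 / w) = (w - 1) / (1 + w)"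
      using w(1) by simp
    then have "- ((1 - 1 / w) / (1 + 1 / w)) = (1 - w) / (1 + w)"
      by (simp only: minus_divide_left minus_diff_eq)
    then have "(1 - - ((1 - 1 / w) / (1 + 1 / w))) / (1 + - ((1 - 1 / w) / (1 + 1 / w))) = w"
      using cayley_involution[OF nz(1)] by (simp only:)
    with R_inv[OF 1] show ?thesis by (simp only:)
  next
    assume "?x ^ 4 = ((1 - w) / (1 + w)) ^ 4"
    then have "(1 - w) / (1 + w) \<in> R" by (rule R4[OF x])
    then show ?thesis by (rule R_inv') (rule nz)
  next
    assume "?x ^ 4 = ((1 + w) / (1 - w)) ^ 4"
    then have "(1 - - w) / (1 + - w) \<in> R" using R4[OF x] by simp
    then have "- w \<in> R" by (rule R_inv') (use nz in simp)
    then show ?thesis by (rule R_neg)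
  next
    assume "?x ^ 4 = ((1 - \<i> * w) / (1 + \<i> * w)) ^ 4"
    then have "(1 - \<i> * w) / (1 + \<i> * w) \<in> R" by (rule R4[OF x])
    then have "\<i> * w \<in> R" by (rule R_inv') (rule nz)
    then show ?thesis by (rule R_ii)
  next
    assume "?x ^ 4 = ((1 + \<i> * w) / (1 - \<i> * w)) ^ 4"
    then have "(1 - - (\<i> * w)) / (1 + - (\<i> * w)) \<in> R" using R4[OF x] by simp
    then have "- (\<i> * w) \<in> R" by (rule R_inv') (use nz in simp)
    then show ?thesis by (rule R_ii[OF R_neg])
  qed (rule R4[OF x])
  with that show ?thesis by (auto simp: R_def)
qed

text \<open>The substitution \<open>z \<mapsto> z / (1 - 4 * z)\<close> fixes \<open>theta_ratio\<close> but changes the sign of the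
  square root.\<close>

lemma theta_curve_sign_change:
  assumes z: "Im z > 0"
  obtains z' where "Im z' > 0" "theta_ratio z' = theta_ratio z"
    "theta 0 0 z' * theta 0 1 z' / theta 0 0 (2 * z') ^ 2 = - (theta 0 0 z * theta 0 1 z / theta 0 0 (2 * z) ^ 2)"
proof -
  define g where "g z = theta 0 0 z * theta 0 1 z / theta 0 0 (2 * z) ^ 2" for z
  define h where "h z = theta 0 0 z * theta 1 0 z / theta 0 0 (2 * z) ^ 2" for z
  obtain e k where ek: "e ^ 2 = (1 :: complex)" "\<And>z. Im z > 0 \<Longrightarrow> k z \<noteq> 0"
    and k: "\<And>z. Im z > 0 \<Longrightarrow> theta 0 0 (- 1 / z) = k z * theta 0 0 z"
    "\<And>z. Im z > 0 \<Longrightarrow> theta 1 0 (- 1 / z) = k z * theta 0 1 z"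
    "\<And>z. Im z > 0 \<Longrightarrow> theta 0 1 (- 1 / z) = k z * theta 1 0 z"
    and k2: "\<And>z. Im z > 0 \<Longrightarrow> of_real (sqrt 2) * theta 0 0 (2 * (- 1 / z)) = e * k z * (theta 0 0 (2 * z) + theta 1 0 (2 * z))"
    using theta_inversion_uniform by metis
  have sq: "theta 0 0 (2 * (- 1 / z)) ^ 2 = k z ^ 2 * theta 0 0 (2 * z) ^ 2 * (1 + theta_ratio z) ^ 2 / 2" if z: "Im z > 0" for z
  proof -
    have "2 * theta 0 0 (2 * (- 1 / z)) ^ 2 = (of_real (sqrt 2) * theta 0 0 (2 * (- 1 / z))) ^ 2"
      by (simp add: power_mult_distrib flip: of_real_power)
    also have "\<dots> = k z ^ 2 * (theta 0 0 (2 * z) + theta 1 0 (2 * z)) ^ 2"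
      unfolding k2[OF z] power_mult_distrib ek(1) by simp
    also have "theta 0 0 (2 * z) + theta 1 0 (2 * z) = theta 0 0 (2 * z) * (1 + theta_ratio z)"
      using theta_double_nonzero[OF z] by (simp add: theta_ratio_def field_simps)
    finally show ?thesis by (simp add: power_mult_distrib mult_ac)
  qed
  \<comment> \<open>Inversion exchanges \<open>theta 0 1\<close> with \<open>theta 1 0\<close>,
    hence \<open>g\<close> with \<open>h\<close>, up to a common factor. Thus a sign change of
    \<open>h\<close> can be conjugated into one of \<open>g\<close>.\<close>
  have inv: "g (- 1 / z) = 2 * h z / (1 + theta_ratio z) ^ 2" "h (- 1 / z) = 2 * g z / (1 + theta_ratio z) ^ 2" if z: "Im z > 0" for z
    unfolding g_def h_def sq[OF z] k[OF z] using ek(2)[OF z]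
    by (simp_all add: power2_eq_square mult_ac)
  \<comment> \<open>A unit translation multiplies the ratio by \<open>\<i>\<close> and
    \<open>theta 1 0\<close> by a primitive eighth root of unity. Four of them fix the ratio and
    change the sign of \<open>theta 1 0\<close>.\<close>
  have four: "h (z + 4) = - h z" "theta_ratio (z + 4) = theta_ratio z"
  for z
  proof -
    have e: "z + 4 = z + 1 + 1 + 1 + 1" by simp
    have "exp (of_real pi * \<i> / 4) ^ 4 = -1"
      by (simp flip: exp_of_nat_mult)
    then have th10: "theta 1 0 (z + 1 + 1 + 1 + 1) = - theta 1 0 z"
      unfolding theta_10_add_one by (simp add: power4_eq_xxxx mult.assoc[symmetric])
    have "theta 0 0 (z + 1 + 1 + 1 + 1) = theta 0 0 z"
      unfolding theta_00_add_one theta_01_add_one ..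
    moreover have "theta 0 0 (2 * (z + 1 + 1 + 1 + 1)) = theta 0 0 (2 * z)"
      unfolding theta_double_add_one ..
    ultimately show "h (z + 4) = - h z" unfolding h_def e th10 by simp
    show "theta_ratio (z + 4) = theta_ratio z"
      unfolding e theta_ratio_add_one by (simp add: mult.assoc[symmetric])
  qed
  \<comment> \<open>With this \<open>u\<close> the point \<open>- 1 / u\<close> equals
    \<open>z / (1 - 4 * z)\<close>: the translation by four conjugated by the inversion.\<close>
  define u where "u = - 1 / z + 4"
  have u: "Im u > 0" using Im_minus_inverse_pos[OF z] by (simp add: u_def)
  have z1: "Im (- 1 / z) > 0" by (rule Im_minus_inverse_pos[OF z])
  let ?x = "theta_ratio z"
  have x: "1 + ?x \<noteq> 0" using power4_neq_one_imp theta_ratio_nonzero[OF z] by blast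
  have ru: "theta_ratio u = (1 - ?x) / (1 + ?x)"
    unfolding u_def four theta_ratio_inversion[OF z] ..
  have prod: "(1 + ?x) * (1 + theta_ratio u) = 2" 
  proof -
    have "(1 + ?x) * ((1 - ?x) / (1 + ?x)) = 1 - ?x"
      by (simp only: times_divide_eq_right nonzero_mult_div_cancel_left[OF x])
    then show ?thesis unfolding ru by (simp only: distrib_left mult_1_right) simp
  qed
  show ?thesis
  proof (rule that[of "- 1 / u"])
    show "Im (- 1 / u) > 0" by (rule Im_minus_inverse_pos[OF u])
    show "theta_ratio (- 1 / u) = theta_ratio z"
      unfolding theta_ratio_inversion[OF u] ru by (rule cayley_involution[OF x])
    have "g (- 1 / u) = 2 * h u / (1 + theta_ratio u) ^ 2" by (rule inv[OF u])
    also have "h u = - (2 * g z / (1 + ?x) ^ 2)" unfolding u_def four inv[OF z] ..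
    also have "2 * - (2 * g z / (1 + ?x) ^ 2) / (1 + theta_ratio u) ^ 2 = - (4 * g z / ((1 + ?x) * (1 + theta_ratio u)) ^ 2)"
      by (simp add: power_mult_distrib)
    also have "\<dots> = - g z" unfolding prod by simp
    finally show "theta 0 0 (- 1 / u) * theta 0 1 (- 1 / u) / theta 0 0 (2 * (- 1 / u)) ^ 2 = - (theta 0 0 z * theta 0 1 z / theta 0 0 (2 * z) ^ 2)"
      by (simp only: g_def)
  qed
qed

lemma theta_curve_surj:
  assumes t: "t \<noteq> 0" "t ^ 4 \<noteq> 1" and y: "y ^ 2 = 1 - t ^ 4"
  obtains z where "Im z > 0" "theta 1 0 (2 * z) = t * theta 0 0 (2 * z)"
    "theta 0 0 z * theta 0 1 z = y * theta 0 0 (2 * z) ^ 2"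
proof -
  obtain z where z: "Im z > 0" "theta_ratio z = t" using theta_ratio_surj[OF t] .
  define g where "g z = theta 0 0 z * theta 0 1 z / theta 0 0 (2 * z) ^ 2" for z
  have "g z ^ 2 = y ^ 2"
    unfolding g_def power_divide theta_fourth_powers[OF z(1)] y z(2)[symmetric] theta_ratio_def
    using theta_double_nonzero[OF z(1)] by (simp add: diff_divide_distrib flip: power_mult)
  then have "g z = y \<or> g z = - y" by (simp add: power2_eq_iff)
  moreover obtain z2 where z2: "Im z2 > 0" "theta_ratio z2 = theta_ratio z" "g z2 = - g z"
    using theta_curve_sign_change[OF z(1), folded g_def] .
  ultimately have "\<exists>z'. Im z' > 0 \<and> theta_ratio z' = t \<and> g z' = y"
  proof (elim disjE)
    assume "g z = y"
    with z show ?thesis by blast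
  next
    assume "g z = - y"
    with z z2 show ?thesis by (intro exI[of _ z2]) simp
  qed
  then obtain z' where z': "Im z' > 0" "theta_ratio z' = t" "g z' = y" by blast
  have "theta 1 0 (2 * z') = theta_ratio z' * theta 0 0 (2 * z')"
    "theta 0 0 z' * theta 0 1 z' = g z' * theta 0 0 (2 * z') ^ 2"
    using theta_double_nonzero(1)[OF z'(1)] by (simp_all add: theta_ratio_def g_def)
  from this[unfolded z'(2,3)] show ?thesis
    by (rule that[OF z'(1)])
qed

section \<open>Projective space\<close>

lemma proj_cases:
  obtains x where "x \<noteq> 0" "p = pt x"
proof -
  obtain x where "x \<noteq> 0" "Rep_proj p = range (\<lambda>c. c *s x)"
    using Rep_proj[of p] by auto
  then have "p = pt x" unfolding pt_def by (metis Rep_proj_inverse)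
  with \<open>x \<noteq> 0\<close> that show ?thesis by blast
qed

lemma pt_scale:
  assumes "c \<noteq> 0"
  shows "pt (c *s x) = pt x"
proof -
  have "range (\<lambda>k. k *s (c *s x)) = range (\<lambda>k. k *s x)"
  proof (intro equalityI subsetI)
    fix v assume "v \<in> range (\<lambda>k. k *s x)"
    then obtain k where "v = k *s x" by blast
    then have "v = (k / c) *s (c *s x)" using assms by (simp add: vector_smult_assoc)
    then show "v \<in> range (\<lambda>k. k *s (c *s x))" by blast
  qed (auto simp: vector_smult_assoc)
  then show ?thesis by (simp add: pt_def)
qed

lemma pt_eq_iff:
  assumes "x \<noteq> 0" "y \<noteq> 0"
  shows "pt x = pt y \<longleftrightarrow> (\<exists>c. c \<noteq> 0 \<and> y = c *s x)"
proof
  assume "pt x = pt y"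
  moreover have "range (\<lambda>c. c *s x) \<in> {range (\<lambda>c. c *s x) | x. x \<noteq> 0}"
    "range (\<lambda>c. c *s y) \<in> {range (\<lambda>c. c *s x) | x. x \<noteq> 0}"
    using assms by blast+
  ultimately have "range (\<lambda>c. c *s x) = range (\<lambda>c. c *s y)"
    unfolding pt_def by (simp only: Abs_proj_inject)
  moreover have "y \<in> range (\<lambda>c. c *s y)" by (rule range_eqI[of _ _ 1]) simp
  ultimately obtain c where c: "y = c *s x" by blast
  moreover have "c \<noteq> 0" using c assms by auto
  ultimately show "\<exists>c. c \<noteq> 0 \<and> y = c *s x" by blast
next
  assume "\<exists>c. c \<noteq> 0 \<and> y = c *s x"
  then show "pt x = pt y" using pt_scale by metis
qed

section \<open>Forms\<close>

definition monomial :: "('n::finite \<Rightarrow> nat) \<Rightarrow> complex ^ 'n \<Rightarrow> complex" where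
  "monomial e x = (\<Prod>i\<in>UNIV. x $ i ^ e i)"

lemma forms_def': "forms d = {F. \<exists>c. F = (\<lambda>x. \<Sum>e | sum e UNIV = d. c e * monomial e x)}"
  by (simp add: forms_def monomial_def)

lemma finite_exponents: "finite {e :: 'n::finite \<Rightarrow> nat. sum e UNIV = d}"
proof (rule finite_subset)
  show "{e :: 'n \<Rightarrow> nat. sum e UNIV = d} \<subseteq> PiE UNIV (\<lambda>_. {..d})"
    by (auto simp: PiE_def extensional_def intro: member_le_sum)
  show "finite (PiE (UNIV :: 'n set) (\<lambda>_. {..d}))"
    by (intro finite_PiE) auto
qed

lemma forms_zero: "(\<lambda>x. 0) \<in> forms d"
  unfolding forms_def by (intro CollectI exI[of _ "\<lambda>_. 0"]) simp

lemma forms_add: "F \<in> forms d \<Longrightarrow> G \<in> forms d \<Longrightarrow> (\<lambda>x. F x + G x) \<in> forms d"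
  unfolding forms_def
proof clarify
  fix c c' :: "('a \<Rightarrow> nat) \<Rightarrow> complex"
  show "\<exists>c''. (\<lambda>x. (\<Sum>e | sum e UNIV = d. c e * (\<Prod>i\<in>UNIV. x $ i ^ e i)) + (\<Sum>e | sum e UNIV = d. c' e * (\<Prod>i\<in>UNIV. x $ i ^ e i))) =
      (\<lambda>x. \<Sum>e | sum e UNIV = d. c'' e * (\<Prod>i\<in>UNIV. x $ i ^ e i))"
    by (rule exI[of _ "\<lambda>e. c e + c' e"]) (simp add: sum.distrib distrib_right)
qed

lemma forms_cmult: "F \<in> forms d \<Longrightarrow> (\<lambda>x. k * F x) \<in> forms d"
  unfolding forms_def
proof clarify
  fix c :: "('a \<Rightarrow> nat) \<Rightarrow> complex"
  show "\<exists>c''. (\<lambda>x. k * (\<Sum>e | sum e UNIV = d. c e * (\<Prod>i\<in>UNIV. x $ i ^ e i))) =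
      (\<lambda>x. \<Sum>e | sum e UNIV = d. c'' e * (\<Prod>i\<in>UNIV. x $ i ^ e i))"
    by (rule exI[of _ "\<lambda>e. k * c e"]) (simp add: sum_distrib_left mult.assoc)
qed

lemma forms_diff: "F \<in> forms d \<Longrightarrow> G \<in> forms d \<Longrightarrow> (\<lambda>x. F x - G x) \<in> forms d"
  using forms_add[OF _ forms_cmult[of G d "-1"], of F] by simp

lemma forms_sum: "(\<And>a. a \<in> A \<Longrightarrow> F a \<in> forms d) \<Longrightarrow> (\<lambda>x. \<Sum>a\<in>A. F a x) \<in> forms d"
  by (induction A rule: infinite_finite_induct) (auto intro: forms_zero forms_add)

lemma monomial_in_forms:
  fixes e :: "'n::finite \<Rightarrow> nat"
  shows "monomial e \<in> forms (sum e UNIV)"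
proof -
  have "monomial e x = (\<Sum>e' | sum e' UNIV = sum e UNIV. (if e' = e then 1 else 0) * monomial e' x)" for x
  proof -
    have "(\<Sum>e' | sum e' UNIV = sum e UNIV. (if e' = e then 1 else 0) * monomial e' x) =
        (\<Sum>e' | sum e' UNIV = sum e UNIV. (if e' = e then monomial e x else 0))"
      by (rule sum.cong) auto
    then show ?thesis by (simp add: sum.delta' finite_exponents)
  qed
  then show ?thesis
    unfolding forms_def' by (intro CollectI exI[of _ "\<lambda>e'. if e' = e then 1 else 0"] ext)
qed

lemma monomial_increment:
  "monomial (e(i := Suc (e i))) x = x $ i * monomial e x"
  "sum (e(i := Suc (e i))) UNIV = Suc (sum e UNIV)"
proof -
  show "monomial (e(i := Suc (e i))) x = x $ i * monomial e x"
    by (simp add: monomial_def prod.remove[of UNIV i])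
  show "sum (e(i := Suc (e i))) UNIV = Suc (sum e UNIV)"
    by (simp add: sum.remove[of UNIV i])
qed

lemma forms_coord_mult:
  assumes "F \<in> forms d"
  shows "(\<lambda>x. x $ i * F x) \<in> forms (Suc d)"
proof -
  obtain c where c: "F = (\<lambda>x. \<Sum>e | sum e UNIV = d. c e * monomial e x)"
    using assms unfolding forms_def' by blast
  have "(\<lambda>x. \<Sum>e | sum e UNIV = d. c e * (x $ i * monomial e x)) \<in> forms (Suc d)"
  proof (intro forms_sum forms_cmult)
    fix e :: "'a \<Rightarrow> nat" assume "e \<in> {e. sum e UNIV = d}"
    then show "(\<lambda>x. x $ i * monomial e x) \<in> forms (Suc d)"
      using monomial_in_forms[of "e(i := Suc (e i))"] by (simp only: monomial_increment[abs_def] mem_Collect_eq)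
  qed
  then show ?thesis by (simp add: c sum_distrib_left mult.left_commute)
qed

text \<open>Forms are built by multiplying with one coordinate at a time. This is the step in which
  derivatives and normal forms are easy to follow.\<close>

lemma forms_induct [consumes 1, case_names zero add cmult one coord]:
  fixes F :: "complex ^ 'n::finite \<Rightarrow> complex"
  assumes F: "F \<in> forms d"
    and zero: "\<And>d. P d (\<lambda>x. 0)"
    and add: "\<And>d F G. P d F \<Longrightarrow> P d G \<Longrightarrow> P d (\<lambda>x. F x + G x)"
    and cmult: "\<And>d F k. P d F \<Longrightarrow> P d (\<lambda>x. k * F x)"
    and one: "P 0 (\<lambda>x. 1)"
    and coord: "\<And>d F i. P d F \<Longrightarrow> P (Suc d) (\<lambda>x. x $ i * F x)"
  shows "P d F"
proof -
  have mono: "P (sum e UNIV) (monomial e)" for e :: "'n \<Rightarrow> nat"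
  proof (induction "sum e UNIV" arbitrary: e)
    case 0
    then have "e i = 0" for i by simp
    then have "monomial e = (\<lambda>x. 1)" by (simp add: monomial_def fun_eq_iff)
    then show ?case using one "0.hyps"[symmetric] by (simp only:)
  next
    case (Suc n)
    then obtain i where "e i \<noteq> 0" by fastforce
    then obtain k where k: "e i = Suc k" using not0_implies_Suc by blast
    define e' where "e' = e(i := k)"
    have e: "e = e'(i := Suc (e' i))" by (auto simp: e'_def k fun_eq_iff)
    have "n = sum e' UNIV" using Suc.hyps(2) monomial_increment(2)[of e' i] e by simp
    then have "P (sum e' UNIV) (monomial e')" using Suc.hyps(1) by simp
    then have "P (Suc (sum e' UNIV)) (\<lambda>x. x $ i * monomial e' x)" by (rule coord)
    then show ?case
      using monomial_increment[of e' i] by (simp only: e[symmetric] flip: monomial_increment[abs_def])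
  qed
  obtain c where c: "F = (\<lambda>x. \<Sum>e | sum e UNIV = d. c e * monomial e x)"
    using F unfolding forms_def' by blast
  have "P d (\<lambda>x. \<Sum>e\<in>X. c e * monomial e x)" if "finite X" "X \<subseteq> {e. sum e UNIV = d}" for X
    using that
  proof (induction X)
    case empty
    then show ?case using zero by simp
  next
    case (insert e X)
    then have "P d (monomial e)" using mono[of e] by auto
    then show ?case using insert by (simp add: add cmult)
  qed
  then show ?thesis using finite_exponents c by blast
qed

lemma forms_const: "(\<lambda>x :: complex ^ 'n::finite. k) \<in> forms 0"
proof -
  have "(\<lambda>x. k * monomial (\<lambda>_ :: 'n. 0) x) \<in> forms (sum (\<lambda>_ :: 'n. 0) UNIV)"
    using forms_cmult[OF monomial_in_forms[of "\<lambda>_. 0"]] .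
  then show ?thesis by (simp add: monomial_def)
qed

lemma forms_coord: "(\<lambda>x. x $ i) \<in> forms 1"
  using forms_coord_mult[OF forms_const[of 1], of i] by (simp add: One_nat_def)

lemma forms_mult:
  assumes "F \<in> forms d" "G \<in> forms e"
  shows "(\<lambda>x. F x * G x) \<in> forms (d + e)"
  using assms(1)
proof (induction rule: forms_induct)
  case (coord d F i)
  from forms_coord_mult[OF coord, of i] show ?case by (simp add: mult.assoc)
qed (use assms(2) in \<open>auto simp: distrib_right mult.assoc intro: forms_zero forms_add forms_cmult\<close>)

lemma forms_power:
  assumes "F \<in> forms d"
  shows "(\<lambda>x. F x ^ n) \<in> forms (n * d)"
proof (induction n)
  case 0
  then show ?case using forms_const[of 1] by simp
next
  case (Suc n)
  then show ?case using forms_mult[OF assms Suc] by simp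
qed

lemma forms_linear: "(\<lambda>x. (M *v x) $ i) \<in> forms 1"
  unfolding matrix_vector_mult_def by (simp, intro forms_sum forms_cmult forms_coord)

lemma forms_homogeneous:
  assumes "F \<in> forms d"
  shows "F (k *s x) = k ^ d * F x"
  using assms by (induction rule: forms_induct) (auto simp: algebra_simps)

subsection \<open>Derivatives\<close>

lemma forms_has_some_derivative:
  assumes "F \<in> forms d"
  shows "\<exists>g. (F has_derivative (\<lambda>h. \<Sum>i\<in>UNIV. g $ i * h $ i)) (at x)"
  using assms
proof (induction rule: forms_induct)
  case (zero d)
  show ?case by (rule exI[of _ 0]) simp
next
  case (add d F G)
  then obtain g g' where "(F has_derivative (\<lambda>h. \<Sum>i\<in>UNIV. g $ i * h $ i)) (at x)"
    "(G has_derivative (\<lambda>h. \<Sum>i\<in>UNIV. g' $ i * h $ i)) (at x)" by blast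
  from has_derivative_add[OF this] show ?case
    by (intro exI[of _ "g + g'"]) (simp add: sum.distrib distrib_right)
next
  case (cmult d F k)
  then obtain g where "(F has_derivative (\<lambda>h. \<Sum>i\<in>UNIV. g $ i * h $ i)) (at x)" by blast
  from has_derivative_mult_right[OF this, of k] show ?case
    by (intro exI[of _ "k *s g"]) (simp add: sum_distrib_left mult.assoc)
next
  case one
  show ?case by (rule exI[of _ 0]) simp
next
  case (coord d F i)
  then obtain g where g: "(F has_derivative (\<lambda>h. \<Sum>i\<in>UNIV. g $ i * h $ i)) (at x)" by blast
  have "((\<lambda>x. x $ i) has_derivative (\<lambda>h. h $ i)) (at x)"
    by (intro bounded_linear_imp_has_derivative bounded_linear_vec_nth)
  from has_derivative_mult[OF this g]
  have "((\<lambda>x. x $ i * F x) has_derivative (\<lambda>h. x $ i * (\<Sum>j\<in>UNIV. g $ j * h $ j) + h $ i * F x)) (at x)" .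
  moreover have "x $ i * (\<Sum>j\<in>UNIV. g $ j * h $ j) + h $ i * F x =
      (\<Sum>j\<in>UNIV. (\<chi> j. x $ i * g $ j + (if j = i then F x else 0)) $ j * h $ j)" for h
  proof -
    have "(\<Sum>j\<in>UNIV. (if j = i then F x else 0) * h $ j) = (\<Sum>j\<in>UNIV. if j = i then F x * h $ i else 0)"
      by (rule sum.cong) auto
    then show ?thesis
      by (simp add: distrib_right sum.distrib sum_distrib_left mult.assoc sum.delta')
  qed
  ultimately show ?case by (metis (no_types, lifting) ext)
qed

lemma has_derivative_smult_axis:
  fixes x v :: "complex ^ 'n"
  shows "((\<lambda>t. x + t *s v) has_derivative (\<lambda>t. t *s v)) F"
proof -
  have "linear (\<lambda>t. t *s v)"
    by (rule linearI) (simp_all add: vec_eq_iff distrib_right)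
  then have "bounded_linear (\<lambda>t. t *s v)"
    by (simp add: linear_conv_bounded_linear)
  then have "((\<lambda>t. t *s v) has_derivative (\<lambda>t. t *s v)) F"
    by (rule bounded_linear_imp_has_derivative)
  from has_derivative_add[OF has_derivative_const this] show ?thesis by simp
qed

lemma gradient_eqI:
  assumes "(F has_derivative (\<lambda>h. \<Sum>i\<in>UNIV. g $ i * h $ i)) (at x)"
  shows "gradient F x = g"
proof -
  have "gradient F x $ i = g $ i" for i
  proof -
    have F0: "(F has_derivative (\<lambda>h. \<Sum>i\<in>UNIV. g $ i * h $ i)) (at (x + 0 *s axis i 1))"
      using assms by simp
    from has_derivative_compose[OF has_derivative_smult_axis F0]
    have "((\<lambda>t. F (x + t *s axis i 1)) has_derivative (\<lambda>t. \<Sum>j\<in>UNIV. g $ j * (t *s axis i 1) $ j)) (at 0)" .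
    moreover have "(\<Sum>j\<in>UNIV. g $ j * (t *s axis i 1) $ j) = g $ i * t" for t
    proof -
      have "(\<Sum>j\<in>UNIV. g $ j * (t *s axis i 1) $ j) = (\<Sum>j\<in>UNIV. if j = i then g $ i * t else 0)"
        by (rule sum.cong) (auto simp: axis_def)
      then show ?thesis by (simp add: sum.delta')
    qed
    ultimately have "((\<lambda>t. F (x + t *s axis i 1)) has_field_derivative g $ i) (at 0)"
      by (simp add: has_field_derivative_def)
    then show ?thesis
      by (simp add: gradient_def DERIV_imp_deriv)
  qed
  then show ?thesis by (simp add: vec_eq_iff)
qed

lemma forms_has_derivative:
  assumes "F \<in> forms d"
  shows "(F has_derivative (\<lambda>h. \<Sum>i\<in>UNIV. gradient F x $ i * h $ i)) (at x)"
  using forms_has_some_derivative[OF assms, of x] gradient_eqI[of F _ x] by auto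

section \<open>Zariski closed sets\<close>

lemma vanishing_forms_iff:
  "F \<in> vanishing_forms d S \<longleftrightarrow> F \<in> forms d \<and> (\<forall>x. x \<noteq> 0 \<longrightarrow> pt x \<in> S \<longrightarrow> F x = 0)"
  by (auto simp: vanishing_forms_def)

lemma zariski_closedI:
  assumes "\<And>x. x \<noteq> 0 \<Longrightarrow> pt x \<notin> S \<Longrightarrow> \<exists>d. \<exists>F\<in>vanishing_forms d S. F x \<noteq> 0"
  shows "zariski_closed S"
  unfolding zariski_closed_def using assms by blast

lemma zariski_closedD:
  assumes "zariski_closed S" "x \<noteq> 0" "pt x \<notin> S"
  obtains d F where "F \<in> vanishing_forms d S" "F x \<noteq> 0"
  using assms unfolding zariski_closed_def by blast

lemma zariski_closed_empty: "zariski_closed {}"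
proof (rule zariski_closedI)
  fix x :: "complex ^ 'a"
  have "(\<lambda>x. 1) \<in> vanishing_forms 0 {}" by (simp add: vanishing_forms_iff forms_const)
  then show "\<exists>d. \<exists>F\<in>vanishing_forms d {}. F x \<noteq> 0" by (intro exI bexI) auto
qed

lemma zariski_closed_Un:
  assumes "zariski_closed S" "zariski_closed T"
  shows "zariski_closed (S \<union> T)"
proof (rule zariski_closedI)
  fix x assume x: "x \<noteq> 0" "pt x \<notin> S \<union> T"
  have "pt x \<notin> S" "pt x \<notin> T" using x(2) by auto
  obtain d F where F: "F \<in> vanishing_forms d S" "F x \<noteq> 0"
    using zariski_closedD[OF assms(1) x(1) \<open>pt x \<notin> S\<close>] .
  obtain e G where G: "G \<in> vanishing_forms e T" "G x \<noteq> 0"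
    using zariski_closedD[OF assms(2) x(1) \<open>pt x \<notin> T\<close>] .
  have "(\<lambda>x. F x * G x) \<in> vanishing_forms (d + e) (S \<union> T)"
    using F(1) G(1) by (auto simp: vanishing_forms_iff forms_mult)
  then show "\<exists>d. \<exists>F\<in>vanishing_forms d (S \<union> T). F x \<noteq> 0"
    using F(2) G(2) by (intro exI bexI) auto
qed

lemma zariski_closed_point: "zariski_closed {p}"
proof (rule zariski_closedI)
  obtain y where y: "y \<noteq> 0" "p = pt y" by (rule proj_cases)
  fix x assume x: "x \<noteq> 0" "pt x \<notin> {p}"
  obtain j where j: "y $ j \<noteq> 0" using y(1) by (auto simp: vec_eq_iff)
  have "\<exists>i. x $ i * y $ j - x $ j * y $ i \<noteq> 0"
  proof (rule ccontr)
    assume "\<not> ?thesis"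
    then have x_eq: "x = (x $ j / y $ j) *s y"
      using j by (simp add: vec_eq_iff field_simps)
    then have "x $ j / y $ j \<noteq> 0" using x(1) by (metis vector_smult_lzero)
    then have "pt x = pt y" using x_eq pt_scale by metis
    with x(2) y(2) show False by simp
  qed
  then obtain i where i: "x $ i * y $ j - x $ j * y $ i \<noteq> 0" by blast
  have "(\<lambda>x. y $ j * x $ i - y $ i * x $ j) \<in> vanishing_forms 1 {p}"
    unfolding vanishing_forms_iff
  proof (intro conjI allI impI)
    show "(\<lambda>x. y $ j * x $ i - y $ i * x $ j) \<in> forms 1"
      by (intro forms_diff forms_cmult forms_coord)
    fix x assume "x \<noteq> 0" "pt x \<in> {p}"
    then obtain c where "x = c *s y" using y pt_eq_iff[of y x] by auto
    then show "y $ j * x $ i - y $ i * x $ j = 0" by (simp add: algebra_simps)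
  qed
  then show "\<exists>d. \<exists>F\<in>vanishing_forms d {p}. F x \<noteq> 0"
    using i by (intro exI bexI) (auto simp: mult.commute)
qed

lemma zariski_closed_finite:
  assumes "finite S"
  shows "zariski_closed S"
  using assms
proof (induction S)
  case empty
  show ?case by (rule zariski_closed_empty)
next
  case (insert p S)
  from zariski_closed_Un[OF zariski_closed_point[of p] insert.IH] show ?case by simp
qed

text \<open>An infinite closed set on which every form vanishes everywhere or only finitely often is
  a curve, because its proper closed subsets are finite.\<close>

lemma projective_curveI:
  assumes closed: "zariski_closed S" and inf: "infinite S"
    and fin: "\<And>d F. F \<in> forms d \<Longrightarrow> F \<notin> vanishing_forms d S \<Longrightarrow> finite {p \<in> S. \<exists>x. x \<noteq> 0 \<and> p = pt x \<and> F x = 0}"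
  shows "projective_curve S"
proof -
  have proper: "finite Y" if Y: "zariski_closed Y" "Y \<subset> S" for Y
  proof -
    obtain p where p: "p \<in> S" "p \<notin> Y" using Y by blast
    obtain x where x: "x \<noteq> 0" "p = pt x" by (rule proj_cases)
    obtain d F where F: "F \<in> vanishing_forms d Y" "F x \<noteq> 0"
      using zariski_closedD[OF Y(1) x(1)] p x by blast
    have "finite {p \<in> S. \<exists>x. x \<noteq> 0 \<and> p = pt x \<and> F x = 0}"
      using F p x by (intro fin[of _ d]) (auto simp: vanishing_forms_iff)
    moreover have "Y \<subseteq> {p \<in> S. \<exists>x. x \<noteq> 0 \<and> p = pt x \<and> F x = 0}"
    proof
      fix q assume q: "q \<in> Y"
      obtain v where v: "v \<noteq> 0" "q = pt v" by (rule proj_cases)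
      then show "q \<in> {p \<in> S. \<exists>x. x \<noteq> 0 \<and> p = pt x \<and> F x = 0}"
        using q Y(2) F(1) by (auto simp: vanishing_forms_iff)
    qed
    ultimately show ?thesis by (rule rev_finite_subset)
  qed
  have irr: "irreducible_closed S"
    unfolding irreducible_closed_def
  proof (intro conjI allI impI closed)
    show "S \<noteq> {}" using inf by auto
    fix A B assume AB: "zariski_closed A \<and> zariski_closed B \<and> S = A \<union> B"
    show "S = A \<or> S = B"
    proof (rule ccontr)
      assume "\<not> ?thesis"
      then have "finite A" "finite B" using AB proper by auto
      with AB inf show False by simp
    qed
  qed
  have irr_point: "irreducible_closed {p}" for p :: "'a proj"
    unfolding irreducible_closed_def using zariski_closed_point by blast
  obtain p where "p \<in> S" using inf by fastforce
  then have "{p} \<subset> S" using inf by (metis finite.emptyI finite_insert insert_subset empty_subsetI psubsetI)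
  moreover have "\<not> (irreducible_closed Y \<and> irreducible_closed Y' \<and> Y \<subset> Y' \<and> Y' \<subset> S)" for Y Y'
  proof
    assume *: "irreducible_closed Y \<and> irreducible_closed Y' \<and> Y \<subset> Y' \<and> Y' \<subset> S"
    then have "finite Y'" using proper by (auto simp: irreducible_closed_def)
    \<comment> \<open>A finite \<open>Y'\<close> splits into \<open>Y\<close> and the remaining
      points, both closed because finite; irreducibility of \<open>Y'\<close> then excludes a proper
      nonempty \<open>Y\<close>.\<close>
    then have "zariski_closed Y" "zariski_closed (Y' - Y)" "Y' = Y \<union> (Y' - Y)"
      using * by (auto intro!: zariski_closed_finite intro: finite_subset)
    then have "Y' = Y \<or> Y' = Y' - Y" using * unfolding irreducible_closed_def by blast
    moreover have "Y \<noteq> {}" using * by (simp add: irreducible_closed_def)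
    ultimately show False using * by blast
  qed
  ultimately show ?thesis
    unfolding projective_curve_def using irr irr_point by blast
qed

section \<open>The model of the elliptic curve\<close>

text \<open>The cone over the curve in three-dimensional projective space; it is parametrised by
  \<open>(a\<^sup>2, a * b, b\<^sup>2, y)\<close> with \<open>y\<^sup>2 = a ^ 4 - b ^ 4\<close>.\<close>

definition quartic_cone :: "(complex ^ 4) set" where
  "quartic_cone = {t. t $ 1 * t $ 3 = (t $ 2)\<^sup>2 \<and> (t $ 4)\<^sup>2 = (t $ 1)\<^sup>2 - (t $ 3)\<^sup>2}"

definition quartic_curve :: "complex ^ 4 ^ 'n \<Rightarrow> ('n::finite) proj set" where
  "quartic_curve A = {pt (A *v t) | t. t \<in> quartic_cone \<and> t \<noteq> 0}"

definition vec4 :: "complex \<Rightarrow> complex \<Rightarrow> complex \<Rightarrow> complex \<Rightarrow> complex ^ 4" where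
  "vec4 a b c d = (\<chi> i. if i = 1 then a else if i = 2 then b else if i = 3 then c else d)"

lemma vec4_nth [simp]:
  "vec4 a b c d $ 1 = a" "vec4 a b c d $ 2 = b" "vec4 a b c d $ 3 = c" "vec4 a b c d $ 4 = d"
  by (simp_all add: vec4_def)

lemma vec4_eq_iff: "(t :: complex ^ 4) = u \<longleftrightarrow> t $ 1 = u $ 1 \<and> t $ 2 = u $ 2 \<and> t $ 3 = u $ 3 \<and> t $ 4 = u $ 4"
  by (simp add: vec_eq_iff forall_4)

lemma quartic_cone_smult: "t \<in> quartic_cone \<Longrightarrow> c *s t \<in> quartic_cone"
  by (simp add: quartic_cone_def power_mult_distrib) (simp add: power2_eq_square algebra_simps)

definition quad1 :: "complex ^ 4 \<Rightarrow> complex" where "quad1 t = t $ 1 * t $ 3 - (t $ 2)\<^sup>2"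
definition quad2 :: "complex ^ 4 \<Rightarrow> complex" where "quad2 t = (t $ 4)\<^sup>2 - (t $ 1)\<^sup>2 + (t $ 3)\<^sup>2"

lemma quartic_cone_iff: "t \<in> quartic_cone \<longleftrightarrow> quad1 t = 0 \<and> quad2 t = 0"
  by (auto simp: quartic_cone_def quad1_def quad2_def algebra_simps)

definition grad1 :: "complex ^ 4 \<Rightarrow> complex ^ 4" where "grad1 t = vec4 (t $ 3) (- 2 * t $ 2) (t $ 1) 0"
definition grad2 :: "complex ^ 4 \<Rightarrow> complex ^ 4" where "grad2 t = vec4 (- 2 * t $ 1) 0 (2 * t $ 3) (2 * t $ 4)"

lemma has_derivative_nth: "((\<lambda>t :: complex ^ 'n. t $ i) has_derivative (\<lambda>h. h $ i)) F"
  by (intro bounded_linear_imp_has_derivative bounded_linear_vec_nth)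

lemma has_derivative_quad:
  "(quad1 has_derivative (\<lambda>h. \<Sum>i\<in>UNIV. grad1 t $ i * h $ i)) (at t)"
  "(quad2 has_derivative (\<lambda>h. \<Sum>i\<in>UNIV. grad2 t $ i * h $ i)) (at t)"
  unfolding quad1_def[abs_def] quad2_def[abs_def] grad1_def grad2_def power2_eq_square
  by (rule has_derivative_eq_rhs, (rule has_derivative_add has_derivative_diff has_derivative_mult has_derivative_nth)+,
      simp add: fun_eq_iff sum_4 algebra_simps)+

subsection \<open>Normal forms modulo the two quadrics\<close>

text \<open>Instead of the ideal generated by the two quadrics we use the functions that vanish on the
  cone and whose gradients there are combinations of the gradients of the quadrics.\<close>

definition cone_ideal :: "(complex ^ 4 \<Rightarrow> complex) set" where
  "cone_ideal = {f. \<forall>t\<in>quartic_cone. f t = 0 \<and>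
     (\<exists>\<alpha> \<beta>. (f has_derivative (\<lambda>h. \<Sum>i\<in>UNIV. (\<alpha> *s grad1 t + \<beta> *s grad2 t) $ i * h $ i)) (at t))}"

lemma cone_idealD:
  assumes "f \<in> cone_ideal" "t \<in> quartic_cone"
  shows "f t = 0"
    "\<exists>\<alpha> \<beta>. (f has_derivative (\<lambda>h. \<Sum>i\<in>UNIV. (\<alpha> *s grad1 t + \<beta> *s grad2 t) $ i * h $ i)) (at t)"
  using assms by (auto simp: cone_ideal_def)

lemma cone_ideal_zero: "(\<lambda>t. 0) \<in> cone_ideal"
  unfolding cone_ideal_def by (intro CollectI ballI conjI refl exI[of _ 0]) simp

lemma cone_ideal_quad: "quad1 \<in> cone_ideal" "quad2 \<in> cone_ideal"
proof -
  show "quad1 \<in> cone_ideal"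
    unfolding cone_ideal_def
  proof (intro CollectI ballI conjI exI)
    fix t assume "t \<in> quartic_cone"
    then show "quad1 t = 0" by (simp add: quartic_cone_iff)
    show "(quad1 has_derivative (\<lambda>h. \<Sum>i\<in>UNIV. (1 *s grad1 t + 0 *s grad2 t) $ i * h $ i)) (at t)"
      using has_derivative_quad(1)[of t] by simp
  qed
  show "quad2 \<in> cone_ideal"
    unfolding cone_ideal_def
  proof (intro CollectI ballI conjI exI)
    fix t assume "t \<in> quartic_cone"
    then show "quad2 t = 0" by (simp add: quartic_cone_iff)
    show "(quad2 has_derivative (\<lambda>h. \<Sum>i\<in>UNIV. (0 *s grad1 t + 1 *s grad2 t) $ i * h $ i)) (at t)"
      using has_derivative_quad(2)[of t] by simp
  qed
qed

lemma cone_ideal_add: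
  assumes "f \<in> cone_ideal" "g \<in> cone_ideal"
  shows "(\<lambda>t. f t + g t) \<in> cone_ideal"
  unfolding cone_ideal_def
proof (intro CollectI ballI conjI)
  fix t assume t: "t \<in> quartic_cone"
  show "f t + g t = 0" using cone_idealD(1)[OF assms(1) t] cone_idealD(1)[OF assms(2) t] by simp
  obtain a b where 1: "(f has_derivative (\<lambda>h. \<Sum>i\<in>UNIV. (a *s grad1 t + b *s grad2 t) $ i * h $ i)) (at t)"
    using cone_idealD(2)[OF assms(1) t] by blast
  obtain c d where 2: "(g has_derivative (\<lambda>h. \<Sum>i\<in>UNIV. (c *s grad1 t + d *s grad2 t) $ i * h $ i)) (at t)"
    using cone_idealD(2)[OF assms(2) t] by blast
  show "\<exists>\<alpha> \<beta>. ((\<lambda>t. f t + g t) has_derivative (\<lambda>h. \<Sum>i\<in>UNIV. (\<alpha> *s grad1 t + \<beta> *s grad2 t) $ i * h $ i)) (at t)"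
    by (rule exI[of _ "a + c"], rule exI[of _ "b + d"], rule has_derivative_eq_rhs[OF has_derivative_add[OF 1 2]])
      (simp add: fun_eq_iff sum_4 algebra_simps)
qed

text \<open>On the cone \<open>f\<close> vanishes, so the product rule leaves only
  \<open>g t\<close> times the derivative of \<open>f\<close>, again a combination of the two
  gradients.\<close>

lemma cone_ideal_mult:
  assumes f: "f \<in> cone_ideal" and g: "\<And>t. g differentiable (at t)"
  shows "(\<lambda>t. g t * f t) \<in> cone_ideal"
  unfolding cone_ideal_def
proof (intro CollectI ballI conjI)
  fix t assume t: "t \<in> quartic_cone"
  have f0: "f t = 0" using cone_idealD(1)[OF f t] .
  then show "g t * f t = 0" by simp
  obtain a b where 1: "(f has_derivative (\<lambda>h. \<Sum>i\<in>UNIV. (a *s grad1 t + b *s grad2 t) $ i * h $ i)) (at t)"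
    using cone_idealD(2)[OF f t] by blast
  obtain g' where 2: "(g has_derivative g') (at t)" using g unfolding differentiable_def by blast
  show "\<exists>\<alpha> \<beta>. ((\<lambda>t. g t * f t) has_derivative (\<lambda>h. \<Sum>i\<in>UNIV. (\<alpha> *s grad1 t + \<beta> *s grad2 t) $ i * h $ i)) (at t)"
    by (rule exI[of _ "g t * a"], rule exI[of _ "g t * b"], rule has_derivative_eq_rhs[OF has_derivative_mult[OF 2 1]])
      (simp add: fun_eq_iff sum_4 f0 algebra_simps)
qed

lemma cone_ideal_cmult: "f \<in> cone_ideal \<Longrightarrow> (\<lambda>t. k * f t) \<in> cone_ideal"
  by (rule cone_ideal_mult) auto

text \<open>For \<open>k \<le> 2 * d\<close> this represents \<open>a ^ (2 * d - k) * b ^ k\<close>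
  in the parametrisation by \<open>a\<^sup>2\<close>, \<open>a * b\<close>,
  \<open>b\<^sup>2\<close>: the mixed coordinate occurs at most once, and the remaining power of
  \<open>b\<close> is carried by the third coordinate.\<close>

definition cone_monomial :: "nat \<Rightarrow> nat \<Rightarrow> complex ^ 4 \<Rightarrow> complex" where
  "cone_monomial d k t = t $ 1 ^ (d - k div 2 - k mod 2) * t $ 2 ^ (k mod 2) * t $ 3 ^ (k div 2)"

lemma differentiable_nth: "(\<lambda>t :: complex ^ 'n. t $ i) differentiable F"
  using has_derivative_nth differentiable_def by blast

lemma cone_monomial_differentiable: "cone_monomial d k differentiable (at t)"
  unfolding cone_monomial_def[abs_def]
  by (intro differentiable_mult differentiable_power differentiable_nth)

text \<open>The factor \<open>t $ 4\<close> has degree one, so its coefficient has degree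
  \<open>d - 1\<close> and uses the indices up to \<open>2 * (d - 1)\<close>. For
  \<open>d = 0\<close> truncated subtraction makes this second sum empty.\<close>

definition cone_normal :: "nat \<Rightarrow> (nat \<Rightarrow> complex) \<Rightarrow> (nat \<Rightarrow> complex) \<Rightarrow> complex ^ 4 \<Rightarrow> complex" where
  "cone_normal d c e t = (\<Sum>k\<le>2 * d. c k * cone_monomial d k t) + t $ 4 * (\<Sum>k<2 * d - 1. e k * cone_monomial (d - 1) k t)"

definition has_normal_form :: "nat \<Rightarrow> (complex ^ 4 \<Rightarrow> complex) \<Rightarrow> bool" where
  "has_normal_form d f \<longleftrightarrow> (\<exists>c e. \<exists>r\<in>cone_ideal. f = (\<lambda>t. cone_normal d c e t + r t))"

lemma has_normal_form_ideal: "f \<in> cone_ideal \<Longrightarrow> has_normal_form d f"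
  unfolding has_normal_form_def
  by (rule exI[of _ "\<lambda>_. 0"], rule exI[of _ "\<lambda>_. 0"], rule bexI[of _ f]) (simp_all add: cone_normal_def)

lemma has_normal_form_add:
  assumes "has_normal_form d f" "has_normal_form d g"
  shows "has_normal_form d (\<lambda>t. f t + g t)"
proof -
  obtain c e r where 1: "r \<in> cone_ideal" "f = (\<lambda>t. cone_normal d c e t + r t)"
    using assms(1) unfolding has_normal_form_def by blast
  obtain c' e' r' where 2: "r' \<in> cone_ideal" "g = (\<lambda>t. cone_normal d c' e' t + r' t)"
    using assms(2) unfolding has_normal_form_def by blast
  show ?thesis
    unfolding has_normal_form_def 1(2) 2(2)
    by (rule exI[of _ "\<lambda>k. c k + c' k"], rule exI[of _ "\<lambda>k. e k + e' k"], rule bexI[OF _ cone_ideal_add[OF 1(1) 2(1)]])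
      (simp add: fun_eq_iff cone_normal_def distrib_right sum.distrib distrib_left)
qed

lemma has_normal_form_cmult:
  assumes "has_normal_form d f"
  shows "has_normal_form d (\<lambda>t. k * f t)"
proof -
  obtain c e r where 1: "r \<in> cone_ideal" "f = (\<lambda>t. cone_normal d c e t + r t)"
    using assms(1) unfolding has_normal_form_def by blast
  show ?thesis
    unfolding has_normal_form_def 1(2)
    by (rule exI[of _ "\<lambda>j. k * c j"], rule exI[of _ "\<lambda>j. k * e j"], rule bexI[OF _ cone_ideal_cmult[OF 1(1), of k]])
      (simp add: fun_eq_iff cone_normal_def distrib_left sum_distrib_left mult.assoc mult.left_commute)
qed

lemma has_normal_form_sum:
  "(\<And>a. a \<in> A \<Longrightarrow> has_normal_form d (f a)) \<Longrightarrow> has_normal_form d (\<lambda>t. \<Sum>a\<in>A. f a t)"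
  by (induction A rule: infinite_finite_induct)
    (auto intro: has_normal_form_ideal cone_ideal_zero has_normal_form_add)

lemma has_normal_form_monomial:
  assumes "k \<le> 2 * d"
  shows "has_normal_form d (cone_monomial d k)"
  unfolding has_normal_form_def
proof (rule exI[of _ "\<lambda>j. if j = k then 1 else 0"], rule exI[of _ "\<lambda>_. 0"], rule bexI[OF _ cone_ideal_zero])
  have "(\<Sum>j\<le>2 * d. (if j = k then 1 else 0) * cone_monomial d j t) = (\<Sum>j\<le>2 * d. if j = k then cone_monomial d k t else 0)" for t
    by (rule sum.cong) auto
  then show "cone_monomial d k = (\<lambda>t. cone_normal d (\<lambda>j. if j = k then 1 else 0) (\<lambda>_. 0) t + 0)"
    using assms by (simp add: fun_eq_iff cone_normal_def sum.delta')
qed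

lemma has_normal_form_monomial':
  assumes "k \<le> 2 * d"
  shows "has_normal_form (Suc d) (\<lambda>t. t $ 4 * cone_monomial d k t)"
  unfolding has_normal_form_def
proof (rule exI[of _ "\<lambda>_. 0"], rule exI[of _ "\<lambda>j. if j = k then 1 else 0"], rule bexI[OF _ cone_ideal_zero])
  have "(\<Sum>j<2 * Suc d - 1. (if j = k then 1 else 0) * cone_monomial d j t) = (\<Sum>j<2 * Suc d - 1. if j = k then cone_monomial d k t else 0)" for t
    by (rule sum.cong) auto
  then show "(\<lambda>t. t $ 4 * cone_monomial d k t) = (\<lambda>t. cone_normal (Suc d) (\<lambda>_. 0) (\<lambda>j. if j = k then 1 else 0) t + 0)"
    using assms by (simp add: fun_eq_iff cone_normal_def sum.delta')
qed

lemma half_sum_le: "k \<le> 2 * d \<Longrightarrow> k div 2 + k mod 2 \<le> (d :: nat)"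
  using div_mult_mod_eq[of k 2] mod_less_divisor[of 2 k] by linarith

lemma cone_monomial_mult:
  assumes "k \<le> 2 * d"
  shows "t $ 1 * cone_monomial d k t = cone_monomial (Suc d) k t"
    and "t $ 3 * cone_monomial d k t = cone_monomial (Suc d) (k + 2) t"
proof -
  have "Suc d - k div 2 - k mod 2 = Suc (d - k div 2 - k mod 2)" 
  proof -
    obtain m where "d = k div 2 + k mod 2 + m" using half_sum_le[OF assms] unfolding le_iff_add by blast
    then show ?thesis by simp
  qed
  then show "t $ 1 * cone_monomial d k t = cone_monomial (Suc d) k t"
    by (simp add: cone_monomial_def mult_ac)
  show "t $ 3 * cone_monomial d k t = cone_monomial (Suc d) (k + 2) t"
    by (simp add: cone_monomial_def mult_ac)
qed

text \<open>For even \<open>k\<close> the mixed coordinate does not occur yet and can be added. For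
  odd \<open>k\<close> it would occur squared, and its square is replaced by
  \<open>t $ 1 * t $ 3\<close> at the cost of a multiple of \<open>quad1\<close>.\<close>

lemma cone_monomial_mult2:
  assumes "k \<le> 2 * d"
  shows "\<exists>r\<in>cone_ideal. \<forall>t. t $ 2 * cone_monomial d k t = cone_monomial (Suc d) (Suc k) t + r t"
proof (cases "even k")
  case True
  then have "Suc k mod 2 = Suc (k mod 2)" "Suc k div 2 = k div 2" by presburger+
  then have "t $ 2 * cone_monomial d k t = cone_monomial (Suc d) (Suc k) t + 0" for t
    by (simp add: cone_monomial_def mult_ac)
  then show ?thesis using cone_ideal_zero by (intro bexI[of _ "\<lambda>t. 0"] allI)
next
  case False
  then have k: "k mod 2 = 1" "Suc k mod 2 = 0" "Suc k div 2 = Suc (k div 2)" by presburger+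
  then have d: "Suc d - Suc (k div 2) - 0 = Suc (d - k div 2 - 1)"
  proof -
    have "k div 2 + 1 \<le> d" using half_sum_le[OF assms] unfolding k(1) .
    then obtain m where "d = k div 2 + 1 + m" unfolding le_iff_add by blast
    then show ?thesis by simp
  qed
  have "t $ 2 * cone_monomial d k t = cone_monomial (Suc d) (Suc k) t + - (t $ 1 ^ (d - k div 2 - 1) * t $ 3 ^ (k div 2)) * quad1 t" for t
    unfolding cone_monomial_def k d quad1_def by (simp add: algebra_simps power2_eq_square)
  moreover have "(\<lambda>t. - (t $ 1 ^ (d - k div 2 - 1) * t $ 3 ^ (k div 2)) * quad1 t) \<in> cone_ideal"
    by (intro cone_ideal_mult cone_ideal_quad differentiable_minus differentiable_mult differentiable_power differentiable_nth)
  ultimately show ?thesis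
    by (intro bexI[of _ "\<lambda>t. - (t $ 1 ^ (d - k div 2 - 1) * t $ 3 ^ (k div 2)) * quad1 t"] allI)
qed

lemma has_normal_form_coord_monomial:
  assumes "k \<le> 2 * d"
  shows "has_normal_form (Suc d) (\<lambda>t. t $ i * cone_monomial d k t)"
proof -
  have 2: "has_normal_form (Suc d) (\<lambda>t. t $ 2 * cone_monomial d k t)"
  proof -
    obtain r where r: "r \<in> cone_ideal" "\<And>t. t $ 2 * cone_monomial d k t = cone_monomial (Suc d) (Suc k) t + r t"
      using cone_monomial_mult2[OF assms] by blast
    then show ?thesis
      using assms has_normal_form_add[OF has_normal_form_monomial[of "Suc k" "Suc d"] has_normal_form_ideal[OF r(1)]]
      by (simp only: r(2)) simp
  qed
  have 1: "has_normal_form (Suc d) (\<lambda>t. t $ 1 * cone_monomial d k t)"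
    unfolding cone_monomial_mult(1)[OF assms] using assms has_normal_form_monomial[of k "Suc d"] by simp
  have 3: "has_normal_form (Suc d) (\<lambda>t. t $ 3 * cone_monomial d k t)"
    unfolding cone_monomial_mult(2)[OF assms] using assms has_normal_form_monomial[of "k + 2" "Suc d"] by simp
  from 1 2 3 has_normal_form_monomial'[OF assms] show ?thesis
    using forall_4[of "\<lambda>i. has_normal_form (Suc d) (\<lambda>t. t $ i * cone_monomial d k t)"] by blast
qed

lemma has_normal_form_coord_monomial':
  assumes "k \<le> 2 * d"
  shows "has_normal_form (Suc (Suc d)) (\<lambda>t. t $ i * (t $ 4 * cone_monomial d k t))"
proof -
  have 1: "has_normal_form (Suc (Suc d)) (\<lambda>t. t $ 1 * (t $ 4 * cone_monomial d k t))"
    unfolding mult.left_commute[of _ "_ $ 4"] cone_monomial_mult(1)[OF assms]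
    using assms by (intro has_normal_form_monomial') auto
  have 3: "has_normal_form (Suc (Suc d)) (\<lambda>t. t $ 3 * (t $ 4 * cone_monomial d k t))"
    unfolding mult.left_commute[of _ "_ $ 4"] cone_monomial_mult(2)[OF assms]
    using assms by (intro has_normal_form_monomial') auto
  have 2: "has_normal_form (Suc (Suc d)) (\<lambda>t. t $ 2 * (t $ 4 * cone_monomial d k t))"
  proof -
    obtain r where r: "r \<in> cone_ideal" "\<And>t. t $ 2 * cone_monomial d k t = cone_monomial (Suc d) (Suc k) t + r t"
      using cone_monomial_mult2[OF assms] by blast
    have "has_normal_form (Suc (Suc d)) (\<lambda>t. t $ 4 * cone_monomial (Suc d) (Suc k) t + t $ 4 * r t)"
      using assms
      by (intro has_normal_form_add[OF has_normal_form_monomial' has_normal_form_ideal[OF cone_ideal_mult[OF r(1) differentiable_nth]]]) auto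
    then show ?thesis
      unfolding mult.left_commute[of _ "_ $ 4"] r(2) distrib_left .
  qed
  have 4: "has_normal_form (Suc (Suc d)) (\<lambda>t. t $ 4 * (t $ 4 * cone_monomial d k t))"
  proof -
    \<comment> \<open>Modulo \<open>quad2\<close>, the square of the fourth coordinate is
      \<open>(t $ 1)\<^sup>2 - (t $ 3)\<^sup>2\<close>, which raises \<open>k\<close> by zero or by
      four.\<close>
    have eq: "t $ 4 * (t $ 4 * cone_monomial d k t) =
        (cone_monomial (Suc (Suc d)) k t + (- 1) * cone_monomial (Suc (Suc d)) (k + 2 + 2) t) + cone_monomial d k t * quad2 t" for t
    proof -
      have "cone_monomial (Suc (Suc d)) k t = t $ 1 * (t $ 1 * cone_monomial d k t)"
        using assms by (simp only: cone_monomial_mult(1) le_SucI mult_Suc_right trans_le_add2)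
      moreover have "t $ 3 * cone_monomial (Suc d) (k + 2) t = cone_monomial (Suc (Suc d)) (k + 2 + 2) t"
        by (rule cone_monomial_mult(2)) (use assms in simp)
      then have "cone_monomial (Suc (Suc d)) (k + 2 + 2) t = t $ 3 * (t $ 3 * cone_monomial d k t)"
        by (simp only: cone_monomial_mult(2)[OF assms])
      ultimately show ?thesis 
        by (simp only: quad2_def) (simp add: algebra_simps power2_eq_square)
    qed
    show ?thesis
      unfolding eq using assms
      by (intro has_normal_form_add[OF has_normal_form_add[OF has_normal_form_monomial has_normal_form_cmult[OF has_normal_form_monomial]]
          has_normal_form_ideal[OF cone_ideal_mult[OF cone_ideal_quad(2) cone_monomial_differentiable]]]) auto
  qed
  from 1 2 3 4 show ?thesis
    using forall_4[of "\<lambda>i. has_normal_form (Suc (Suc d)) (\<lambda>t. t $ i * (t $ 4 * cone_monomial d k t))"] by blast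
qed

lemma has_normal_form_coord:
  assumes "has_normal_form d f"
  shows "has_normal_form (Suc d) (\<lambda>t. t $ i * f t)"
proof -
  obtain c e r where r: "r \<in> cone_ideal" "f = (\<lambda>t. cone_normal d c e t + r t)"
    using assms unfolding has_normal_form_def by blast
  have eq: "t $ i * f t = (\<Sum>k\<le>2 * d. c k * (t $ i * cone_monomial d k t)) +
      (\<Sum>k<2 * d - 1. e k * (t $ i * (t $ 4 * cone_monomial (d - 1) k t))) + t $ i * r t" for t
    by (simp add: r(2) cone_normal_def distrib_left sum_distrib_left mult_ac)
  have "has_normal_form (Suc d) (\<lambda>t. t $ i * (t $ 4 * cone_monomial (d - 1) k t))" if "k < 2 * d - 1" for k
    using that has_normal_form_coord_monomial'[of k "d - 1" i] by (cases d) auto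
  then show ?thesis
    unfolding eq
    by (intro has_normal_form_add[OF has_normal_form_add[OF has_normal_form_sum[OF has_normal_form_cmult[OF has_normal_form_coord_monomial]]
        has_normal_form_sum[OF has_normal_form_cmult]] has_normal_form_ideal[OF cone_ideal_mult[OF r(1) differentiable_nth]]]) auto
qed

lemma forms_has_normal_form:
  assumes "F \<in> forms d"
  shows "has_normal_form d (\<lambda>t. F (A *v t))"
  using assms
proof (induction rule: forms_induct)
  case (coord d F i)
  have "(\<lambda>t. (A *v t) $ i * F (A *v t)) = (\<lambda>t. \<Sum>j\<in>UNIV. A $ i $ j * (t $ j * F (A *v t)))"
    by (simp add: matrix_vector_mult_def sum_distrib_right mult.assoc)
  then show ?case
    using has_normal_form_sum[OF has_normal_form_cmult[OF has_normal_form_coord[OF coord]]] by (simp only:)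
next
  case one
  have "cone_monomial 0 0 = (\<lambda>t. 1)" by (simp add: cone_monomial_def fun_eq_iff)
  then show ?case using has_normal_form_monomial[of 0 0] by simp
qed (auto intro: has_normal_form_ideal cone_ideal_zero has_normal_form_add has_normal_form_cmult)

subsection \<open>Functions on the curve\<close>

definition affine_point :: "complex \<Rightarrow> complex \<Rightarrow> complex ^ 4" where
  "affine_point s y = vec4 1 s (s\<^sup>2) y"

lemma affine_point_in_cone: "y\<^sup>2 = 1 - s ^ 4 \<Longrightarrow> affine_point s y \<in> quartic_cone"
  by (simp add: quartic_cone_def affine_point_def flip: power_mult)

lemma affine_point_nonzero: "affine_point s y \<noteq> 0"
  by (simp add: vec4_eq_iff affine_point_def)

lemma cone_monomial_affine_point: "cone_monomial d k (affine_point s y) = s ^ k"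
proof -
  have "s ^ k = s ^ (k mod 2) * (s\<^sup>2) ^ (k div 2)"
    by (simp add: power_mult[symmetric] power_add[symmetric])
  then show ?thesis by (simp add: cone_monomial_def affine_point_def)
qed

definition coeff_poly :: "(nat \<Rightarrow> complex) \<Rightarrow> nat \<Rightarrow> complex poly" where
  "coeff_poly c n = (\<Sum>k<n. monom (c k) k)"

lemma poly_coeff_poly: "poly (coeff_poly c n) s = (\<Sum>k<n. c k * s ^ k)"
  by (simp add: coeff_poly_def poly_sum poly_monom)

lemma coeff_poly_eq_0D: "coeff_poly c n = 0 \<Longrightarrow> k < n \<Longrightarrow> c k = 0"
proof -
  assume "coeff_poly c n = 0" "k < n"
  moreover have "coeff (coeff_poly c n) k = (\<Sum>j<n. if j = k then c k else 0)"
    unfolding coeff_poly_def coeff_sum by (rule sum.cong) auto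
  ultimately show "c k = 0" by simp
qed

lemma cone_normal_affine_point:
  "cone_normal d c e (affine_point s y) =
    poly (coeff_poly c (2 * d + 1)) s + y * poly (coeff_poly e (2 * d - 1)) s"
proof -
  have "{..2 * d} = {..<2 * d + 1}" by auto
  then show ?thesis
    by (simp add: cone_normal_def cone_monomial_affine_point poly_coeff_poly) (simp add: affine_point_def)
qed

text \<open>\<open>1 - X\<^sup>4\<close> has a simple zero at \<open>1\<close>, so that the two sides have zeros of different parity.\<close>

lemma square_eq_quartic_square_imp_zero:
  fixes P Q :: "complex poly"
  assumes "P\<^sup>2 = [:1, 0, 0, 0, -1:] * Q\<^sup>2"
  shows "P = 0" "Q = 0"
proof -
  show "Q = 0"
  proof (rule ccontr)
    assume Q: "Q \<noteq> 0"
    have f: "[:1, 0, 0, 0, -1:] = [:-1, 1:] * ([:-1, -1, -1, -1:] :: complex poly)" by simp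
    have lin: "order 1 [:-1, 1 :: complex:] = 1"
      using order_power_n_n[of "1 :: complex" 1] by simp
    have "order 1 ([:-1, -1, -1, -1:] :: complex poly) = 0" by (rule order_0I) simp
    then have "order 1 [:1, 0, 0, 0, -1 :: complex:] = 1"
      unfolding f by (subst order_mult) (simp_all add: lin)
    moreover have nz: "[:1, 0, 0, 0, -1:] * Q\<^sup>2 \<noteq> 0"
      by (rule no_zero_divisors) (use Q in simp_all)
    moreover have "order 1 (Q\<^sup>2) = 2 * order 1 Q" using Q by (simp add: order_mult power2_eq_square)
    ultimately have "order 1 ([:1, 0, 0, 0, -1:] * Q\<^sup>2) = 1 + 2 * order 1 Q"
      using order_mult[OF nz, of 1] by linarith
    moreover have P: "P \<noteq> 0"
    proof
      assume "P = 0"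
      then have "P\<^sup>2 = 0" by simp
      with nz show False unfolding assms by blast
    qed
    then have "order 1 (P\<^sup>2) = 2 * order 1 P" by (simp add: order_mult power2_eq_square)
    ultimately have "2 * order 1 P = 1 + 2 * order 1 Q" using assms by (simp only:)
    then show False by presburger
  qed
  then show "P = 0" using assms by simp
qed

text \<open>On the affine chart a normal form is \<open>P + y * Q\<close>. Moving one summand to the
  other side and squaring eliminates \<open>y\<close> and leaves
  \<open>P\<^sup>2 = (1 - X ^ 4) * Q\<^sup>2\<close>, where parity of the order at \<open>1\<close>
  forces both polynomials to vanish.\<close>

lemma cone_normal_vanishes_imp_zero:
  assumes "\<And>s y. y\<^sup>2 = 1 - s ^ 4 \<Longrightarrow> cone_normal d c e (affine_point s y) = 0"
  shows "k \<le> 2 * d \<Longrightarrow> c k = 0" "k < 2 * d - 1 \<Longrightarrow> e k = 0"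
proof -
  define P where "P = coeff_poly c (2 * d + 1)"
  define Q where "Q = coeff_poly e (2 * d - 1)"
  have "poly (P\<^sup>2) s = poly ([:1, 0, 0, 0, -1:] * Q\<^sup>2) s" for s
  proof -
    define y where "y = csqrt (1 - s ^ 4)"
    have y: "y\<^sup>2 = 1 - s ^ 4" by (simp add: y_def)
    have "poly P s + y * poly Q s = 0"
      using assms[OF y] unfolding cone_normal_affine_point P_def Q_def .
    then have "poly P s = - (y * poly Q s)" by (simp only: eq_neg_iff_add_eq_0)
    then have "poly P s ^ 2 = (- (y * poly Q s)) ^ 2" by (simp only:)
    also have "\<dots> = (1 - s ^ 4) * poly Q s ^ 2" by (simp add: power_mult_distrib y)
    also have "\<dots> = poly ([:1, 0, 0, 0, -1:] * Q\<^sup>2) s"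
      by (simp add: algebra_simps power4_eq_xxxx)
    finally show ?thesis by simp
  qed
  then have "P\<^sup>2 = [:1, 0, 0, 0, -1:] * Q\<^sup>2" using poly_eq_poly_eq_iff by blast
  note PQ = square_eq_quartic_square_imp_zero[OF this]
  show "k \<le> 2 * d \<Longrightarrow> c k = 0" using PQ(1) coeff_poly_eq_0D[of c "2 * d + 1" k] by (simp add: P_def)
  show "k < 2 * d - 1 \<Longrightarrow> e k = 0" using PQ(2) coeff_poly_eq_0D[of e "2 * d - 1" k] by (simp add: Q_def)
qed

lemma cone_normal_eq_0:
  assumes "\<And>k. k \<le> 2 * d \<Longrightarrow> c k = 0" "\<And>k. k < 2 * d - 1 \<Longrightarrow> e k = 0"
  shows "cone_normal d c e t = 0"
  using assms by (simp add: cone_normal_def)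

subsection \<open>The curve in an ambient projective space\<close>

text \<open>The left inverse \<open>B\<close> provides equations: \<open>mat 1 - A ** B\<close> cuts
  out the linear span of the curve, and the quadrics pulled back along \<open>B\<close> cut out the
  curve in it. All translates are instances of the locale.\<close>

locale embedded_quartic =
  fixes A :: "complex ^ 4 ^ 'n::finite" and B :: "complex ^ 'n ^ 4"
  assumes BA: "B ** A = mat 1"
begin

lemma B_A: "B *v (A *v t) = t"
  by (simp add: matrix_vector_mul_assoc BA)

lemma A_eq_0_iff: "A *v t = 0 \<longleftrightarrow> t = 0"
  using B_A[of t] by auto

lemma mem_curve_iff:
  assumes "x \<noteq> 0"
  shows "pt x \<in> quartic_curve A \<longleftrightarrow> (\<exists>t\<in>quartic_cone. t \<noteq> 0 \<and> x = A *v t)"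
proof
  assume "pt x \<in> quartic_curve A"
  then obtain t where t: "t \<in> quartic_cone" "t \<noteq> 0" "pt x = pt (A *v t)"
    by (auto simp: quartic_curve_def)
  then obtain c where c: "c \<noteq> 0" "A *v t = c *s x"
    using pt_eq_iff[of x "A *v t"] assms A_eq_0_iff by auto
  have "x = inverse c *s (A *v t)" using c by (simp add: vector_smult_assoc)
  also have "\<dots> = A *v (inverse c *s t)" by (simp add: vector_scalar_commute)
  finally show "\<exists>t\<in>quartic_cone. t \<noteq> 0 \<and> x = A *v t"
    using t c by (intro bexI[of _ "inverse c *s t"] quartic_cone_smult) auto
qed (auto simp: quartic_curve_def)

lemma mem_curve_iff':
  assumes "x \<noteq> 0"
  shows "pt x \<in> quartic_curve A \<longleftrightarrow> A *v (B *v x) = x \<and> B *v x \<in> quartic_cone"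
  unfolding mem_curve_iff[OF assms]
proof
  assume "A *v (B *v x) = x \<and> B *v x \<in> quartic_cone"
  moreover from this assms have "B *v x \<noteq> 0" by (metis matrix_vector_mult_0_right)
  ultimately show "\<exists>t\<in>quartic_cone. t \<noteq> 0 \<and> x = A *v t" by metis
qed (auto simp: B_A)

lemma linear_form: "(\<lambda>x. ((mat 1 - A ** B) *v x) $ i) \<in> vanishing_forms 1 (quartic_curve A)"
  unfolding vanishing_forms_iff
proof (intro conjI allI impI forms_linear)
  fix x assume "x \<noteq> 0" "pt x \<in> quartic_curve A"
  then have "A *v (B *v x) = x" using mem_curve_iff' by blast
  then show "((mat 1 - A ** B) *v x) $ i = 0"
    by (simp add: matrix_vector_mult_diff_rdistrib matrix_vector_mul_assoc)
qed

lemma quadratic_form: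
  "(\<lambda>x. quad1 (B *v x)) \<in> vanishing_forms 2 (quartic_curve A)"
  "(\<lambda>x. quad2 (B *v x)) \<in> vanishing_forms 2 (quartic_curve A)"
proof -
  have lin: "(\<lambda>x. (B *v x) $ i) \<in> forms 1" for i by (rule forms_linear)
  have sq: "(\<lambda>x. (B *v x) $ i * (B *v x) $ j) \<in> forms 2" for i j
    using forms_mult[OF lin lin, of i j] by simp
  show "(\<lambda>x. quad1 (B *v x)) \<in> vanishing_forms 2 (quartic_curve A)"
    "(\<lambda>x. quad2 (B *v x)) \<in> vanishing_forms 2 (quartic_curve A)"
    unfolding vanishing_forms_iff quad1_def quad2_def power2_eq_square
    by (intro conjI forms_add forms_diff sq allI impI,
        simp add: mem_curve_iff' quartic_cone_def power2_eq_square)+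
qed

lemma zariski_closed_curve: "zariski_closed (quartic_curve A)"
proof (rule zariski_closedI)
  fix x assume x: "x \<noteq> 0" "pt x \<notin> quartic_curve A"
  show "\<exists>d. \<exists>F\<in>vanishing_forms d (quartic_curve A). F x \<noteq> 0"
  proof (cases "A *v (B *v x) = x")
    case False
    then have "(mat 1 - A ** B) *v x \<noteq> 0"
      by (simp add: matrix_vector_mult_diff_rdistrib matrix_vector_mul_assoc)
    then obtain i where "((mat 1 - A ** B) *v x) $ i \<noteq> 0" by (auto simp: vec_eq_iff)
    then show ?thesis using linear_form by (intro exI bexI) auto
  next
    case True
    with x have "quad1 (B *v x) \<noteq> 0 \<or> quad2 (B *v x) \<noteq> 0"
      using mem_curve_iff' by (auto simp: quartic_cone_iff)
    then show ?thesis
    proof (elim disjE)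
      assume "quad1 (B *v x) \<noteq> 0"
      then show ?thesis by (intro exI[of _ 2] bexI[OF _ quadratic_form(1)])
    next
      assume "quad2 (B *v x) \<noteq> 0"
      then show ?thesis by (intro exI[of _ 2] bexI[OF _ quadratic_form(2)])
    qed
  qed
qed

lemma form_normal:
  assumes "F \<in> forms d"
  shows "\<exists>c e. \<exists>r\<in>cone_ideal. \<forall>t. F (A *v t) = cone_normal d c e t + r t"
proof -
  obtain c e r where "r \<in> cone_ideal" and eq: "(\<lambda>t. F (A *v t)) = (\<lambda>t. cone_normal d c e t + r t)"
    using forms_has_normal_form[OF assms, of A] unfolding has_normal_form_def by blast
  moreover have "\<forall>t. F (A *v t) = cone_normal d c e t + r t"
    using fun_cong[OF eq] ..
  ultimately show ?thesis by blast
qed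

lemma cone_cases:
  assumes "t \<in> quartic_cone" "t \<noteq> 0"
  obtains (affine) s y c where "c \<noteq> 0" "t = c *s affine_point s y" "y\<^sup>2 = 1 - s ^ 4"
  | (infinite) y c where "c \<noteq> 0" "t = c *s vec4 0 0 1 y" "y\<^sup>2 = - 1"
proof (cases "t $ 1 = 0")
  case False
  define p where "p = t $ 1"
  have p: "p \<noteq> 0" using False by (simp add: p_def)
  have t: "p * t $ 3 = (t $ 2)\<^sup>2" "(t $ 4)\<^sup>2 = p\<^sup>2 - (t $ 3)\<^sup>2"
    using assms(1) by (auto simp: quartic_cone_def p_def)
  have t3: "t $ 3 / p = (t $ 2 / p)\<^sup>2"
    using t(1) p by (simp add: power_divide) (simp add: field_simps power2_eq_square)
  have "t = p *s affine_point (t $ 2 / p) (t $ 4 / p)"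
    using p unfolding vec4_eq_iff affine_point_def t3[symmetric] by (simp add: p_def)
  moreover have "(t $ 4 / p)\<^sup>2 = 1 - (t $ 2 / p) ^ 4"
  proof -
    have "(t $ 2 / p) ^ 4 = (t $ 3 / p)\<^sup>2" unfolding t3 by simp
    then show ?thesis using p by (simp add: power_divide t(2) diff_divide_distrib)
  qed
  ultimately show ?thesis using p affine by blast
next
  case True
  with assms(1) have t: "t $ 2 = 0" "(t $ 4)\<^sup>2 = - (t $ 3)\<^sup>2" by (auto simp: quartic_cone_def)
  with True assms(2) have t3: "t $ 3 \<noteq> 0" by (auto simp: vec4_eq_iff)
  have "t = t $ 3 *s vec4 0 0 1 (t $ 4 / t $ 3)"
    using True t t3 by (simp add: vec4_eq_iff)
  moreover have "(t $ 4 / t $ 3)\<^sup>2 = - 1" using t t3 by (simp add: power_divide)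
  ultimately show ?thesis using t3 infinite by blast
qed

lemma infinite_curve: "infinite (quartic_curve A)"
proof -
  let ?f = "\<lambda>s. pt (A *v affine_point s (csqrt (1 - s ^ 4)))"
  have "inj ?f"
  proof (rule injI)
    fix s s' assume "?f s = ?f s'"
    then obtain c where "A *v affine_point s' (csqrt (1 - s' ^ 4)) = c *s (A *v affine_point s (csqrt (1 - s ^ 4)))"
      using pt_eq_iff A_eq_0_iff affine_point_nonzero by metis
    then have "affine_point s' (csqrt (1 - s' ^ 4)) = c *s affine_point s (csqrt (1 - s ^ 4))"
      using B_A by (metis vector_scalar_commute)
    then have "1 = c * 1" "s' = c * s" unfolding vec4_eq_iff by (auto simp: affine_point_def)
    then show "s = s'" by simp
  qed
  then have "infinite (range ?f)" using infinite_UNIV_char_0 finite_image_iff by blast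
  moreover have "range ?f \<subseteq> quartic_curve A"
    using affine_point_in_cone affine_point_nonzero by (auto simp: quartic_curve_def)
  ultimately show ?thesis using finite_subset by blast
qed

text \<open>The polynomial \<open>N = P\<^sup>2 - (1 - X ^ 4) * Q\<^sup>2\<close> is the norm of
  \<open>P + y * Q\<close>. If it is zero, so is the normal form, and the pullback is in
  \<open>cone_ideal\<close>. Otherwise every affine zero lies over one of its finitely many roots,
  with two values of \<open>y\<close> at most, and two points at infinity are added.\<close>

lemma form_vanishing_or_finite:
  assumes F: "F \<in> forms d"
  shows "(\<lambda>t. F (A *v t)) \<in> cone_ideal \<and> F \<in> vanishing_forms d (quartic_curve A) \<or>
    F \<notin> vanishing_forms d (quartic_curve A) \<and> finite {p \<in> quartic_curve A. \<exists>x. x \<noteq> 0 \<and> p = pt x \<and> F x = 0}"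
proof -
  obtain c e r where r': "r \<in> cone_ideal" "\<forall>t. F (A *v t) = cone_normal d c e t + r t"
    using form_normal[OF F] by blast
  note r = r'(1) r'(2)[rule_format]
  define P where "P = coeff_poly c (2 * d + 1)"
  define Q where "Q = coeff_poly e (2 * d - 1)"
  have aff: "F (A *v affine_point s y) = poly P s + y * poly Q s" if "y\<^sup>2 = 1 - s ^ 4" for s y
    using cone_idealD(1)[OF r(1) affine_point_in_cone[OF that]]
    by (simp add: r(2) cone_normal_affine_point P_def Q_def)
  show ?thesis
  proof (cases "P\<^sup>2 = [:1, 0, 0, 0, -1:] * Q\<^sup>2")
    case True
    note PQ = square_eq_quartic_square_imp_zero[OF True]
    have "cone_normal d c e t = 0" for t
      using PQ coeff_poly_eq_0D[of c "2 * d + 1"] coeff_poly_eq_0D[of e "2 * d - 1"]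
      by (intro cone_normal_eq_0) (auto simp: P_def Q_def)
    then have Fr: "(\<lambda>t. F (A *v t)) = r" by (simp add: r(2) fun_eq_iff)
    then have "F (A *v t) = 0" if "t \<in> quartic_cone" for t
      using cone_idealD(1)[OF r(1) that] by (metis)
    then have "F \<in> vanishing_forms d (quartic_curve A)"
      using F by (auto simp: vanishing_forms_iff mem_curve_iff)
    with Fr r(1) show ?thesis by simp
  next
    case False
    define N where "N = P\<^sup>2 - [:1, 0, 0, 0, -1:] * Q\<^sup>2"
    have "N \<noteq> 0" using False by (simp add: N_def)
    then have fin: "finite {s. poly N s = 0}" by (rule poly_roots_finite)
    have N: "poly N s = 0" if "y\<^sup>2 = 1 - s ^ 4" "F (A *v affine_point s y) = 0" for s y
    proof -
      have "poly P s = - (y * poly Q s)" using aff[OF that(1)] that(2) by (simp only: eq_neg_iff_add_eq_0)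
      then have "poly P s ^ 2 = (- (y * poly Q s)) ^ 2" by (simp only:)
      also have "\<dots> = (1 - s ^ 4) * poly Q s ^ 2" by (simp add: power_mult_distrib that(1))
      also have "\<dots> = poly ([:1, 0, 0, 0, -1:] * Q\<^sup>2) s"
        by (simp add: algebra_simps power4_eq_xxxx)
      finally show ?thesis by (simp add: N_def)
    qed
    define Z where "Z = (\<lambda>(s, y). pt (A *v affine_point s y)) ` (SIGMA s:{s. poly N s = 0}. {y. y\<^sup>2 = 1 - s ^ 4}) \<union>
      (\<lambda>y. pt (A *v vec4 0 0 1 y)) ` {y. y\<^sup>2 = - 1}"
    have sqrt_fin: "finite {y :: complex. y\<^sup>2 = w}" for w
    proof (rule finite_subset)
      show "{y. y\<^sup>2 = w} \<subseteq> {csqrt w, - csqrt w}"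
      proof
        fix y assume "y \<in> {y. y\<^sup>2 = w}"
        then have "y\<^sup>2 = (csqrt w)\<^sup>2" by simp
        then show "y \<in> {csqrt w, - csqrt w}" by (simp only: power2_eq_iff) blast
      qed
    qed simp
    have "finite Z"
      unfolding Z_def using fin sqrt_fin by (intro finite_UnI finite_imageI finite_SigmaI) auto
    moreover have "{p \<in> quartic_curve A. \<exists>x. x \<noteq> 0 \<and> p = pt x \<and> F x = 0} \<subseteq> Z"
    proof clarify
      fix x assume x: "pt x \<in> quartic_curve A" "x \<noteq> 0" "F x = 0"
      then obtain t where t: "t \<in> quartic_cone" "t \<noteq> 0" "x = A *v t" using mem_curve_iff by blast
      show "pt x \<in> Z"
        using t(1,2)
      proof (cases rule: cone_cases)
        case (affine s y c)
        then have x_eq: "x = c *s (A *v affine_point s y)" by (simp add: t(3) vector_scalar_commute)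
        then have "c ^ d * F (A *v affine_point s y) = 0" using x(3) forms_homogeneous[OF F] by simp
        then have "poly N s = 0" using affine N by simp
        then show ?thesis
          unfolding x_eq pt_scale[OF affine(1)] Z_def using affine(3) by force
      next
        case (infinite y c)
        then have x_eq: "x = c *s (A *v vec4 0 0 1 y)" by (simp add: t(3) vector_scalar_commute)
        show ?thesis
          unfolding x_eq pt_scale[OF infinite(1)] Z_def using infinite(3) by blast
      qed
    qed
    ultimately have Zfin: "finite {p \<in> quartic_curve A. \<exists>x. x \<noteq> 0 \<and> p = pt x \<and> F x = 0}"
      by (rule rev_finite_subset)
    moreover have "F \<notin> vanishing_forms d (quartic_curve A)"
    proof
      assume van: "F \<in> vanishing_forms d (quartic_curve A)"
      have "quartic_curve A \<subseteq> {p \<in> quartic_curve A. \<exists>x. x \<noteq> 0 \<and> p = pt x \<and> F x = 0}"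
      proof
        fix p assume p: "p \<in> quartic_curve A"
        obtain x where x: "x \<noteq> 0" "p = pt x" by (rule proj_cases)
        then have "F x = 0" using van p by (simp add: vanishing_forms_iff)
        with x p show "p \<in> {p \<in> quartic_curve A. \<exists>x. x \<noteq> 0 \<and> p = pt x \<and> F x = 0}" by blast
      qed
      with Zfin infinite_curve show False using finite_subset by blast
    qed
    ultimately show ?thesis by (intro disjI2 conjI)
  qed
qed

lemma projective_curve: "projective_curve (quartic_curve A)"
  using form_vanishing_or_finite
  by (intro projective_curveI zariski_closed_curve infinite_curve) blast

end

subsection \<open>Smoothness\<close>

lemma span_insert_coeffs: "x \<in> vec.span {u, v} \<longleftrightarrow> (\<exists>a b. x = a *s u + b *s v)"
proof
  assume "x \<in> vec.span {u, v}"
  then obtain a where "x - a *s u \<in> vec.span {v}" using vec.span_breakdown_eq by blast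
  then obtain b where "x - a *s u - b *s v \<in> vec.span {}" using vec.span_breakdown_eq by blast
  then show "\<exists>a b. x = a *s u + b *s v" by (auto simp: algebra_simps eq_diff_eq)
next
  assume "\<exists>a b. x = a *s u + b *s v"
  then obtain a b where x: "x = a *s u + b *s v" by blast
  show "x \<in> vec.span {u, v}"
    unfolding x by (intro vec.span_add vec.span_scale vec.span_base) auto
qed

text \<open>In the coordinates \<open>k\<close> and \<open>l\<close> the vectors \<open>u\<close>
  and \<open>v\<close> form a triangular system with nonzero diagonal, so the two remaining axes
  complete them to a basis.\<close>

lemma extend_to_basis4:
  fixes u v :: "complex ^ 4"
  assumes UNIV: "\<And>m. m = i \<or> m = j \<or> m = k \<or> m = l"
    and dist: "i \<noteq> j" "i \<noteq> k" "i \<noteq> l" "j \<noteq> k" "j \<noteq> l" "k \<noteq> l"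
    and uv: "v $ k \<noteq> 0" "u $ k = 0" "u $ l \<noteq> 0"
  shows "axis j 1 \<notin> vec.span {u, v}" "axis i 1 \<notin> vec.span (insert (axis j 1) {u, v})"
    "vec.span (insert (axis i 1) (insert (axis j 1) {u, v})) = UNIV"
proof -
  have zero: "a = 0 \<and> b = 0" if "(a *s u + b *s v) $ k = 0" "(a *s u + b *s v) $ l = 0" for a b
    using that uv by auto
  show "axis j 1 \<notin> vec.span {u, v}"
  proof
    assume "axis j 1 \<in> vec.span {u, v}"
    then obtain a b where ab: "axis j 1 = a *s u + b *s v" unfolding span_insert_coeffs by blast
    have "a = 0 \<and> b = 0" by (rule zero) (use dist in \<open>simp_all add: ab[symmetric] axis_def\<close>)
    then show False using ab by (simp add: axis_eq_0_iff)
  qed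
  show "axis i 1 \<notin> vec.span (insert (axis j 1) {u, v})"
  proof
    assume "axis i 1 \<in> vec.span (insert (axis j 1) {u, v})"
    then obtain c where "axis i 1 - c *s axis j 1 \<in> vec.span {u, v}" using vec.span_breakdown_eq by blast
    then obtain a b where ab: "axis i 1 - c *s axis j 1 = a *s u + b *s v" unfolding span_insert_coeffs by blast
    have "a = 0 \<and> b = 0" by (rule zero) (use dist in \<open>simp_all add: ab[symmetric] axis_def\<close>)
    then have "(axis i 1 - c *s axis j 1) $ i = 0" using ab by simp
    then show False using dist by (simp add: axis_def)
  qed
  have "w \<in> vec.span (insert (axis i 1) (insert (axis j 1) {u, v}))" for w
  proof -
    define a where "a = (w $ l - w $ k / v $ k * v $ l) / u $ l"
    define b where "b = w $ k / v $ k"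
    define r where "r = w - (a *s u + b *s v)"
    have "r $ k = 0" "r $ l = 0" using uv by (simp_all add: r_def a_def b_def)
    then have "r = r $ i *s axis i 1 + r $ j *s axis j 1"
      unfolding vec_eq_iff using UNIV dist by (auto simp: axis_def)
    then have "w = r $ i *s axis i 1 + (r $ j *s axis j 1 + (a *s u + b *s v))"
      by (simp add: r_def algebra_simps)
    then show ?thesis
      by (metis (no_types, lifting) insertI1 insertI2 vec.span_add vec.span_base vec.span_scale)
  qed
  then show "vec.span (insert (axis i 1) (insert (axis j 1) {u, v})) = UNIV" by blast
qed

text \<open>The quadrics meet transversally along the cone. If \<open>t $ 4\<close> is nonzero, the
  fourth coordinate occurs only in \<open>grad2\<close>, and \<open>t $ 1\<close> or
  \<open>t $ 3\<close> makes \<open>grad1\<close> nonzero. If \<open>t $ 4 = 0\<close>, then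
  \<open>t $ 1\<close>, \<open>t $ 3\<close> and hence \<open>t $ 2\<close> are nonzero, and the
  second coordinate occurs only in \<open>grad1\<close>.\<close>

lemma gradients_extend_to_basis:
  assumes t: "t \<in> quartic_cone" "t \<noteq> 0"
  obtains e e' where "e' \<notin> vec.span {grad1 t, grad2 t}" "e \<notin> vec.span (insert e' {grad1 t, grad2 t})"
    "vec.span (insert e (insert e' {grad1 t, grad2 t})) = UNIV"
proof -
  have cover: "m = 1 \<or> m = 2 \<or> m = 3 \<or> m = (4 :: 4)" for m using exhaust_4[of m] by blast
  have eq: "t $ 1 * t $ 3 = (t $ 2)\<^sup>2" "(t $ 4)\<^sup>2 = (t $ 1)\<^sup>2 - (t $ 3)\<^sup>2"
    using t(1) by (auto simp: quartic_cone_def)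
  consider "t $ 4 \<noteq> 0" "t $ 1 \<noteq> 0" | "t $ 4 \<noteq> 0" "t $ 3 \<noteq> 0" | "t $ 2 \<noteq> 0" "t $ 1 \<noteq> 0"
  proof (cases "t $ 4 = 0")
    case True
    have t1: "t $ 1 \<noteq> 0"
    proof
      assume "t $ 1 = 0"
      with True eq have "t $ 3 = 0" "t $ 2 = 0" by auto
      with \<open>t $ 1 = 0\<close> True t(2) show False by (auto simp: vec4_eq_iff)
    qed
    with True eq have "t $ 3 \<noteq> 0" by auto
    with t1 eq(1) have "t $ 2 \<noteq> 0" by auto
    with t1 show ?thesis using that(3) by blast
  next
    case False
    then have "t $ 1 \<noteq> 0 \<or> t $ 3 \<noteq> 0" using eq(2) by auto
    with False show ?thesis using that(1,2) by blast
  qed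
  then show ?thesis
  proof cases
    case 1
    have "(4 :: 4) \<noteq> 3" by simp
    then show ?thesis
      using extend_to_basis4[of 1 2 4 3 "grad2 t" "grad1 t"] 1 cover
      by (intro that[of "axis 2 1" "axis 1 1"]) (auto simp: grad1_def grad2_def)
  next
    case 2
    then show ?thesis
      using extend_to_basis4[of 3 2 4 1 "grad2 t" "grad1 t"] cover
      by (intro that[of "axis 2 1" "axis 3 1"]) (auto simp: grad1_def grad2_def)
  next
    case 3
    then show ?thesis
      using extend_to_basis4[of 4 3 2 1 "grad1 t" "grad2 t"] cover
      by (intro that[of "axis 3 1" "axis 4 1"]) (auto simp: grad1_def grad2_def insert_commute)
  qed
qed

declare transpose_matrix_vector [simp del]

lemma has_derivative_matrix:
  fixes M :: "complex ^ 'm::finite ^ 'k::finite"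
  shows "((\<lambda>t. M *v t) has_derivative (\<lambda>h. M *v h)) F"
proof (rule bounded_linear_imp_has_derivative)
  have "linear (\<lambda>t. M *v t)"
    by (rule linearI) (rule matrix_vector_right_distrib, simp add: vec_eq_iff matrix_vector_mult_def scaleR_sum_right)
  then show "bounded_linear (\<lambda>t. M *v t)" by (simp add: linear_conv_bounded_linear)
qed

lemma sum_axis:
  fixes v :: "complex ^ 'k::finite"
  shows "(\<Sum>i\<in>UNIV. v $ i * axis j 1 $ i) = v $ j"
proof -
  have "(\<Sum>i\<in>UNIV. v $ i * axis j 1 $ i) = (\<Sum>i\<in>UNIV. if i = j then v $ j else 0)"
    by (rule sum.cong) (auto simp: axis_def)
  then show ?thesis by simp
qed

lemma transpose_mult_eq_sum:
  fixes M :: "complex ^ 'm::finite ^ 'k::finite"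
  shows "transpose M *v v = (\<Sum>i\<in>UNIV. v $ i *s M $ i)"
  by (simp add: vec_eq_iff matrix_vector_mult_def transpose_def mult.commute)

context embedded_quartic
begin

text \<open>A vanishing form pulls back into \<open>cone_ideal\<close>, so the chain rule expresses
  its gradient by those of the quadrics. This is the upper bound for the Jacobian rank, valid for
  forms of all degrees at once.\<close>

lemma gradient_pullback:
  assumes F: "F \<in> vanishing_forms d (quartic_curve A)" and t: "t \<in> quartic_cone" "t \<noteq> 0"
  shows "transpose A *v gradient F (A *v t) \<in> vec.span {grad1 t, grad2 t}"
proof -
  have Ff: "F \<in> forms d" using F by (simp add: vanishing_forms_iff)
  have "(\<lambda>t. F (A *v t)) \<in> cone_ideal" using form_vanishing_or_finite[OF Ff] F by blast
  then obtain a b where ab: "((\<lambda>t. F (A *v t)) has_derivative (\<lambda>h. \<Sum>i\<in>UNIV. (a *s grad1 t + b *s grad2 t) $ i * h $ i)) (at t)"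
    using cone_idealD(2) t(1) by blast
  from has_derivative_compose[OF has_derivative_matrix forms_has_derivative[OF Ff]]
  have 2: "((\<lambda>t. F (A *v t)) has_derivative (\<lambda>h. \<Sum>i\<in>UNIV. gradient F (A *v t) $ i * (A *v h) $ i)) (at t)" .
  have "(\<Sum>i\<in>UNIV. gradient F (A *v t) $ i * (A *v h) $ i) = (\<Sum>i\<in>UNIV. (a *s grad1 t + b *s grad2 t) $ i * h $ i)" for h
    using has_derivative_unique[OF 2 ab] by (rule fun_cong)
  moreover have "(A *v axis j 1) $ i = A $ i $ j" for i j
    unfolding matrix_vector_mult_def by (simp add: sum_axis)
  ultimately have "(\<Sum>i\<in>UNIV. gradient F (A *v t) $ i * A $ i $ j) = (a *s grad1 t + b *s grad2 t) $ j" for j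
    by (metis (no_types, lifting) sum.cong sum_axis)
  then have "(transpose A *v gradient F (A *v t)) $ j = (a *s grad1 t + b *s grad2 t) $ j" for j
    by (simp only: matrix_vector_mult_def transpose_def vec_lambda_beta mult.commute)
  then have "transpose A *v gradient F (A *v t) = a *s grad1 t + b *s grad2 t" by (simp add: vec_eq_iff)
  then show ?thesis unfolding span_insert_coeffs by blast
qed

lemma gradient_linear: "gradient (\<lambda>x. (M *v x) $ i) x = M $ i"
proof (rule gradient_eqI)
  have "((\<lambda>x. \<Sum>j\<in>UNIV. M $ i $ j * x $ j) has_derivative (\<lambda>h. \<Sum>j\<in>UNIV. M $ i $ j * h $ j)) (at x)"
    by (intro has_derivative_sum has_derivative_mult_right has_derivative_nth)
  then show "((\<lambda>x. (M *v x) $ i) has_derivative (\<lambda>h. \<Sum>j\<in>UNIV. M $ i $ j * h $ j)) (at x)"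
    by (simp add: matrix_vector_mult_def)
qed

lemma gradient_comp_B:
  assumes "(q has_derivative (\<lambda>h. \<Sum>i\<in>UNIV. g $ i * h $ i)) (at (B *v x))"
  shows "gradient (\<lambda>x. q (B *v x)) x = transpose B *v g"
proof (rule gradient_eqI)
  have "(\<Sum>i\<in>UNIV. g $ i * (B *v h) $ i) = (\<Sum>j\<in>UNIV. (transpose B *v g) $ j * h $ j)" for h
    unfolding matrix_vector_mult_def transpose_def
    by (simp add: sum_distrib_left sum_distrib_right) (subst sum.swap, simp add: mult_ac)
  then show "((\<lambda>x. q (B *v x)) has_derivative (\<lambda>h. \<Sum>i\<in>UNIV. (transpose B *v g) $ i * h $ i)) (at x)"
    using has_derivative_compose[OF has_derivative_matrix assms] by simp
qed

lemma transpose_B_A: "transpose A *v (transpose B *v w) = w"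
  by (metis BA matrix_transpose_mul matrix_vector_mul_assoc matrix_vector_mul_lid transpose_mat)

text \<open>The span of the gradients is shown to have codimension exactly two: two vectors outside
  it are lifted from a complement of the quadric gradients, and together with explicit linear and
  quadratic forms they span everything.\<close>

lemma smooth: "smooth_projective_curve (quartic_curve A)"
  unfolding smooth_projective_curve_def
proof (intro conjI projective_curve allI impI)
  fix x assume x: "x \<noteq> 0 \<and> pt x \<in> quartic_curve A"
  then obtain t where t: "t \<in> quartic_cone" "t \<noteq> 0" "x = A *v t" using mem_curve_iff by blast
  define G where "G = (\<Union>d. (\<lambda>F. gradient F x) ` vanishing_forms d (quartic_curve A))"
  have G_pull: "transpose A *v g \<in> vec.span {grad1 t, grad2 t}" if "g \<in> vec.span G" for g
    using that
  proof (induction rule: vec.span_induct_alt)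
    case base
    then show ?case by (simp add: vec.span_zero)
  next
    case (step c g h)
    then obtain d F where F: "F \<in> vanishing_forms d (quartic_curve A)" "g = gradient F x" by (auto simp: G_def)
    have "transpose A *v g \<in> vec.span {grad1 t, grad2 t}"
      using gradient_pullback[OF F(1) t(1,2)] F(2) t(3) by simp
    then show ?case
      using step by (simp add: matrix_vector_right_distrib vector_scalar_commute vec.span_add vec.span_scale)
  qed
  obtain e e' where e: "e' \<notin> vec.span {grad1 t, grad2 t}" "e \<notin> vec.span (insert e' {grad1 t, grad2 t})"
    "vec.span (insert e (insert e' {grad1 t, grad2 t})) = UNIV"
    using gradients_extend_to_basis[OF t(1,2)] .
  let ?c = "transpose B *v e" and ?c' = "transpose B *v e'"
  have c': "?c' \<notin> vec.span G" using G_pull[of ?c'] e(1) by (auto simp: transpose_B_A)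
  have c: "?c \<notin> vec.span (insert ?c' G)"
  proof
    assume "?c \<in> vec.span (insert ?c' G)"
    then obtain k where "?c - k *s ?c' \<in> vec.span G" using vec.span_breakdown_eq by blast
    from G_pull[OF this] have "e - k *s e' \<in> vec.span {grad1 t, grad2 t}"
      by (simp add: matrix_vector_mult_diff_distrib vector_scalar_commute transpose_B_A)
    then show False using e(2) vec.span_breakdown_eq by blast
  qed
  have rows: "(mat 1 - A ** B) $ i \<in> G" for i
  proof -
    have "gradient (\<lambda>x. ((mat 1 - A ** B) *v x) $ i) x \<in> G"
      unfolding G_def by (intro UN_I[of 1] imageI linear_form UNIV_I)
    then show ?thesis by (simp only: gradient_linear)
  qed
  have quads: "transpose B *v grad1 t \<in> G" "transpose B *v grad2 t \<in> G"
  proof -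
    have Bx: "B *v x = t" by (simp add: t(3) B_A)
    have "gradient (\<lambda>x. quad1 (B *v x)) x \<in> G" "gradient (\<lambda>x. quad2 (B *v x)) x \<in> G"
      unfolding G_def by (intro UN_I[of 2] imageI quadratic_form UNIV_I)+
    moreover have "gradient (\<lambda>x. quad1 (B *v x)) x = transpose B *v grad1 t"
      "gradient (\<lambda>x. quad2 (B *v x)) x = transpose B *v grad2 t"
      by (rule gradient_comp_B, simp only: Bx, rule has_derivative_quad)+
    ultimately show "transpose B *v grad1 t \<in> G" "transpose B *v grad2 t \<in> G" by (simp_all only:)
  qed
  let ?U = "insert ?c (insert ?c' G)"
  have "v \<in> vec.span ?U" for v
  proof -
    have "transpose (mat 1 - A ** B) *v v = (\<Sum>i\<in>UNIV. v $ i *s (mat 1 - A ** B) $ i)"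
      by (rule transpose_mult_eq_sum)
    also have "\<dots> \<in> vec.span ?U"
      by (intro vec.span_sum vec.span_scale vec.span_base) (use rows in blast)
    finally have 1: "transpose (mat 1 - A ** B) *v v \<in> vec.span ?U" .
    have 2: "transpose B *v w \<in> vec.span ?U" for w
    proof -
      have "w \<in> vec.span (insert e (insert e' {grad1 t, grad2 t}))" using e(3) by blast
      then show ?thesis
      proof (induction rule: vec.span_induct_alt)
        case base
        then show ?case by (simp add: vec.span_zero)
      next
        case (step k g h)
        then have "transpose B *v g \<in> ?U" using quads by auto
        then show ?case
          using step by (simp add: matrix_vector_right_distrib vector_scalar_commute vec.span_add vec.span_scale vec.span_base)
      qed
    qed
    \<comment> \<open>The first part is a combination of gradients of linear forms; the second lies
      in the image of \<open>transpose B\<close>, where the quadric gradients and the two lifted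
      vectors span.\<close>
    have "v = transpose (mat 1 - A ** B) *v v + transpose B *v (transpose A *v v)"
    proof -
      have "transpose (mat 1 - A ** B) = mat 1 - transpose B ** transpose A"
        by (simp add: vec_eq_iff transpose_def mat_def matrix_matrix_mult_def mult.commute)
      then show ?thesis by (simp add: matrix_vector_mult_diff_rdistrib matrix_vector_mul_assoc)
    qed
    then show ?thesis using vec.span_add[OF 1 2[of "transpose A *v v"]] by simp
  qed
  then have "vec.span ?U = UNIV" by blast
  then have "vec.dim ?U = CARD('n)"
    by (metis vec.dim_span vec_dim_card)
  moreover have "vec.dim ?U = vec.dim G + 2" using c c' by (simp add: vec.dim_insert)
  ultimately show "vec.dim G + 2 = CARD('n)" unfolding G_def by simp
qed

end

subsection \<open>The Hilbert function\<close>

lemma cfun_dim_eq_card: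
  fixes f :: "'i \<Rightarrow> 'a \<Rightarrow> complex"
  assumes I: "finite I" and mem: "\<And>i. i \<in> I \<Longrightarrow> f i \<in> V"
    and span: "\<And>g. g \<in> V \<Longrightarrow> \<exists>c. \<forall>x. g x = (\<Sum>i\<in>I. c i * f i x)"
    and indep: "\<And>c i. (\<And>x. (\<Sum>i\<in>I. c i * f i x) = 0) \<Longrightarrow> i \<in> I \<Longrightarrow> c i = 0"
  shows "cfun.dim V = card I"
proof -
  have sum_apply: "(\<Sum>a\<in>A. h a) x = (\<Sum>a\<in>A. h a x)" for A :: "'b set" and h :: "'b \<Rightarrow> 'a \<Rightarrow> complex" and x
    by (induction A rule: infinite_finite_induct) auto
  have inj: "inj_on f I"
  proof (rule inj_onI, rule ccontr)
    fix i j assume ij: "i \<in> I" "j \<in> I" "f i = f j" "i \<noteq> j"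
    define c :: "'i \<Rightarrow> complex" where "c k = (if k = i then 1 else if k = j then - 1 else 0)" for k
    have "(\<Sum>k\<in>I. c k * f k x) = (\<Sum>k\<in>I. (if k = i then f i x else 0) - (if k = j then f j x else 0))" for x
      by (rule sum.cong) (use ij in \<open>auto simp: c_def\<close>)
    also have "\<dots> x = 0" for x
      using ij I by (simp add: sum_subtractf sum.delta')
    finally have "c i = 0" using indep ij(1) by blast
    then show False by (simp add: c_def)
  qed
  have "cfun.independent (f ` I)"
    unfolding cfun.dependent_finite[OF finite_imageI[OF I]]
  proof clarify
    fix u i assume sum0: "(\<Sum>v\<in>f ` I. (\<lambda>x. u v * v x)) = 0" and i: "i \<in> I" "u (f i) \<noteq> 0"
    have "(\<Sum>k\<in>I. u (f k) * f k x) = 0" for x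
    proof -
      have "(\<Sum>v\<in>f ` I. (\<lambda>x. u v * v x)) x = 0" using sum0 by simp
      then show ?thesis unfolding sum_apply sum.reindex[OF inj] by simp
    qed
    then have "u (f i) = 0" using indep[of "\<lambda>k. u (f k)"] i(1) by blast
    with i(2) show False by simp
  qed
  moreover have "cfun.span (f ` I) = cfun.span V"
  proof (rule equalityI)
    show "cfun.span (f ` I) \<subseteq> cfun.span V" using mem by (intro cfun.span_mono) auto
    have "g \<in> cfun.span (f ` I)" if g: "g \<in> V" for g
    proof -
      obtain c where "\<And>x. g x = (\<Sum>i\<in>I. c i * f i x)" using span[OF g] by blast
      then have "g = (\<Sum>i\<in>I. (\<lambda>x. c i * f i x))" by (simp add: fun_eq_iff sum_apply)
      also have "\<dots> \<in> cfun.span (f ` I)"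
        by (intro cfun.span_sum cfun.span_scale cfun.span_base) auto
      finally show ?thesis .
    qed
    then show "cfun.span V \<subseteq> cfun.span (f ` I)" by (metis cfun.span_minimal cfun.subspace_span subsetI)
  qed
  ultimately have "cfun.dim V = card (f ` I)" by (intro cfun.dim_eq_card)
  then show ?thesis using inj by (simp add: card_image)
qed

context embedded_quartic
begin

lemma cone_monomial_forms:
  assumes "k \<le> 2 * d"
  shows "(\<lambda>x. cone_monomial d k (B *v x)) \<in> forms d"
proof -
  have lin: "(\<lambda>x. (B *v x) $ i) \<in> forms 1" for i by (rule forms_linear)
  have "(\<lambda>x. cone_monomial d k (B *v x)) \<in> forms ((d - k div 2 - k mod 2) * 1 + k mod 2 * 1 + k div 2 * 1)"
    unfolding cone_monomial_def by (rule forms_mult[OF forms_mult]; rule forms_power[OF lin])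
  moreover have "(d - k div 2 - k mod 2) * 1 + k mod 2 * 1 + k div 2 * 1 = d"
    using half_sum_le[OF assms] by simp
  ultimately show ?thesis by (simp only:)
qed

text \<open>The basis consists of \<open>2 * d + 1\<close> cone monomials and of
  \<open>2 * d - 1\<close> further ones multiplied by the fourth coordinate. For
  \<open>d = 0\<close> truncation leaves one element instead of none, which is why
  \<open>d \<ge> 1\<close> is assumed.\<close>

lemma hilbert_function_curve:
  assumes d: "d \<ge> 1"
  shows "hilbert_function (quartic_curve A) d = 4 * d"
proof -
  let ?r = "\<lambda>F (x :: complex ^ 'n). if x \<noteq> 0 \<and> pt x \<in> quartic_curve A then F x else 0"
  let ?I = "Inl ` {..2 * d} \<union> Inr ` {..<2 * d - 1} :: (nat + nat) set"
  let ?m = "case_sum (\<lambda>k x. cone_monomial d k (B *v x)) (\<lambda>k x. (B *v x) $ 4 * cone_monomial (d - 1) k (B *v x))"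
  let ?f = "\<lambda>i. ?r (?m i)"
  have sum_I: "(\<Sum>i\<in>?I. c i * ?m i x) = cone_normal d (\<lambda>k. c (Inl k)) (\<lambda>k. c (Inr k)) (B *v x)" for c x
    by (subst sum.union_disjoint) (auto simp: cone_normal_def sum.reindex sum_distrib_left mult.left_commute)
  have sum_f: "(\<Sum>i\<in>?I. c i * ?f i x) = ?r (\<lambda>x. cone_normal d (\<lambda>k. c (Inl k)) (\<lambda>k. c (Inr k)) (B *v x)) x" for c x
  proof (cases "x \<noteq> 0 \<and> pt x \<in> quartic_curve A")
    case True
    then show ?thesis using sum_I[of c x] unfolding if_P[OF True] by simp
  next
    case False
    then show ?thesis unfolding if_not_P[OF False] by simp
  qed
  have "cfun.dim (?r ` forms d) = card ?I"
  proof (rule cfun_dim_eq_card)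
    show "finite ?I" by simp
  next
    fix i assume "i \<in> ?I"
    moreover have "(\<lambda>x. (B *v x) $ 4 * cone_monomial (d - 1) k (B *v x)) \<in> forms d" if "k < 2 * d - 1" for k
      using forms_mult[OF forms_linear[of B 4] cone_monomial_forms[of k "d - 1"]] that d by simp
    ultimately have "?m i \<in> forms d" by (auto simp: cone_monomial_forms)
    then show "?f i \<in> ?r ` forms d" by (rule imageI)
  next
    fix g assume "g \<in> ?r ` forms d"
    then obtain F where F: "F \<in> forms d" "g = ?r F" by blast
    obtain c e r where r': "r \<in> cone_ideal" "\<forall>t. F (A *v t) = cone_normal d c e t + r t"
      using form_normal[OF F(1)] by blast
    note r = r'(1) r'(2)[rule_format]
    have "g x = (\<Sum>i\<in>?I. case_sum c e i * ?f i x)" for x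
    proof (cases "x \<noteq> 0 \<and> pt x \<in> quartic_curve A")
      case True
      then obtain t where t: "t \<in> quartic_cone" "x = A *v t" using mem_curve_iff by blast
      then show ?thesis unfolding sum_f using True cone_idealD(1)[OF r(1) t(1)] by (simp add: F(2) r(2) B_A)
    next
      case False
      then show ?thesis unfolding sum_f by (simp only: F(2) if_False)
    qed
    then show "\<exists>c. \<forall>x. g x = (\<Sum>i\<in>?I. c i * ?f i x)" by blast
  next
    fix c i assume zero: "\<And>x. (\<Sum>i\<in>?I. c i * ?f i x) = 0" and i: "i \<in> ?I"
    have "cone_normal d (\<lambda>k. c (Inl k)) (\<lambda>k. c (Inr k)) (affine_point s y) = 0" if y: "y\<^sup>2 = 1 - s ^ 4" for s y
    proof -
      let ?x = "A *v affine_point s y"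
      have "?x \<noteq> 0" "pt ?x \<in> quartic_curve A"
        using A_eq_0_iff affine_point_nonzero affine_point_in_cone[OF y] by (auto simp: quartic_curve_def)
      then show ?thesis using zero[of ?x] unfolding sum_f by (simp add: B_A)
    qed
    note c0 = cone_normal_vanishes_imp_zero[OF this]
    show "c i = 0" using i c0 by auto
  qed
  also have "card ?I = 4 * d"
    using d by (subst card_Un_disjoint) (auto simp: card_image)
  finally show ?thesis by (simp add: hilbert_function_def)
qed

lemma hilbert_polynomial_curve: "hilbert_polynomial (quartic_curve A) = [:0, 4:]"
  unfolding hilbert_polynomial_def
proof (rule the_equality)
  have ev: "\<forall>\<^sub>F d in sequentially. of_nat (hilbert_function (quartic_curve A) d) = (4 * of_nat d :: rat)"
    using eventually_ge_at_top[of 1] by eventually_elim (simp add: hilbert_function_curve)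
  then show "\<forall>\<^sub>F d in sequentially. of_nat (hilbert_function (quartic_curve A) d) = poly [:0, 4:] (of_nat d :: rat)"
    by eventually_elim (simp add: mult.commute)
  fix P :: "rat poly"
  assume "\<forall>\<^sub>F d in sequentially. of_nat (hilbert_function (quartic_curve A) d) = poly P (of_nat d)"
  with ev have "\<forall>\<^sub>F d in sequentially. poly (P - [:0, 4:]) (of_nat d) = 0"
    by eventually_elim (simp add: mult.commute)
  then obtain N where N: "\<And>d. d \<ge> N \<Longrightarrow> poly (P - [:0, 4:]) (of_nat d) = 0"
    unfolding eventually_sequentially by blast
  have "P - [:0, 4:] = 0"
  proof (rule ccontr)
    assume "P - [:0, 4:] \<noteq> 0"
    then have "finite {x. poly (P - [:0, 4:]) x = 0}" by (rule poly_roots_finite)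
    moreover have "of_nat ` {N..} \<subseteq> {x. poly (P - [:0, 4:]) x = 0}" using N by blast
    ultimately have "finite ((of_nat :: nat \<Rightarrow> rat) ` {N..})" by (rule rev_finite_subset)
    then show False using infinite_Ici[of N] by (simp add: finite_image_iff inj_on_def)
  qed
  then show "P = [:0, 4:]" by simp
qed

lemma elliptic: "elliptic_curve (quartic_curve A)"
  using smooth by (simp add: elliptic_curve_def curve_genus_def hilbert_polynomial_curve)

end

section \<open>The topology of projective space\<close>

lemma open_proj_iff: "open (U :: 'n::finite proj set) \<longleftrightarrow> open {x. x \<noteq> 0 \<and> pt x \<in> U}"
  by (simp add: open_proj_def)

text \<open>The homogeneous function \<open>minors x\<close> of degree zero vanishes exactly on the line through \<open>x\<close>.\<close>

definition minors :: "complex ^ 'n \<Rightarrow> complex ^ 'n::finite \<Rightarrow> real" where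
  "minors x z = (\<Sum>i\<in>UNIV. \<Sum>j\<in>UNIV. norm (z $ i * x $ j - z $ j * x $ i)) / norm z"

lemma norm_smult: "norm (c *s (z :: complex ^ 'n::finite)) = norm c * norm z"
proof -
  have "norm (c *s z) = L2_set (\<lambda>i. norm c * norm (z $ i)) UNIV"
    by (simp add: norm_vec_def norm_mult)
  also have "\<dots> = norm c * L2_set (\<lambda>i. norm (z $ i)) UNIV"
    by (rule L2_set_right_distrib[symmetric]) simp
  finally show ?thesis by (simp add: norm_vec_def)
qed

lemma minors_scale:
  assumes "c \<noteq> 0"
  shows "minors x (c *s z) = minors x z"
proof -
  have "norm ((c *s z) $ i * x $ j - (c *s z) $ j * x $ i) = norm c * norm (z $ i * x $ j - z $ j * x $ i)" for i j
    by (simp add: norm_mult[symmetric] algebra_simps)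
  then show ?thesis
    using assms by (simp add: minors_def norm_smult sum_distrib_left[symmetric])
qed

lemma minors_eq_0_iff:
  assumes "x \<noteq> 0" "z \<noteq> 0"
  shows "minors x z = 0 \<longleftrightarrow> pt z = pt x"
proof
  assume "minors x z = 0"
  then have *: "z $ i * x $ j = z $ j * x $ i" for i j
    using assms(2) by (auto simp: minors_def sum_nonneg_eq_0_iff sum_nonneg)
  obtain j where j: "x $ j \<noteq> 0" using assms(1) by (auto simp: vec_eq_iff)
  have z: "z = (z $ j / x $ j) *s x"
    using j *[of _ j] by (simp add: vec_eq_iff field_simps)
  then have "z $ j / x $ j \<noteq> 0" using assms(2) by (metis vector_smult_lzero)
  then show "pt z = pt x" using z pt_scale by metis
next
  assume "pt z = pt x"
  then obtain c where "z = c *s x" using pt_eq_iff[of x z] assms by auto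
  then show "minors x z = 0" by (simp add: minors_def mult_ac)
qed

lemma continuous_on_minors: "continuous_on (- {0}) (minors x)"
  unfolding minors_def[abs_def] by (intro continuous_intros) auto

text \<open>With \<open>x\<close> fixed, \<open>minors x\<close> is a continuous function on the
  projective space that is zero at \<open>pt x\<close> only. Its sublevel and superlevel sets at
  half of its value at \<open>pt y\<close> separate the two points.\<close>

instance proj :: (finite) t2_space
proof
  fix p q :: "'a proj" assume "p \<noteq> q"
  obtain x where x: "x \<noteq> 0" "p = pt x" by (rule proj_cases)
  obtain y where y: "y \<noteq> 0" "q = pt y" by (rule proj_cases)
  define d where "d = minors x y"
  have "d \<ge> 0" unfolding d_def minors_def by (intro divide_nonneg_nonneg sum_nonneg) auto
  moreover have "d \<noteq> 0" using minors_eq_0_iff[OF x(1) y(1)] x y \<open>p \<noteq> q\<close> by (simp add: d_def)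
  ultimately have d: "d > 0" by simp
  define S where "S T = {r. \<exists>z. z \<noteq> 0 \<and> r = pt z \<and> minors x z \<in> T}" for T
  have S_iff: "pt z \<in> S T \<longleftrightarrow> minors x z \<in> T" if z: "z \<noteq> 0" for z T
  proof
    assume "pt z \<in> S T"
    then obtain z' where z': "z' \<noteq> 0" "pt z = pt z'" "minors x z' \<in> T" by (auto simp: S_def)
    then obtain c where "c \<noteq> 0" "z' = c *s z" using pt_eq_iff[OF z z'(1)] by auto
    then show "minors x z \<in> T" using z'(3) by (simp add: minors_scale)
  qed (use z in \<open>auto simp: S_def\<close>)
  have S_open: "open (S T)" if "open T" for T
  proof -
    have "{z. z \<noteq> 0 \<and> pt z \<in> S T} = - {0} \<inter> minors x -` T" using S_iff by auto
    moreover have "open (- {0} \<inter> minors x -` T)"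
      by (rule continuous_open_preimage[OF continuous_on_minors _ that]) auto
    ultimately show ?thesis by (simp add: open_proj_iff)
  qed
  have "S {..<d / 2} \<inter> S {d / 2<..} = {}"
  proof -
    have "r \<notin> S {d / 2<..}" if "r \<in> S {..<d / 2}" for r
    proof -
      obtain z where z: "z \<noteq> 0" "r = pt z" by (rule proj_cases)
      then show ?thesis using that S_iff by auto
    qed
    then show ?thesis by blast
  qed
  moreover have "p \<in> S {..<d / 2}" using x d minors_eq_0_iff[OF x(1) x(1)] by (simp add: S_iff)
  moreover have "q \<in> S {d / 2<..}" using y d by (simp add: S_iff d_def)
  ultimately show "\<exists>U V. open U \<and> open V \<and> p \<in> U \<and> q \<in> V \<and> U \<inter> V = {}"
    using S_open by (intro exI[of _ "S {..<d / 2}"] exI[of _ "S {d / 2<..}"]) auto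
qed

lemma continuous_on_pt: "continuous_on (- {0}) pt"
proof -
  have "open (pt -` U \<inter> - {0})" if "open U" for U :: "'a proj set"
  proof -
    have "pt -` U \<inter> - {0} = {x. x \<noteq> 0 \<and> pt x \<in> U}" by auto
    then show ?thesis using that by (simp add: open_proj_iff)
  qed
  moreover have "open (- {0 :: complex ^ 'a})" by (intro open_Compl closed_singleton)
  ultimately show ?thesis by (simp only: continuous_on_open_vimage) blast
qed

lemma pt_in_closed:
  fixes x :: "complex ^ 'n::finite"
  assumes "closed S" "F \<noteq> bot" "(f \<longlongrightarrow> x) F" "x \<noteq> 0" "\<forall>\<^sub>F t in F. pt (f t) \<in> S"
  shows "pt x \<in> S"
proof -
  have "open (- {0 :: complex ^ 'n})" by (intro open_Compl closed_singleton)
  from iffD1[OF continuous_on_eq_continuous_at[OF this] continuous_on_pt]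
  have "isCont pt x" using assms(4) by simp
  then have "((\<lambda>t. pt (f t)) \<longlongrightarrow> pt x) F"
    by (rule isCont_tendsto_compose) (rule assms(3))
  from Lim_in_closed_set[OF assms(1,5,2) this] show ?thesis .
qed

lemma continuous_on_matrix [continuous_intros]:
  fixes M :: "complex ^ 'm::finite ^ 'k::finite"
  assumes "continuous_on S f"
  shows "continuous_on S (\<lambda>x. M *v f x)"
proof -
  have "continuous_on UNIV (\<lambda>x. M *v x)"
    using has_derivative_continuous_on[OF has_derivative_matrix] by blast
  from continuous_on_compose2[OF this assms] show ?thesis by simp
qed

context embedded_quartic
begin

lemma closed_curve: "closed (quartic_curve A)"
proof -
  have K: "closed quartic_cone"
  proof -
    have eq: "quartic_cone = {t. t $ 1 * t $ 3 = (t $ 2)\<^sup>2} \<inter> {t. (t $ 4)\<^sup>2 = (t $ 1)\<^sup>2 - (t $ 3)\<^sup>2}"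
      by (auto simp: quartic_cone_def)
    show ?thesis
      unfolding eq by (intro closed_Int closed_Collect_eq continuous_intros)
  qed
  have "closed {x. A *v (B *v x) = x}"
    by (intro closed_Collect_eq continuous_intros)
  moreover have "closed ((\<lambda>x. B *v x) -` quartic_cone)"
    by (rule closed_vimage[OF K]) (intro continuous_intros)
  ultimately have "open (- ({x. A *v (B *v x) = x} \<inter> ((\<lambda>x. B *v x) -` quartic_cone)))"
    by (intro open_Compl closed_Int)
  moreover have "{x. x \<noteq> 0 \<and> pt x \<in> - quartic_curve A} = - ({x. A *v (B *v x) = x} \<inter> ((\<lambda>x. B *v x) -` quartic_cone))"
  proof (rule set_eqI)
    fix x
    show "x \<in> {x. x \<noteq> 0 \<and> pt x \<in> - quartic_curve A} \<longleftrightarrow> x \<in> - ({x. A *v (B *v x) = x} \<inter> ((\<lambda>x. B *v x) -` quartic_cone))"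
    proof (cases "x = 0")
      case True
      then show ?thesis by (simp add: quartic_cone_def)
    next
      case False
      then show ?thesis using mem_curve_iff'[OF False] by auto
    qed
  qed
  ultimately show ?thesis by (simp only: closed_def open_proj_iff)
qed

end

section \<open>The shift curve\<close>

lemma UNIV_coord: "(UNIV :: coord set) = {Z1, Z2, Z3, W1, W2, W3, C}"
  using coord.exhaust by blast

lemma sum_coord: "(\<Sum>i\<in>UNIV. f i) = f Z1 + f Z2 + f Z3 + f W1 + f W2 + f W3 + f C"
  by (simp add: UNIV_coord add_ac)

lemma forall_coord: "(\<forall>i. P i) \<longleftrightarrow> P Z1 \<and> P Z2 \<and> P Z3 \<and> P W1 \<and> P W2 \<and> P W3 \<and> P C"
proof (intro iffI allI)
  fix i assume "P Z1 \<and> P Z2 \<and> P Z3 \<and> P W1 \<and> P W2 \<and> P W3 \<and> P C"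
  then show "P i" by (cases i) auto
qed auto

lemma coord_vec_eq_iff:
  "(x :: complex ^ coord) = y \<longleftrightarrow> x $ Z1 = y $ Z1 \<and> x $ Z2 = y $ Z2 \<and> x $ Z3 = y $ Z3 \<and>
    x $ W1 = y $ W1 \<and> x $ W2 = y $ W2 \<and> x $ W3 = y $ W3 \<and> x $ C = y $ C"
  by (simp only: vec_eq_iff forall_coord)

text \<open>The columns belong to \<open>a\<^sup>2\<close>, \<open>a * b\<close>,
  \<open>b\<^sup>2\<close> and \<open>y\<close>. The shift \<open>w = z + 1\<close> keeps
  \<open>a\<close> and multiplies \<open>b\<close> by \<open>\<i>\<close>, which gives the entries
  for \<open>W1\<close>, \<open>W2\<close>, \<open>W3\<close> and \<open>C\<close>; the entry for
  \<open>Z3\<close> is \<open>2 * exp (pi * \<i> / 4)\<close>.\<close>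

definition shift_matrix :: "complex ^ 4 ^ coord" where
  "shift_matrix = (\<chi> i. case i of Z1 \<Rightarrow> vec4 0 0 0 1 | Z2 \<Rightarrow> vec4 0 0 0 1
     | Z3 \<Rightarrow> vec4 0 (of_real (sqrt 2) * (1 + \<i>)) 0 0 | W1 \<Rightarrow> vec4 0 (1 + \<i>) 0 0 | W2 \<Rightarrow> vec4 0 (1 + \<i>) 0 0
     | W3 \<Rightarrow> vec4 1 0 (- \<i>) 0 | C \<Rightarrow> vec4 1 0 \<i> 0)"

definition shift_matrix_inv :: "complex ^ coord ^ 4" where
  "shift_matrix_inv = (\<chi> j i. if j = 1 then (case i of W3 \<Rightarrow> 1 / 2 | C \<Rightarrow> 1 / 2 | _ \<Rightarrow> 0)
     else if j = 2 then (case i of W1 \<Rightarrow> 1 / (1 + \<i>) | _ \<Rightarrow> 0)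
     else if j = 3 then (case i of W3 \<Rightarrow> \<i> / 2 | C \<Rightarrow> - \<i> / 2 | _ \<Rightarrow> 0)
     else (case i of Z2 \<Rightarrow> 1 | _ \<Rightarrow> 0))"

lemma shift_matrix_nth:
  "(shift_matrix *v t) $ Z1 = t $ 4" "(shift_matrix *v t) $ Z2 = t $ 4"
  "(shift_matrix *v t) $ Z3 = of_real (sqrt 2) * (1 + \<i>) * t $ 2"
  "(shift_matrix *v t) $ W1 = (1 + \<i>) * t $ 2" "(shift_matrix *v t) $ W2 = (1 + \<i>) * t $ 2"
  "(shift_matrix *v t) $ W3 = t $ 1 - \<i> * t $ 3" "(shift_matrix *v t) $ C = t $ 1 + \<i> * t $ 3"
  by (simp_all add: shift_matrix_def matrix_vector_mult_def sum_4)

lemma shift_matrix_inv_nth: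
  "(shift_matrix_inv *v x) $ 1 = (x $ C + x $ W3) / 2" "(shift_matrix_inv *v x) $ 2 = x $ W1 / (1 + \<i>)"
  "(shift_matrix_inv *v x) $ 3 = - \<i> * (x $ C - x $ W3) / 2" "(shift_matrix_inv *v x) $ 4 = x $ Z2"
  by (simp_all add: shift_matrix_inv_def matrix_vector_mult_def sum_coord algebra_simps add_divide_distrib diff_divide_distrib)

lemma one_plus_i_nonzero: "1 + \<i> \<noteq> 0"
  by (simp add: complex_eq_iff)

interpretation shift: embedded_quartic shift_matrix shift_matrix_inv
proof
  have "shift_matrix_inv *v (shift_matrix *v t) = t" for t
    using one_plus_i_nonzero by (simp add: vec4_eq_iff shift_matrix_nth shift_matrix_inv_nth)
  then show "shift_matrix_inv ** shift_matrix = mat 1"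
    unfolding matrix_eq by (simp add: matrix_vector_mul_assoc[symmetric])
qed

lemma theta_map_shift:
  assumes z: "Im z > 0"
  defines "t \<equiv> vec4 (theta 0 0 (2 * z) ^ 2) (theta 0 0 (2 * z) * theta 1 0 (2 * z)) (theta 1 0 (2 * z) ^ 2) (theta 0 0 z * theta 0 1 z)"
  shows "t \<in> quartic_cone" "t \<noteq> 0" "(\<chi> i. theta_coord z (z + 1) i) = shift_matrix *v t"
proof -
  show "t \<in> quartic_cone"
    using theta_fourth_powers[OF z] by (simp add: t_def quartic_cone_def power_mult_distrib flip: power_mult)
  show "t \<noteq> 0" using theta_double_nonzero[OF z] by (simp add: t_def vec4_eq_iff)
  have sqrt2: "of_real (sqrt 2) * exp (of_real pi * \<i> / 4) = 1 + \<i>"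
  proof -
    have "exp (of_real pi * \<i> / 4) = cis (pi / 4)" by (simp add: cis_conv_exp mult.commute)
    moreover have "of_real (sqrt 2) * cis (pi / 4) = 1 + \<i>" by (simp add: complex_eq_iff cos_45 sin_45)
    ultimately show ?thesis by (simp only:)
  qed
  have "of_real (sqrt 2) * (1 + \<i>) = of_real (sqrt 2) * of_real (sqrt 2) * exp (of_real pi * \<i> / 4)"
    unfolding sqrt2[symmetric] by simp
  also have "\<dots> = 2 * exp (of_real pi * \<i> / 4)" by (simp flip: of_real_mult)
  finally have Z3: "theta 1 0 z * theta 1 0 (z + 1) = of_real (sqrt 2) * (1 + \<i>) * (theta 0 0 (2 * z) * theta 1 0 (2 * z))"
    using theta_squares(3)[OF z] unfolding theta_10_add_one by (simp add: power2_eq_square mult_ac)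
  show "(\<chi> i. theta_coord z (z + 1) i) = shift_matrix *v t"
    unfolding coord_vec_eq_iff shift_matrix_nth vec_lambda_beta theta_coord_def coord.case
      theta_00_add_one theta_01_add_one theta_double_add_one Z3
    by (simp add: t_def power2_eq_square algebra_simps)
qed

lemma theta_map_shift_dense_part:
  assumes t: "s \<noteq> 0" "s ^ 4 \<noteq> 1" and y: "y\<^sup>2 = 1 - s ^ 4"
  obtains z where "Im z > 0" "pt (shift_matrix *v affine_point s y) = theta_map z (z + 1)"
proof -
  obtain z where z: "Im z > 0" "theta 1 0 (2 * z) = s * theta 0 0 (2 * z)"
    "theta 0 0 z * theta 0 1 z = y * theta 0 0 (2 * z) ^ 2"
    using theta_curve_surj[OF t y] .
  let ?a = "theta 0 0 (2 * z)"
  have "vec4 (?a ^ 2) (?a * theta 1 0 (2 * z)) (theta 1 0 (2 * z) ^ 2) (theta 0 0 z * theta 0 1 z) = ?a\<^sup>2 *s affine_point s y"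
    by (simp add: vec4_eq_iff affine_point_def z power_mult_distrib power2_eq_square)
  then have "theta_map z (z + 1) = pt (?a\<^sup>2 *s (shift_matrix *v affine_point s y))"
    using theta_map_shift(3)[OF z(1)] by (simp add: theta_map_def vector_scalar_commute)
  also have "\<dots> = pt (shift_matrix *v affine_point s y)"
    using theta_double_nonzero[OF z(1)] by (intro pt_scale) simp
  finally show ?thesis using z(1) that by simp
qed

lemma eventually_not_root: "\<forall>\<^sub>F s in at s0. s \<noteq> 0 \<and> s ^ 4 \<noteq> (1 :: complex)"
proof -
  have "finite {s :: complex. poly [:-1, 0, 0, 0, 1:] s = 0}" by (rule poly_roots_finite) simp
  then have "finite ({0} \<union> {s :: complex. poly [:-1, 0, 0, 0, 1:] s = 0})" by simp
  then have "\<forall>\<^sub>F s in at s0. s \<notin> {0} \<union> {s :: complex. poly [:-1, 0, 0, 0, 1:] s = 0}"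
    using islimpt_finite islimpt_iff_eventually by blast
  then show ?thesis
    by eventually_elim (auto simp: power4_eq_xxxx mult.assoc)
qed

text \<open>For \<open>y0 \<noteq> 0\<close> the quotient of \<open>g\<close> by
  \<open>y0\<^sup>2\<close> tends to one, a point off the branch cut of \<open>csqrt\<close>. For
  \<open>y0 = 0\<close> the root tends to zero because its norm does.\<close>

lemma sqrt_branch:
  fixes g :: "complex \<Rightarrow> complex"
  assumes "isCont g s0" "y0\<^sup>2 = g s0"
  shows "\<exists>y. (\<forall>s. (y s)\<^sup>2 = g s) \<and> (y \<longlongrightarrow> y0) (at s0)"
proof (cases "y0 = 0")
  case True
  have g0: "(g \<longlongrightarrow> 0) (at s0)" using assms True by (simp add: isCont_def)
  have "((\<lambda>s. sqrt (norm (g s))) \<longlongrightarrow> sqrt (norm (0 :: complex))) (at s0)"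
    by (intro tendsto_intros g0)
  then have "((\<lambda>s. norm (csqrt (g s))) \<longlongrightarrow> 0) (at s0)" by simp
  then have "((\<lambda>s. csqrt (g s)) \<longlongrightarrow> y0) (at s0)" using True tendsto_norm_zero_iff by blast
  then show ?thesis by (intro exI[of _ "\<lambda>s. csqrt (g s)"]) simp
next
  case False
  have "((\<lambda>s. g s / y0\<^sup>2) \<longlongrightarrow> g s0 / y0\<^sup>2) (at s0)"
    using assms(1) False by (intro tendsto_intros) (simp_all add: isCont_def)
  moreover have "g s0 / y0\<^sup>2 = 1" unfolding assms(2)[symmetric] using False by simp
  ultimately have g1: "((\<lambda>s. g s / y0\<^sup>2) \<longlongrightarrow> 1) (at s0)" by (simp only:)
  have "isCont csqrt 1" by (rule continuous_at_csqrt) simp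
  from isCont_tendsto_compose[OF this g1]
  have "((\<lambda>s. y0 * csqrt (g s / y0\<^sup>2)) \<longlongrightarrow> y0 * csqrt 1) (at s0)" by (intro tendsto_intros)
  then have lim: "((\<lambda>s. y0 * csqrt (g s / y0\<^sup>2)) \<longlongrightarrow> y0) (at s0)" by simp
  have "(y0 * csqrt (g s / y0\<^sup>2))\<^sup>2 = g s" for s using False by (simp add: power_mult_distrib)
  with lim show ?thesis by (intro exI[of _ "\<lambda>s. y0 * csqrt (g s / y0\<^sup>2)"]) simp
qed

lemma tendsto_vec4:
  assumes "(a \<longlongrightarrow> a') F" "(b \<longlongrightarrow> b') F" "(c \<longlongrightarrow> c') F" "(d \<longlongrightarrow> d') F"
  shows "((\<lambda>x. vec4 (a x) (b x) (c x) (d x)) \<longlongrightarrow> vec4 a' b' c' d') F"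
proof (rule vec_tendstoI)
  fix i :: 4
  show "((\<lambda>x. vec4 (a x) (b x) (c x) (d x) $ i) \<longlongrightarrow> vec4 a' b' c' d' $ i) F"
    using exhaust_4[of i] assms by auto
qed

text \<open>Theta points cover the affine part except over \<open>s = 0\<close> and
  \<open>s ^ 4 = 1\<close>. The points left out, including those at infinity, are limits along a
  branch of the square root.\<close>

theorem shift_curve_eq: "shift_curve = quartic_curve shift_matrix"
proof
  let ?T = "{theta_map z w | z w. z \<in> upper_half_plane \<and> w \<in> upper_half_plane \<and> w = z + 1}"
  have T: "theta_map z (z + 1) \<in> ?T" if "Im z > 0" for z
    using that by (auto simp: upper_half_plane_def)
  have "?T \<subseteq> quartic_curve shift_matrix"
  proof clarify
    fix z assume "z \<in> upper_half_plane"
    then have z: "Im z > 0" by (simp add: upper_half_plane_def)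
    show "theta_map z (z + 1) \<in> quartic_curve shift_matrix"
      unfolding theta_map_def theta_map_shift(3)[OF z] quartic_curve_def
      using theta_map_shift(1,2)[OF z] by blast
  qed
  then show "shift_curve \<subseteq> quartic_curve shift_matrix"
    unfolding shift_curve_def by (rule closure_minimal) (rule shift.closed_curve)
  have cont: "((\<lambda>t. shift_matrix *v f t) \<longlongrightarrow> shift_matrix *v x) F" if "(f \<longlongrightarrow> x) F" for f x and F :: "complex filter"
  proof -
    have "continuous_on UNIV (\<lambda>t. shift_matrix *v t)" by (intro continuous_intros)
    then have "isCont (\<lambda>t. shift_matrix *v t) x" by (simp add: continuous_on_eq_continuous_at)
    from isCont_tendsto_compose[OF this that] show ?thesis .
  qed
  have limit: "pt (shift_matrix *v t0) \<in> shift_curve"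
    if f: "(f \<longlongrightarrow> t0) (at s0)" "t0 \<noteq> 0" and
      g: "\<And>s. s \<noteq> 0 \<Longrightarrow> s ^ 4 \<noteq> 1 \<Longrightarrow> pt (shift_matrix *v f s) \<in> ?T"
    for f t0 and s0 :: complex
  proof (rule pt_in_closed[where F = "at s0" and f = "\<lambda>s. shift_matrix *v f s"])
    show "closed shift_curve" unfolding shift_curve_def by (rule closed_closure)
    show "((\<lambda>s. shift_matrix *v f s) \<longlongrightarrow> shift_matrix *v t0) (at s0)" by (rule cont[OF f(1)])
    show "shift_matrix *v t0 \<noteq> 0" using f(2) by (simp add: shift.A_eq_0_iff)
    show "\<forall>\<^sub>F s in at s0. pt (shift_matrix *v f s) \<in> shift_curve"
      using eventually_not_root
    proof eventually_elim
      case (elim s)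
      then show ?case using g[of s] closure_subset[of ?T] unfolding shift_curve_def by blast
    qed
  qed simp
  show "quartic_curve shift_matrix \<subseteq> shift_curve"
  proof
    fix p assume "p \<in> quartic_curve shift_matrix"
    then obtain t where t: "t \<in> quartic_cone" "t \<noteq> 0" "p = pt (shift_matrix *v t)"
      by (auto simp: quartic_curve_def)
    show "p \<in> shift_curve"
      using t(1,2)
    proof (cases rule: shift.cone_cases)
      case (affine s0 y0 c)
      have "isCont (\<lambda>s. 1 - s ^ 4) s0" by (intro continuous_intros)
      from sqrt_branch[OF this affine(3)]
      obtain y where "\<forall>s. (y s)\<^sup>2 = 1 - s ^ 4" and y2: "(y \<longlongrightarrow> y0) (at s0)" by blast
      note y = this(1)[rule_format] y2
      have "pt (shift_matrix *v affine_point s0 y0) \<in> shift_curve"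
      proof (rule limit)
        show "((\<lambda>s. affine_point s (y s)) \<longlongrightarrow> affine_point s0 y0) (at s0)"
          unfolding affine_point_def by (intro tendsto_vec4 tendsto_intros y)
        fix s :: complex assume "s \<noteq> 0" "s ^ 4 \<noteq> 1"
        then obtain z where "Im z > 0" "pt (shift_matrix *v affine_point s (y s)) = theta_map z (z + 1)"
          using theta_map_shift_dense_part y(1) by blast
        then show "pt (shift_matrix *v affine_point s (y s)) \<in> ?T" using T by simp
      qed (rule affine_point_nonzero)
      then show ?thesis
        unfolding t(3) affine(2) vector_scalar_commute pt_scale[OF affine(1)] .
    next
      case (infinite y0 c)
      \<comment> \<open>At infinity the local parameter is \<open>s = a / b\<close>, so the roles of
        \<open>a\<close> and \<open>b\<close> are exchanged and the equation becomes
        \<open>y\<^sup>2 = s ^ 4 - 1\<close>. For \<open>s \<noteq> 0\<close> the point is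
        \<open>s\<^sup>2\<close> times the affine point over \<open>1 / s\<close>.\<close>
      have "isCont (\<lambda>s. s ^ 4 - 1) (0 :: complex)" by (intro continuous_intros)
      moreover have "y0\<^sup>2 = 0 ^ 4 - 1" using infinite(3) by simp
      ultimately have "\<exists>y. (\<forall>s. (y s)\<^sup>2 = s ^ 4 - 1) \<and> (y \<longlongrightarrow> y0) (at 0)"
        by (rule sqrt_branch)
      then obtain y where "\<forall>s. (y s)\<^sup>2 = s ^ 4 - 1" and y2: "(y \<longlongrightarrow> y0) (at 0)" by blast
      note y = this(1)[rule_format] y2
      have "pt (shift_matrix *v vec4 0 0 1 y0) \<in> shift_curve"
      proof (rule limit)
        have "((\<lambda>s. vec4 (s\<^sup>2) s 1 (y s)) \<longlongrightarrow> vec4 (0\<^sup>2) 0 1 y0) (at 0)"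
          by (intro tendsto_vec4 tendsto_intros y)
        then show "((\<lambda>s. vec4 (s\<^sup>2) s 1 (y s)) \<longlongrightarrow> vec4 0 0 1 y0) (at 0)" by simp
        fix s :: complex assume s: "s \<noteq> 0" "s ^ 4 \<noteq> 1"
        have "(y s / s\<^sup>2)\<^sup>2 = 1 - (1 / s) ^ 4"
          using s by (simp add: power_divide y diff_divide_distrib flip: power_mult)
        moreover have "1 / s \<noteq> 0" "(1 / s) ^ 4 \<noteq> 1" using s by (simp_all add: power_divide)
        ultimately obtain z where z: "Im z > 0" "pt (shift_matrix *v affine_point (1 / s) (y s / s\<^sup>2)) = theta_map z (z + 1)"
          using theta_map_shift_dense_part by blast
        have "vec4 (s\<^sup>2) s 1 (y s) = s\<^sup>2 *s affine_point (1 / s) (y s / s\<^sup>2)"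
          using s by (simp add: vec4_eq_iff affine_point_def power_divide) (simp add: power2_eq_square)
        moreover have "s\<^sup>2 \<noteq> 0" using s by simp
        ultimately have "pt (shift_matrix *v vec4 (s\<^sup>2) s 1 (y s)) = theta_map z (z + 1)"
          using z(2) pt_scale by (metis vector_scalar_commute)
        then show "pt (shift_matrix *v vec4 (s\<^sup>2) s 1 (y s)) \<in> ?T" using T[OF z(1)] by simp
      qed (simp add: vec4_eq_iff)
      then show ?thesis
        unfolding t(3) infinite(2) vector_scalar_commute pt_scale[OF infinite(1)] .
    qed
  qed
qed

subsection \<open>Equations\<close>

definition box_cone :: "(complex ^ coord) set" where
  "box_cone = {x. (x $ W1)\<^sup>2 + (x $ W2)\<^sup>2 = (x $ Z3)\<^sup>2 \<and> (x $ W1)\<^sup>2 + (x $ W3)\<^sup>2 = (x $ Z2)\<^sup>2 \<and>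
     (x $ W2)\<^sup>2 + (x $ W3)\<^sup>2 = (x $ Z1)\<^sup>2 \<and> (x $ W1)\<^sup>2 + (x $ W2)\<^sup>2 + (x $ W3)\<^sup>2 = (x $ C)\<^sup>2}"

lemma box_cone_smult: "x \<in> box_cone \<Longrightarrow> c *s x \<in> box_cone"
  unfolding box_cone_def mem_Collect_eq vector_smult_component power_mult_distrib distrib_left[symmetric]
  by (elim conjE, intro conjI; simp only:)

lemma box_variety_eq: "box_variety = {pt x | x. x \<noteq> 0 \<and> x \<in> box_cone}"
  by (simp only: box_variety_def box_cone_def mem_Collect_eq)

lemma mem_box_variety_iff:
  assumes "x \<noteq> 0"
  shows "pt x \<in> box_variety \<longleftrightarrow> x \<in> box_cone"
proof
  assume "pt x \<in> box_variety"
  then obtain x' where x': "x' \<noteq> 0" "x' \<in> box_cone" "pt x' = pt x"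
    by (auto simp: box_variety_eq)
  then obtain c where "x = c *s x'" using pt_eq_iff[OF x'(1) assms] by auto
  then show "x \<in> box_cone" using x'(2) box_cone_smult by simp
next
  assume "x \<in> box_cone"
  with assms show "pt x \<in> box_variety"
    unfolding box_variety_eq by (intro CollectI exI[of _ x] conjI refl)
qed

definition shift_equations :: "complex ^ coord \<Rightarrow> bool" where
  "shift_equations x \<longleftrightarrow> x $ W1 = x $ W2 \<and> x $ Z1 = x $ Z2 \<and> of_real (sqrt 2) * x $ W1 = x $ Z3 \<and>
       (x $ W3)\<^sup>2 + (x $ Z3)\<^sup>2 - (x $ C)\<^sup>2 = 0 \<and>
       2 * (x $ Z2)\<^sup>2 + (x $ Z3)\<^sup>2 - 2 * (x $ C)\<^sup>2 = 0"

lemma of_real_sqrt2_squared: "(of_real (sqrt 2) * x)\<^sup>2 = 2 * (x :: complex)\<^sup>2"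
  by (simp add: power_mult_distrib flip: of_real_power)

text \<open>The linear description is the one that monomial matrices transport to the other curves;
  the second one yields the equations of the theorem. Membership is recovered by inverting
  \<open>shift_matrix\<close> and checking the two quadrics from the box equations.\<close>

lemma mem_shift_curve_iff:
  assumes "x \<noteq> 0"
  shows "pt x \<in> shift_curve \<longleftrightarrow> x \<in> box_cone \<and> x $ W1 = x $ W2 \<and> x $ Z1 = x $ Z2 \<and> of_real (sqrt 2) * x $ W1 = x $ Z3"
    and "pt x \<in> shift_curve \<longleftrightarrow> x \<in> box_cone \<and> shift_equations x"
proof -
  have i2: "(1 + \<i>)\<^sup>2 = 2 * \<i>" by (simp add: power2_eq_square algebra_simps)
  have 1: "x \<in> box_cone \<and> shift_equations x" if px: "pt x \<in> shift_curve"
  proof -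
    obtain t where t: "t \<in> quartic_cone" "x = shift_matrix *v t"
      using iffD1[OF shift.mem_curve_iff[OF assms] px[unfolded shift_curve_eq]] by blast
    have e: "t $ 1 * t $ 3 = (t $ 2)\<^sup>2" "(t $ 4)\<^sup>2 = (t $ 1)\<^sup>2 - (t $ 3)\<^sup>2"
      using t(1) by (auto simp: quartic_cone_def)
    have W1: "((1 + \<i>) * t $ 2)\<^sup>2 = 2 * \<i> * (t $ 1 * t $ 3)" unfolding e(1) by (simp add: power_mult_distrib i2)
    have W3: "(t $ 1 - \<i> * t $ 3)\<^sup>2 = (t $ 1)\<^sup>2 - (t $ 3)\<^sup>2 - 2 * \<i> * (t $ 1 * t $ 3)"
      and C: "(t $ 1 + \<i> * t $ 3)\<^sup>2 = (t $ 1)\<^sup>2 - (t $ 3)\<^sup>2 + 2 * \<i> * (t $ 1 * t $ 3)"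
      by (simp_all add: power2_eq_square algebra_simps)
    show ?thesis
      unfolding box_cone_def shift_equations_def mem_Collect_eq t(2) shift_matrix_nth mult.assoc[of "of_real (sqrt 2)"]
        of_real_sqrt2_squared W1 W3 C e(2)
      by (simp add: algebra_simps)
  qed
  have 2: "pt x \<in> shift_curve" if x: "x \<in> box_cone" "x $ W1 = x $ W2" "x $ Z1 = x $ Z2" "of_real (sqrt 2) * x $ W1 = x $ Z3"
  proof -
    have b: "(x $ W1)\<^sup>2 + (x $ W3)\<^sup>2 = (x $ Z2)\<^sup>2" "2 * (x $ W1)\<^sup>2 + (x $ W3)\<^sup>2 = (x $ C)\<^sup>2"
      using x by (auto simp: box_cone_def)
    have "shift_matrix *v (shift_matrix_inv *v x) = x"
      using one_plus_i_nonzero x(2-4)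
      by (simp add: coord_vec_eq_iff shift_matrix_nth shift_matrix_inv_nth) (simp add: field_simps)
    moreover have "shift_matrix_inv *v x \<in> quartic_cone"
      unfolding quartic_cone_def mem_Collect_eq shift_matrix_inv_nth
    proof
      have "(x $ W1)\<^sup>2 = ((x $ C)\<^sup>2 - (x $ W3)\<^sup>2) / 2" unfolding b(2)[symmetric] by simp
      then have "(x $ W1 / (1 + \<i>))\<^sup>2 = ((x $ C)\<^sup>2 - (x $ W3)\<^sup>2) / 2 / (2 * \<i>)" by (simp only: power_divide i2)
      also have "\<dots> = (x $ C + x $ W3) / 2 * (- \<i> * (x $ C - x $ W3) / 2)"
        by (simp add: field_simps power2_eq_square)
      finally show "(x $ C + x $ W3) / 2 * (- \<i> * (x $ C - x $ W3) / 2) = (x $ W1 / (1 + \<i>))\<^sup>2" ..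
      have "2 * (x $ Z2)\<^sup>2 = (x $ C)\<^sup>2 + (x $ W3)\<^sup>2" unfolding b[symmetric] by simp
      then have "(x $ Z2)\<^sup>2 = ((x $ C)\<^sup>2 + (x $ W3)\<^sup>2) / 2" by (simp add: eq_divide_eq mult.commute)
      also have "\<dots> = ((x $ C + x $ W3) / 2)\<^sup>2 - (- \<i> * (x $ C - x $ W3) / 2)\<^sup>2"
        by (simp add: power_divide power_mult_distrib) (simp add: field_simps power2_eq_square)
      finally show "(x $ Z2)\<^sup>2 = ((x $ C + x $ W3) / 2)\<^sup>2 - (- \<i> * (x $ C - x $ W3) / 2)\<^sup>2" .
    qed
    ultimately show ?thesis unfolding shift_curve_eq shift.mem_curve_iff'[OF assms] by (rule conjI)
  qed
  show "pt x \<in> shift_curve \<longleftrightarrow> x \<in> box_cone \<and> x $ W1 = x $ W2 \<and> x $ Z1 = x $ Z2 \<and> of_real (sqrt 2) * x $ W1 = x $ Z3"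
    "pt x \<in> shift_curve \<longleftrightarrow> x \<in> box_cone \<and> shift_equations x"
    using 1 2 by (auto simp: shift_equations_def)
qed

lemma shift_curve_subset_box: "shift_curve \<subseteq> box_variety"
proof
  fix p assume p: "p \<in> shift_curve"
  obtain x where "x \<noteq> 0" "p = pt x" by (rule proj_cases)
  then show "p \<in> box_variety" using p mem_shift_curve_iff(1) mem_box_variety_iff by blast
qed

lemma shift_curve_equations: "shift_curve = {p \<in> box_variety. \<exists>x. x \<noteq> 0 \<and> p = pt x \<and> shift_equations x}"
proof (intro equalityI subsetI)
  fix p assume p: "p \<in> shift_curve"
  obtain x where "x \<noteq> 0" "p = pt x" by (rule proj_cases)
  then show "p \<in> {p \<in> box_variety. \<exists>x. x \<noteq> 0 \<and> p = pt x \<and> shift_equations x}"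
    using p mem_shift_curve_iff(2) mem_box_variety_iff by blast
next
  fix p assume "p \<in> {p \<in> box_variety. \<exists>x. x \<noteq> 0 \<and> p = pt x \<and> shift_equations x}"
  then obtain x where "x \<noteq> 0" "p = pt x" "p \<in> box_variety" "shift_equations x" by blast
  then show "p \<in> shift_curve" using mem_shift_curve_iff(2) mem_box_variety_iff by blast
qed

section \<open>Generators of the group\<close>

definition mat2 :: "int \<Rightarrow> int \<Rightarrow> int \<Rightarrow> int \<Rightarrow> int ^ 2 ^ 2" where
  "mat2 a b c d = (\<chi> i j. if i = 1 then (if j = 1 then a else b) else (if j = 1 then c else d))"

lemma mat2_nth [simp]:
  "mat2 a b c d $ 1 $ 1 = a" "mat2 a b c d $ 1 $ 2 = b" "mat2 a b c d $ 2 $ 1 = c" "mat2 a b c d $ 2 $ 2 = d"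
  by (simp_all add: mat2_def)

lemma mat2_eq_iff: "(M :: int ^ 2 ^ 2) = N \<longleftrightarrow> M $ 1 $ 1 = N $ 1 $ 1 \<and> M $ 1 $ 2 = N $ 1 $ 2 \<and> M $ 2 $ 1 = N $ 2 $ 1 \<and> M $ 2 $ 2 = N $ 2 $ 2"
  by (auto simp: vec_eq_iff forall_2)

lemma mat2_mult: "mat2 a b c d ** mat2 a' b' c' d' = mat2 (a * a' + b * c') (a * b' + b * d') (c * a' + d * c') (c * b' + d * d')"
  by (simp add: mat2_eq_iff matrix_matrix_mult_def sum_2)

lemma mat2_cases:
  obtains a b c d where "M = mat2 a b c d"
  using mat2_eq_iff[of M "mat2 (M $ 1 $ 1) (M $ 1 $ 2) (M $ 2 $ 1) (M $ 2 $ 2)"] by simp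

lemma det_mat2: "det (mat2 a b c d) = a * d - b * c"
  by (simp add: det_2)

lemma mat_1_eq_mat2: "mat 1 = mat2 1 0 0 1"
  by (simp add: mat2_eq_iff mat_def)

abbreviation "matS \<equiv> mat2 0 (-1) 1 0"
abbreviation "matT n \<equiv> mat2 1 n 0 1"

text \<open>Generators are added on the left, as in the composition of actions, so an induction
  treats one more projective map at each step. The translations come with their inverses;
  \<open>matS\<close> has finite order.\<close>

inductive_set gen_pairs :: "((int ^ 2 ^ 2) \<times> (int ^ 2 ^ 2)) set" where
  one: "(mat 1, mat 1) \<in> gen_pairs"
| S: "(M, N) \<in> gen_pairs \<Longrightarrow> (matS ** M, matS ** N) \<in> gen_pairs"
| T: "(M, N) \<in> gen_pairs \<Longrightarrow> (matT 1 ** M, matT 1 ** N) \<in> gen_pairs"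
| T': "(M, N) \<in> gen_pairs \<Longrightarrow> (matT (- 1) ** M, matT (- 1) ** N) \<in> gen_pairs"
| Q: "(M, N) \<in> gen_pairs \<Longrightarrow> (M, matT 2 ** N) \<in> gen_pairs"
| Q': "(M, N) \<in> gen_pairs \<Longrightarrow> (M, matT (- 2) ** N) \<in> gen_pairs"
| neg: "(M, N) \<in> gen_pairs \<Longrightarrow> (M, mat2 (- 1) 0 0 (- 1) ** N) \<in> gen_pairs"

text \<open>Pairs by which \<open>gen_pairs\<close> may be multiplied from the left. Such pairs are
  closed under products, so that whole words in the generators can be composed.\<close>

definition gen_stab :: "((int ^ 2 ^ 2) \<times> (int ^ 2 ^ 2)) set" where
  "gen_stab = {(X, Y). \<forall>M N. (M, N) \<in> gen_pairs \<longrightarrow> (X ** M, Y ** N) \<in> gen_pairs}"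

lemma gen_stab_mult:
  "(X, Y) \<in> gen_stab \<Longrightarrow> (X', Y') \<in> gen_stab \<Longrightarrow> (X ** X', Y ** Y') \<in> gen_stab"
  by (simp add: gen_stab_def matrix_mul_assoc[symmetric])

lemma gen_stab_S: "(matS, matS) \<in> gen_stab"
  by (auto simp: gen_stab_def intro: gen_pairs.S)

lemma gen_stab_T: "(matT n, matT n) \<in> gen_stab"
proof (induction n rule: int_induct[where k = 0])
  case base
  then show ?case by (simp add: gen_stab_def mat_1_eq_mat2[symmetric])
next
  case (step1 i)
  have "(matT 1, matT 1) \<in> gen_stab" by (auto simp: gen_stab_def intro: gen_pairs.T)
  from gen_stab_mult[OF this step1(2)] show ?case by (simp add: mat2_mult add.commute)
next
  case (step2 i)
  have "(matT (- 1), matT (- 1)) \<in> gen_stab" by (auto simp: gen_stab_def intro: gen_pairs.T')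
  from gen_stab_mult[OF this step2(2)] show ?case by (simp add: mat2_mult)
qed

lemma gen_stab_Q: "(mat2 1 0 0 1, matT (2 * n)) \<in> gen_stab"
proof (induction n rule: int_induct[where k = 0])
  case base
  then show ?case by (simp add: gen_stab_def mat_1_eq_mat2[symmetric])
next
  case (step1 i)
  have "(mat2 1 0 0 1, matT 2) \<in> gen_stab" by (auto simp: gen_stab_def mat_1_eq_mat2[symmetric] intro: gen_pairs.Q)
  from gen_stab_mult[OF this step1(2)] show ?case by (simp add: mat2_mult algebra_simps)
next
  case (step2 i)
  have "(mat2 1 0 0 1, matT (- 2)) \<in> gen_stab" by (auto simp: gen_stab_def mat_1_eq_mat2[symmetric] intro: gen_pairs.Q')
  from gen_stab_mult[OF this step2(2)] show ?case by (simp add: mat2_mult algebra_simps)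
qed

lemma gen_stab_neg: "(mat2 1 0 0 1, mat2 (- 1) 0 0 (- 1)) \<in> gen_stab"
  by (auto simp: gen_stab_def mat_1_eq_mat2[symmetric] intro: gen_pairs.neg)

lemma gen_stab_U: "(mat2 1 0 0 1, mat2 1 0 (2 * n) 1) \<in> gen_stab"
proof -
  have "(matS ** (mat2 1 0 0 1 ** (matS ** (matS ** matS))), matS ** (matT (2 * (- n)) ** (matS ** (matS ** matS)))) \<in> gen_stab"
    by (intro gen_stab_mult gen_stab_S gen_stab_Q)
  then show ?thesis by (simp add: mat2_mult)
qed

lemma unit_product_int:
  fixes a d :: int
  assumes "a * d = 1"
  shows "a = 1 \<and> d = 1 \<or> a = - 1 \<and> d = - 1"
  using assms zmult_eq_1_iff by blast

text \<open>The Euclidean algorithm on the first column: \<open>matT q\<close> subtracts a multiple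
  of the second row, and \<open>matS\<close> exchanges the rows up to sign.\<close>

lemma diagonal_in_gen_stab:
  "a * d - b * c = 1 \<Longrightarrow> (mat2 a b c d, mat2 a b c d) \<in> gen_stab"
proof (induction "nat \<bar>c\<bar>" arbitrary: a b c d rule: less_induct)
  case less
  show ?case
  proof (cases "c = 0")
    case True
    then have "a = 1 \<and> d = 1 \<or> a = - 1 \<and> d = - 1" using less.prems by (intro unit_product_int) simp
    then show ?thesis
    proof
      assume "a = 1 \<and> d = 1"
      then show ?thesis using True gen_stab_T by simp
    next
      assume ad: "a = - 1 \<and> d = - 1"
      have "(matS ** (matS ** matT (- b)), matS ** (matS ** matT (- b))) \<in> gen_stab"
        by (intro gen_stab_mult gen_stab_S gen_stab_T)
      then show ?thesis using ad True by (simp add: mat2_mult)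
    qed
  next
    case False
    define q r where "q = a div c" and "r = a mod c"
    have a: "a = c * q + r" by (simp add: q_def r_def)
    have "\<bar>r\<bar> < \<bar>c\<bar>" using False by (simp add: r_def abs_mod_less)
    then have "nat \<bar>- r\<bar> < nat \<bar>c\<bar>" by simp
    moreover have "c * - (b - q * d) - d * - r = 1" using less.prems by (simp add: a algebra_simps)
    ultimately have "(mat2 c d (- r) (- (b - q * d)), mat2 c d (- r) (- (b - q * d))) \<in> gen_stab"
      by (rule less.hyps)
    then have "(matT q ** (matS ** mat2 c d (- r) (- (b - q * d))), matT q ** (matS ** mat2 c d (- r) (- (b - q * d)))) \<in> gen_stab"
      by (intro gen_stab_mult gen_stab_S gen_stab_T)
    then show ?thesis by (simp add: mat2_mult a mult.commute add.commute)
  qed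
qed

text \<open>The residue of least absolute value modulo \<open>2 * c\<close> is at most
  \<open>\<bar>c\<bar>\<close> in size. Equality would give \<open>a\<close> and \<open>c\<close>
  the same parity.\<close>

lemma balanced_remainder:
  fixes a c :: int
  assumes "odd (a + c)" "c \<noteq> 0"
  obtains m where "\<bar>a - 2 * m * c\<bar> < \<bar>c\<bar>"
proof -
  define r where "r = (a + \<bar>c\<bar>) mod (2 * \<bar>c\<bar>)"
  define q where "q = (a + \<bar>c\<bar>) div (2 * \<bar>c\<bar>)"
  have eq: "a + \<bar>c\<bar> = 2 * \<bar>c\<bar> * q + r" by (simp add: r_def q_def)
  have r: "0 \<le> r" "r < 2 * \<bar>c\<bar>" using assms(2) by (simp_all add: r_def)
  have "odd (a + \<bar>c\<bar>)" using assms(1) by (cases "c \<ge> 0") auto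
  then have "odd r" unfolding eq by simp
  then have "r \<noteq> 0" by auto
  with r have "\<bar>r - \<bar>c\<bar>\<bar> < \<bar>c\<bar>" by linarith
  moreover have "r - \<bar>c\<bar> = a - 2 * (q * sgn c) * c"
  proof -
    have "2 * (q * sgn c) * c = 2 * \<bar>c\<bar> * q" by (simp add: abs_sgn mult_ac)
    then show ?thesis using eq by linarith
  qed
  ultimately show ?thesis using that[of "q * sgn c"] by simp
qed

text \<open>The Euclidean algorithm with even multiples only. The entries of the first column have
  opposite parity throughout, so two balanced reductions, one for each entry, make
  \<open>\<bar>c\<bar>\<close> strictly smaller.\<close>

lemma level_two_in_gen_stab:
  "a * d - b * c = 1 \<Longrightarrow> odd a \<Longrightarrow> odd d \<Longrightarrow> even b \<Longrightarrow> even c \<Longrightarrow> (mat2 1 0 0 1, mat2 a b c d) \<in> gen_stab"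
proof (induction "nat \<bar>c\<bar>" arbitrary: a b c d rule: less_induct)
  case less
  show ?case
  proof (cases "c = 0")
    case True
    obtain n where n: "b = 2 * n" using less.prems by blast
    have "a = 1 \<and> d = 1 \<or> a = - 1 \<and> d = - 1" using less.prems True by (intro unit_product_int) simp
    then show ?thesis
    proof
      assume "a = 1 \<and> d = 1"
      then show ?thesis using True n gen_stab_Q by simp
    next
      assume ad: "a = - 1 \<and> d = - 1"
      have "(mat2 1 0 0 1 ** mat2 1 0 0 1, mat2 (- 1) 0 0 (- 1) ** matT (2 * (- n))) \<in> gen_stab"
        by (intro gen_stab_mult gen_stab_neg gen_stab_Q)
      then show ?thesis using ad True n by (simp add: mat2_mult)
    qed
  next
    case False
    have "odd (a + c)" using less.prems by simp
    then obtain m where m: "\<bar>a - 2 * m * c\<bar> < \<bar>c\<bar>" using False by (rule balanced_remainder)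
    define a' b' where "a' = a - 2 * m * c" and "b' = b - 2 * m * d"
    have a': "odd a'" using less.prems by (simp add: a'_def)
    then have "odd (c + a')" "a' \<noteq> 0" using less.prems by auto
    then obtain k where k: "\<bar>c - 2 * k * a'\<bar> < \<bar>a'\<bar>" by (rule balanced_remainder)
    define c' d' where "c' = c - 2 * k * a'" and "d' = d - 2 * k * b'"
    have "nat \<bar>c'\<bar> < nat \<bar>c\<bar>" using m k by (simp add: a'_def[symmetric] c'_def)
    moreover have "a' * d' - b' * c' = 1" using less.prems(1) by (simp add: a'_def b'_def c'_def d'_def algebra_simps)
    moreover have "odd d'" "even b'" "even c'" using less.prems a' by (simp_all add: b'_def c'_def d'_def)
    ultimately have "(mat2 1 0 0 1, mat2 a' b' c' d') \<in> gen_stab" using a' less.hyps by blast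
    then have "(mat2 1 0 0 1 ** (mat2 1 0 0 1 ** mat2 1 0 0 1), matT (2 * m) ** (mat2 1 0 (2 * k) 1 ** mat2 a' b' c' d')) \<in> gen_stab"
      by (intro gen_stab_mult gen_stab_Q gen_stab_U)
    then show ?thesis by (simp add: mat2_mult a'_def b'_def c'_def d'_def)
  qed
qed

lemma Delta_1_2_iff:
  "(mat2 a b c d, mat2 a' b' c' d') \<in> Delta 1 2 \<longleftrightarrow> a * d - b * c = 1 \<and> a' * d' - b' * c' = 1 \<and>
     even (a - a') \<and> even (b - b') \<and> even (c - c') \<and> even (d - d')"
  by (auto simp: Delta_def Gamma_def det_mat2 forall_2 cong_iff_dvd_diff)

lemma Delta_subset_gen_pairs:
  assumes "M \<in> Delta 1 2"
  shows "M \<in> gen_pairs"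
proof -
  obtain a b c d where M1: "fst M = mat2 a b c d" by (rule mat2_cases)
  obtain a' b' c' d' where M2: "snd M = mat2 a' b' c' d'" by (rule mat2_cases)
  have M: "M = (mat2 a b c d, mat2 a' b' c' d')" using M1 M2 by (simp add: prod_eq_iff)
  have D: "a * d - b * c = 1" "a' * d' - b' * c' = 1" "even (a - a')" "even (b - b')" "even (c - c')" "even (d - d')"
    using assms unfolding M Delta_1_2_iff by auto
  \<comment> \<open>These are the entries of the inverse of the first matrix times the second. The
    product is the identity modulo two, so the pair is a diagonal pair times a pair of level
    two.\<close>
  define p q r s where "p = d * a' - b * c'" and "q = d * b' - b * d'" and "r = a * c' - c * a'" and "s = a * d' - c * b'"
  have "p * s - q * r = (a * d - b * c) * (a' * d' - b' * c')"
    unfolding p_def q_def r_def s_def by algebra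
  then have ps: "p * s - q * r = 1" by (simp add: D)
  obtain x y u v where "a - a' = 2 * x" "b - b' = 2 * y" "c - c' = 2 * u" "d - d' = 2 * v"
    using D(3-6) by (elim evenE)
  then have x: "a' = a - 2 * x" "b' = b - 2 * y" "c' = c - 2 * u" "d' = d - 2 * v" by linarith+
  have "p = (a * d - b * c) - 2 * (d * x - b * u)" "s = (a * d - b * c) - 2 * (a * v - c * y)"
    "q = 2 * (b * v - d * y)" "r = 2 * (c * x - a * u)"
    unfolding p_def q_def r_def s_def x by algebra+
  then have par: "odd p" "odd s" "even q" "even r" unfolding D(1) by simp_all
  have "(mat2 a b c d ** mat2 1 0 0 1, mat2 a b c d ** mat2 p q r s) \<in> gen_stab"
    by (intro gen_stab_mult diagonal_in_gen_stab level_two_in_gen_stab D ps par)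
  moreover have "mat2 a b c d ** mat2 p q r s = mat2 a' b' c' d'"
  proof -
    have "a * p + b * r = (a * d - b * c) * a'" "a * q + b * s = (a * d - b * c) * b'"
      "c * p + d * r = (a * d - b * c) * c'" "c * q + d * s = (a * d - b * c) * d'"
      unfolding p_def q_def r_def s_def by algebra+
    then show ?thesis by (simp add: mat2_mult D)
  qed
  ultimately have "M \<in> gen_stab" by (simp add: M mat2_mult)
  then have "(mat2 a b c d ** mat 1, mat2 a' b' c' d' ** mat 1) \<in> gen_pairs"
    unfolding M gen_stab_def using gen_pairs.one by blast
  then show ?thesis by (simp add: M)
qed

lemma gen_pairs_subset_Delta:
  assumes "M \<in> gen_pairs"
  shows "M \<in> Delta 1 2"
proof -
  have "(M1, M2) \<in> Delta 1 2" if "(M1, M2) \<in> gen_pairs" for M1 M2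
    using that
  proof (induction rule: gen_pairs.induct)
    case one
    then show ?case by (simp add: mat_1_eq_mat2 Delta_1_2_iff)
  next
    case (S M N)
    obtain a b c d where M: "M = mat2 a b c d" by (rule mat2_cases)
    obtain a' b' c' d' where N: "N = mat2 a' b' c' d'" by (rule mat2_cases)
    show ?case using S.IH unfolding M N mat2_mult Delta_1_2_iff by (simp add: algebra_simps)
  next
    case (T M N)
    obtain a b c d where M: "M = mat2 a b c d" by (rule mat2_cases)
    obtain a' b' c' d' where N: "N = mat2 a' b' c' d'" by (rule mat2_cases)
    show ?case using T.IH unfolding M N mat2_mult Delta_1_2_iff by (simp add: algebra_simps)
  next
    case (T' M N)
    obtain a b c d where M: "M = mat2 a b c d" by (rule mat2_cases)
    obtain a' b' c' d' where N: "N = mat2 a' b' c' d'" by (rule mat2_cases)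
    show ?case using T'.IH unfolding M N mat2_mult Delta_1_2_iff by (simp add: algebra_simps)
  next
    case (Q M N)
    obtain a b c d where M: "M = mat2 a b c d" by (rule mat2_cases)
    obtain a' b' c' d' where N: "N = mat2 a' b' c' d'" by (rule mat2_cases)
    show ?case using Q.IH unfolding M N mat2_mult Delta_1_2_iff by (simp add: algebra_simps)
  next
    case (Q' M N)
    obtain a b c d where M: "M = mat2 a b c d" by (rule mat2_cases)
    obtain a' b' c' d' where N: "N = mat2 a' b' c' d'" by (rule mat2_cases)
    show ?case using Q'.IH unfolding M N mat2_mult Delta_1_2_iff by (simp add: algebra_simps)
  next
    case (neg M N)
    obtain a b c d where M: "M = mat2 a b c d" by (rule mat2_cases)
    obtain a' b' c' d' where N: "N = mat2 a' b' c' d'" by (rule mat2_cases)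
    show ?case using neg.IH unfolding M N mat2_mult Delta_1_2_iff by (simp add: algebra_simps)
  qed
  then show ?thesis using assms by (cases M) simp
qed

lemma gen_pairs_eq_Delta: "gen_pairs = Delta 1 2"
  using Delta_subset_gen_pairs gen_pairs_subset_Delta by blast

lemma moebius_matS: "moebius matS z = - 1 / z"
  and moebius_matT: "moebius (matT n) z = z + of_int n"
  and moebius_neg: "moebius (mat2 (- 1) 0 0 (- 1)) z = z"
  by (simp_all add: moebius_def)

lemma moebius_mult:
  assumes "det N = 1" "Im z > 0"
  shows "moebius (M ** N) z = moebius M (moebius N z)"
proof -
  obtain a b c d where N: "N = mat2 a b c d" by (rule mat2_cases)
  obtain p q r s where M: "M = mat2 p q r s" by (rule mat2_cases)
  define u v where "u = of_int a * z + of_int b" and "v = of_int c * z + of_int d"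
  have "v \<noteq> 0"
  proof
    assume "v = 0"
    then have "Im v = 0" "Re v = 0" by simp_all
    then have "c = 0" "d = 0" using assms(2) by (simp_all add: v_def)
    then show False using assms(1) by (simp add: N det_mat2)
  qed
  have "moebius M (u / v) = (of_int p * u + of_int q * v) / v / ((of_int r * u + of_int s * v) / v)"
    unfolding M moebius_def mat2_nth using \<open>v \<noteq> 0\<close> by (simp add: add_divide_distrib)
  also have "\<dots> = (of_int p * u + of_int q * v) / (of_int r * u + of_int s * v)"
    using \<open>v \<noteq> 0\<close> by simp
  also have "\<dots> = moebius (M ** N) z"
    unfolding M N mat2_mult moebius_def mat2_nth u_def v_def by (simp add: algebra_simps)
  finally show ?thesis by (simp add: N moebius_def u_def v_def)
qed

lemma Delta_moebius_pos:
  assumes "M \<in> Delta 1 2" "Im z > 0" "Im w > 0"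
  shows "Im (moebius (fst M) z) > 0" "Im (moebius (snd M) w) > 0"
proof -
  have det: "det M1 = 1 \<and> det M2 = 1" if "(M1, M2) \<in> gen_pairs" for M1 M2
    using gen_pairs_subset_Delta[OF that] by (auto simp: Delta_def Gamma_def)
  have "Im (moebius M1 z) > 0 \<and> Im (moebius M2 w) > 0" if "(M1, M2) \<in> gen_pairs" for M1 M2
    using that
  proof (induction rule: gen_pairs.induct)
    case one
    then show ?case using assms by (simp add: mat_1_eq_mat2 moebius_def)
  next
    case (S M N)
    with det[OF S.hyps] assms show ?case
      by (simp only: moebius_mult moebius_matS Im_minus_inverse_pos)
  next
    case (T M N)
    with det[OF T.hyps] assms show ?case by (simp only: moebius_mult moebius_matT) simp
  next
    case (T' M N)
    with det[OF T'.hyps] assms show ?case by (simp only: moebius_mult moebius_matT) simp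
  next
    case (Q M N)
    with det[OF Q.hyps] assms show ?case by (simp only: moebius_mult moebius_matT) simp
  next
    case (Q' M N)
    with det[OF Q'.hyps] assms show ?case by (simp only: moebius_mult moebius_matT) simp
  next
    case (neg M N)
    with det[OF neg.hyps] assms show ?case by (simp only: moebius_mult moebius_neg)
  qed
  with assms(1) show "Im (moebius (fst M) z) > 0" "Im (moebius (snd M) w) > 0"
    by (cases M; simp add: gen_pairs_eq_Delta)+
qed

section \<open>Projective automorphisms\<close>

definition proj_map :: "complex ^ 'n ^ 'n \<Rightarrow> 'n::finite proj \<Rightarrow> 'n proj" where
  "proj_map P p = pt (P *v (SOME x. x \<noteq> 0 \<and> p = pt x))"

definition invertible_matrix :: "complex ^ 'n ^ 'n::finite \<Rightarrow> bool" where
  "invertible_matrix P \<longleftrightarrow> (\<exists>P'. P ** P' = mat 1 \<and> P' ** P = mat 1)"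

lemma invertible_matrix_mult:
  assumes "invertible_matrix P" "invertible_matrix R"
  shows "invertible_matrix (P ** R)"
proof -
  obtain P' where P: "P ** P' = mat 1" "P' ** P = mat 1" using assms(1) by (auto simp: invertible_matrix_def)
  obtain R' where R: "R ** R' = mat 1" "R' ** R = mat 1" using assms(2) by (auto simp: invertible_matrix_def)
  have "(P ** R) ** (R' ** P') = P ** (R ** R') ** P'" "(R' ** P') ** (P ** R) = R' ** (P' ** P) ** R"
    by (simp_all only: matrix_mul_assoc)
  then show ?thesis unfolding invertible_matrix_def P R matrix_mul_rid by blast
qed

lemma invertible_matrix_eq_0_iff:
  assumes "invertible_matrix P"
  shows "P *v x = 0 \<longleftrightarrow> x = 0"
proof
  obtain P' where "P' ** P = mat 1" using assms by (auto simp: invertible_matrix_def)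
  then have "x = P' *v (P *v x)" by (simp add: matrix_vector_mul_assoc)
  then show "P *v x = 0 \<Longrightarrow> x = 0" by simp
qed simp

lemma proj_map_pt:
  assumes "invertible_matrix P" "x \<noteq> 0"
  shows "proj_map P (pt x) = pt (P *v x)"
proof -
  define y where "y = (SOME y. y \<noteq> 0 \<and> pt x = pt y)"
  have "\<exists>y. y \<noteq> 0 \<and> pt x = pt y" using assms(2) by blast
  then have "y \<noteq> 0 \<and> pt x = pt y" unfolding y_def by (rule someI_ex)
  then obtain c where c: "c \<noteq> 0" "y = c *s x" using pt_eq_iff[OF assms(2)] by blast
  have "proj_map P (pt x) = pt (P *v y)" by (simp only: proj_map_def y_def)
  then show ?thesis unfolding c(2) vector_scalar_commute pt_scale[OF c(1)] .
qed

lemma proj_map_mult: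
  assumes "invertible_matrix P" "invertible_matrix R"
  shows "proj_map (P ** R) p = proj_map P (proj_map R p)"
proof -
  obtain x where "x \<noteq> 0" "p = pt x" by (rule proj_cases)
  then show ?thesis
    using assms by (simp add: proj_map_pt invertible_matrix_mult invertible_matrix_eq_0_iff matrix_vector_mul_assoc)
qed

lemma proj_map_one: "proj_map (mat 1) p = p"
proof -
  obtain x where "x \<noteq> 0" "p = pt x" by (rule proj_cases)
  moreover have "invertible_matrix (mat 1 :: complex ^ 'a ^ 'a)" by (auto simp: invertible_matrix_def intro: exI[of _ "mat 1"])
  ultimately show ?thesis by (simp add: proj_map_pt)
qed

lemma continuous_on_proj_map:
  assumes "invertible_matrix P"
  shows "continuous_on UNIV (proj_map P)"
  unfolding continuous_on_open_vimage[OF open_UNIV]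
proof (intro allI impI)
  fix U :: "'a proj set" assume "open U"
  then have "open ((\<lambda>x. P *v x) -` {x. x \<noteq> 0 \<and> pt x \<in> U})"
    unfolding open_proj_iff by (rule open_vimage) (intro continuous_intros)
  also have "(\<lambda>x. P *v x) -` {x. x \<noteq> 0 \<and> pt x \<in> U} = {x. x \<noteq> 0 \<and> pt x \<in> proj_map P -` U}"
    by (intro set_eqI) (simp add: invertible_matrix_eq_0_iff[OF assms] proj_map_pt[OF assms] cong: conj_cong)
  finally show "open (proj_map P -` U \<inter> UNIV)" by (simp only: open_proj_iff Int_UNIV_right)
qed

lemma proj_map_quartic_curve:
  assumes "embedded_quartic A B" "invertible_matrix P"
  shows "\<exists>B'. embedded_quartic (P ** A) B'" "proj_map P ` quartic_curve A = quartic_curve (P ** A)"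
proof -
  interpret embedded_quartic A B by (rule assms(1))
  obtain P' where P': "P' ** P = mat 1" using assms(2) by (auto simp: invertible_matrix_def)
  have "(B ** P') ** (P ** A) = B ** (P' ** P) ** A" by (simp only: matrix_mul_assoc)
  then have "embedded_quartic (P ** A) (B ** P')"
    by unfold_locales (simp add: P' BA)
  then show "\<exists>B'. embedded_quartic (P ** A) B'" ..
  have eq: "proj_map P (pt (A *v t)) = pt ((P ** A) *v t)" if "t \<noteq> 0" for t
    using proj_map_pt[OF assms(2)] that by (simp add: A_eq_0_iff matrix_vector_mul_assoc)
  show "proj_map P ` quartic_curve A = quartic_curve (P ** A)"
  proof (intro equalityI subsetI)
    fix p assume "p \<in> proj_map P ` quartic_curve A"
    then obtain t where "t \<in> quartic_cone" "t \<noteq> 0" "p = proj_map P (pt (A *v t))" by (auto simp: quartic_curve_def)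
    then show "p \<in> quartic_curve (P ** A)" using eq by (auto simp: quartic_curve_def)
  next
    fix p assume "p \<in> quartic_curve (P ** A)"
    then obtain t where t: "t \<in> quartic_cone" "t \<noteq> 0" "p = pt ((P ** A) *v t)" by (auto simp: quartic_curve_def)
    then have "pt (A *v t) \<in> quartic_curve A" by (auto simp: quartic_curve_def)
    then show "p \<in> proj_map P ` quartic_curve A" unfolding t(3) eq[OF t(2), symmetric] by (rule imageI)
  qed
qed

lemma continuous_agree_on_closure:
  fixes f g :: "'a::topological_space \<Rightarrow> 'b::t2_space"
  assumes f: "continuous_on (closure T) f" and g: "continuous_on (closure T) g"
    and eq: "\<And>x. x \<in> T \<Longrightarrow> f x = g x" and x: "x \<in> closure T"
  shows "f x = g x"
proof (cases "x \<in> T")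
  case False
  then have "x islimpt T" using x by (simp add: closure_def)
  then have nontriv: "at x within T \<noteq> bot" by (simp add: trivial_limit_within)
  have "(f \<longlongrightarrow> f x) (at x within T)" "(g \<longlongrightarrow> g x) (at x within T)"
    using f g x unfolding continuous_on_def by (blast intro: tendsto_within_subset[OF _ closure_subset])+
  moreover have "\<forall>\<^sub>F y in at x within T. f y = g y" using eq by (simp add: eventually_at_filter)
  ultimately have "(g \<longlongrightarrow> f x) (at x within T)" using tendsto_cong[of f g] by blast
  then show ?thesis using \<open>(g \<longlongrightarrow> g x) (at x within T)\<close> by (rule tendsto_unique[OF nontriv])
qed (rule eq)

section \<open>The action of the generators on the box variety\<close>

definition monomial_matrix :: "('n \<Rightarrow> 'n) \<Rightarrow> ('n \<Rightarrow> complex) \<Rightarrow> complex ^ 'n ^ 'n::finite" where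
  "monomial_matrix \<sigma> c = (\<chi> i j. if j = \<sigma> i then c i else 0)"

lemma monomial_matrix_nth: "(monomial_matrix \<sigma> c *v x) $ i = c i * x $ \<sigma> i"
proof -
  have "(monomial_matrix \<sigma> c *v x) $ i = (\<Sum>j\<in>UNIV. if j = \<sigma> i then c i * x $ \<sigma> i else 0)"
    unfolding monomial_matrix_def matrix_vector_mult_def vec_lambda_beta by (rule sum.cong) auto
  then show ?thesis by simp
qed

definition box_S :: "complex ^ coord ^ coord" where
  "box_S = monomial_matrix (\<lambda>i. case i of Z1 \<Rightarrow> Z3 | Z2 \<Rightarrow> Z2 | Z3 \<Rightarrow> Z1 | W1 \<Rightarrow> W3 | W2 \<Rightarrow> W2 | W3 \<Rightarrow> W1 | C \<Rightarrow> C)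
     (\<lambda>i. case i of W2 \<Rightarrow> - 1 | _ \<Rightarrow> 1)"

definition box_T :: "complex ^ coord ^ coord" where
  "box_T = monomial_matrix (\<lambda>i. case i of Z1 \<Rightarrow> Z2 | Z2 \<Rightarrow> Z1 | Z3 \<Rightarrow> Z3 | W1 \<Rightarrow> W1 | W2 \<Rightarrow> W2 | W3 \<Rightarrow> C | C \<Rightarrow> W3)
     (\<lambda>i. case i of Z3 \<Rightarrow> \<i> | W1 \<Rightarrow> \<i> | W2 \<Rightarrow> \<i> | _ \<Rightarrow> 1)"

definition box_Q :: "complex ^ coord ^ coord" where
  "box_Q = monomial_matrix (\<lambda>i. case i of Z1 \<Rightarrow> Z1 | Z2 \<Rightarrow> Z2 | Z3 \<Rightarrow> Z3 | W1 \<Rightarrow> W2 | W2 \<Rightarrow> W1 | W3 \<Rightarrow> C | C \<Rightarrow> W3)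
     (\<lambda>i. case i of Z3 \<Rightarrow> \<i> | W1 \<Rightarrow> - \<i> | W2 \<Rightarrow> \<i> | _ \<Rightarrow> 1)"

lemma box_S_nth: "(box_S *v x) $ Z1 = x $ Z3" "(box_S *v x) $ Z2 = x $ Z2" "(box_S *v x) $ Z3 = x $ Z1"
    "(box_S *v x) $ W1 = x $ W3" "(box_S *v x) $ W2 = - (x $ W2)" "(box_S *v x) $ W3 = x $ W1" "(box_S *v x) $ C = x $ C"
  and box_T_nth: "(box_T *v x) $ Z1 = x $ Z2" "(box_T *v x) $ Z2 = x $ Z1" "(box_T *v x) $ Z3 = \<i> * x $ Z3"
    "(box_T *v x) $ W1 = \<i> * x $ W1" "(box_T *v x) $ W2 = \<i> * x $ W2" "(box_T *v x) $ W3 = x $ C" "(box_T *v x) $ C = x $ W3"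
  and box_Q_nth: "(box_Q *v x) $ Z1 = x $ Z1" "(box_Q *v x) $ Z2 = x $ Z2" "(box_Q *v x) $ Z3 = \<i> * x $ Z3"
    "(box_Q *v x) $ W1 = - (\<i> * x $ W2)" "(box_Q *v x) $ W2 = \<i> * x $ W1" "(box_Q *v x) $ W3 = x $ C" "(box_Q *v x) $ C = x $ W3"
  unfolding box_S_def box_T_def box_Q_def by (simp_all add: monomial_matrix_nth)

lemma i_times_i: "\<i> * (\<i> * x) = - x"
  and i_times_scaled_i: "\<i> * (y * (\<i> * x)) = - (y * x)"
  by (simp_all flip: mult.assoc) (simp add: mult.commute flip: mult.assoc)

lemma box_S_square: "box_S ** box_S = mat 1"
  and box_T_power4: "box_T ** (box_T ** (box_T ** box_T)) = mat 1"
  and box_Q_power4: "box_Q ** (box_Q ** (box_Q ** box_Q)) = mat 1"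
  unfolding matrix_eq
  by (simp_all add: coord_vec_eq_iff box_S_nth box_T_nth box_Q_nth i_times_i flip: matrix_vector_mul_assoc)

lemma invertible_box_S: "invertible_matrix box_S"
  and invertible_box_T: "invertible_matrix box_T"
  and invertible_box_Q: "invertible_matrix box_Q"
proof -
  show "invertible_matrix box_S" using box_S_square by (auto simp: invertible_matrix_def)
  show "invertible_matrix box_T" unfolding invertible_matrix_def
    using box_T_power4 by (intro exI[of _ "box_T ** (box_T ** box_T)"]) (simp add: matrix_mul_assoc)
  show "invertible_matrix box_Q" unfolding invertible_matrix_def
    using box_Q_power4 by (intro exI[of _ "box_Q ** (box_Q ** box_Q)"]) (simp add: matrix_mul_assoc)
qed

lemma box_cone_automorphism:
  assumes "x \<in> box_cone"
  shows "box_S *v x \<in> box_cone" "box_T *v x \<in> box_cone" "box_Q *v x \<in> box_cone"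
proof -
  note e = assms[unfolded box_cone_def mem_Collect_eq]
  note h = e[THEN conjunct1, symmetric] e[THEN conjunct2, THEN conjunct1, symmetric]
    e[THEN conjunct2, THEN conjunct2, THEN conjunct1, symmetric] e[THEN conjunct2, THEN conjunct2, THEN conjunct2, symmetric]
  show "box_S *v x \<in> box_cone" "box_T *v x \<in> box_cone" "box_Q *v x \<in> box_cone"
    unfolding box_cone_def mem_Collect_eq box_S_nth box_T_nth box_Q_nth power2_minus power_mult_distrib h
    by (simp_all add: add_ac)
qed

definition box_coords :: "complex \<Rightarrow> complex \<Rightarrow> complex ^ coord" where
  "box_coords z w = (\<chi> i. theta_coord z w i)"

lemma theta_map_eq: "theta_map z w = pt (box_coords z w)"
  by (simp add: theta_map_def box_coords_def)

lemma box_coords_nth: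
  "box_coords z w $ Z1 = theta 0 1 z * theta 0 1 w"
  "box_coords z w $ Z2 = theta 0 0 z * theta 0 0 w"
  "box_coords z w $ Z3 = theta 1 0 z * theta 1 0 w"
  "box_coords z w $ C = theta 0 0 (2 * z) * theta 0 0 (2 * w) + theta 1 0 (2 * z) * theta 1 0 (2 * w)"
  "box_coords z w $ W1 = theta 1 0 (2 * z) * theta 0 0 (2 * w) + theta 0 0 (2 * z) * theta 1 0 (2 * w)"
  "box_coords z w $ W2 = \<i> * (theta 1 0 (2 * z) * theta 0 0 (2 * w) - theta 0 0 (2 * z) * theta 1 0 (2 * w))"
  "box_coords z w $ W3 = theta 0 0 (2 * z) * theta 0 0 (2 * w) - theta 1 0 (2 * z) * theta 1 0 (2 * w)"
  by (simp_all only: box_coords_def theta_coord_def vec_lambda_beta coord.case)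

lemma box_coords_nonzero:
  assumes "Im z > 0" "Im w > 0"
  shows "box_coords z w \<noteq> 0"
proof
  assume "box_coords z w = 0"
  then have "box_coords z w $ C + box_coords z w $ W3 = 0" by simp
  moreover have "box_coords z w $ C + box_coords z w $ W3 = 2 * (theta 0 0 (2 * z) * theta 0 0 (2 * w))"
    by (simp add: box_coords_nth)
  ultimately show False using theta_double_nonzero assms by simp
qed

lemma theta_map_S:
  assumes "Im z > 0" "Im w > 0"
  shows "theta_map (- 1 / z) (- 1 / w) = proj_map box_S (theta_map z w)"
proof -
  obtain e k where e: "e ^ 2 = (1 :: complex)" and k: "\<And>z. Im z > 0 \<Longrightarrow> k z \<noteq> 0"
    and th: "\<And>z. Im z > 0 \<Longrightarrow> theta 0 0 (- 1 / z) = k z * theta 0 0 z"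
    "\<And>z. Im z > 0 \<Longrightarrow> theta 1 0 (- 1 / z) = k z * theta 0 1 z"
    "\<And>z. Im z > 0 \<Longrightarrow> theta 0 1 (- 1 / z) = k z * theta 1 0 z"
    and db: "\<And>z. Im z > 0 \<Longrightarrow> of_real (sqrt 2) * theta 0 0 (2 * (- 1 / z)) = e * k z * (theta 0 0 (2 * z) + theta 1 0 (2 * z))"
    "\<And>z. Im z > 0 \<Longrightarrow> of_real (sqrt 2) * theta 1 0 (2 * (- 1 / z)) = e * k z * (theta 0 0 (2 * z) - theta 1 0 (2 * z))"
    by (rule theta_inversion_uniform) blast
  define r where "r = complex_of_real (sqrt 2)"
  have r: "r * r = 2" unfolding r_def by (simp flip: of_real_mult)
  have e': "e * e = 1" using e by (simp add: power2_eq_square)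
  \<comment> \<open>Each box coordinate in doubled arguments is a sum of products of two theta
    constants. In such a product the unknown sign occurs squared and the two factors
    \<open>sqrt 2\<close> combine to \<open>2\<close>.\<close>
  have prod: "p * q = k z * k w * (p' * q') / 2" if "r * p = e * k z * p'" "r * q = e * k w * q'" for p q p' q'
  proof -
    have "2 * (p * q) = (r * p) * (r * q)" unfolding r[symmetric] by (simp only: mult_ac)
    also have "\<dots> = (e * e) * (k z * k w * (p' * q'))" unfolding that by (simp only: mult_ac)
    finally show ?thesis unfolding e' by (simp add: mult.commute)
  qed
  note dz = db[OF assms(1), folded r_def] and dw = db[OF assms(2), folded r_def]
  have "box_coords (- 1 / z) (- 1 / w) = (k z * k w) *s (box_S *v box_coords z w)"
    unfolding coord_vec_eq_iff vector_smult_component box_S_nth box_coords_nth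
      th[OF assms(1)] th[OF assms(2)] prod[OF dz(1) dw(1)] prod[OF dz(1) dw(2)] prod[OF dz(2) dw(1)] prod[OF dz(2) dw(2)]
    by (simp add: algebra_simps add_divide_distrib diff_divide_distrib)
  then show ?thesis
    using k[OF assms(1)] k[OF assms(2)] proj_map_pt[OF invertible_box_S box_coords_nonzero[OF assms]]
    by (simp add: theta_map_eq pt_scale)
qed

lemma theta_10_add_one_twice: "exp (of_real pi * \<i> / 4) * (exp (of_real pi * \<i> / 4) * x) = \<i> * x"
proof -
  have "exp (of_real pi * \<i> / 4) * exp (of_real pi * \<i> / 4) = exp (of_real pi / 2 * \<i>)"
    unfolding exp_add[symmetric] by (rule arg_cong[of _ _ exp]) simp
  also have "\<dots> = \<i>" using cis_pi_half by (simp add: cis_conv_exp mult.commute)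
  finally show ?thesis by (simp flip: mult.assoc)
qed

lemma theta_map_T:
  assumes "Im z > 0" "Im w > 0"
  shows "theta_map (z + 1) (w + 1) = proj_map box_T (theta_map z w)"
proof -
  have "exp (of_real pi * \<i> / 4) * x * (exp (of_real pi * \<i> / 4) * y) = \<i> * (x * y)" for x y
    using theta_10_add_one_twice[of "x * y"] by (simp only: mult_ac)
  then have "box_coords (z + 1) (w + 1) = box_T *v box_coords z w"
    unfolding coord_vec_eq_iff box_T_nth box_coords_nth theta_00_add_one theta_01_add_one theta_10_add_one theta_double_add_one
    by (simp add: algebra_simps i_times_i)
  then show ?thesis
    using proj_map_pt[OF invertible_box_T box_coords_nonzero[OF assms]] by (simp add: theta_map_eq)
qed

lemma theta_map_Q:
  assumes "Im z > 0" "Im w > 0"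
  shows "theta_map z (w + 2) = proj_map box_Q (theta_map z w)"
proof -
  have "w + 2 = (w + 1) + 1" by simp
  then have "box_coords z (w + 2) = box_Q *v box_coords z w"
    unfolding coord_vec_eq_iff box_Q_nth box_coords_nth
    by (simp only: theta_00_add_one theta_01_add_one theta_10_add_one theta_double_add_one theta_10_add_one_twice)
      (simp add: algebra_simps i_times_i)
  then show ?thesis
    using proj_map_pt[OF invertible_box_Q box_coords_nonzero[OF assms]] by (simp add: theta_map_eq)
qed

section \<open>The translates of the curve\<close>

text \<open>The shape names the two coordinates among \<open>C\<close>, \<open>W1\<close>, \<open>W2\<close>, \<open>W3\<close> that are proportional on the curve;
  the booleans of a code are the signs in the three linear equations.\<close>

datatype shape = W1W2 | W1W3 | W2W3 | CW3 | CW2 | CW1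

type_synonym code = "shape \<times> bool \<times> bool \<times> bool"

definition sg :: "bool \<Rightarrow> complex" where
  "sg a = (if a then 1 else - 1)"

fun code_equations :: "code \<Rightarrow> complex ^ coord \<Rightarrow> bool" where
  "code_equations (W1W2, a, b, c) x \<longleftrightarrow> x $ W1 = sg a * x $ W2 \<and> x $ Z1 = sg b * x $ Z2 \<and> x $ Z3 = sg c * (of_real (sqrt 2) * x $ W1)"
| "code_equations (W1W3, a, b, c) x \<longleftrightarrow> x $ W1 = sg a * x $ W3 \<and> x $ Z1 = sg b * x $ Z3 \<and> x $ Z2 = sg c * (of_real (sqrt 2) * x $ W1)"
| "code_equations (W2W3, a, b, c) x \<longleftrightarrow> x $ W2 = sg a * x $ W3 \<and> x $ Z2 = sg b * x $ Z3 \<and> x $ Z1 = sg c * (of_real (sqrt 2) * x $ W2)"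
| "code_equations (CW3, a, b, c) x \<longleftrightarrow> x $ C = sg a * (\<i> * x $ W3) \<and> x $ Z1 = sg b * (\<i> * x $ Z2) \<and> x $ Z3 = sg c * (of_real (sqrt 2) * x $ C)"
| "code_equations (CW2, a, b, c) x \<longleftrightarrow> x $ C = sg a * (\<i> * x $ W2) \<and> x $ Z1 = sg b * (\<i> * x $ Z3) \<and> x $ Z2 = sg c * (of_real (sqrt 2) * x $ C)"
| "code_equations (CW1, a, b, c) x \<longleftrightarrow> x $ C = sg a * (\<i> * x $ W1) \<and> x $ Z2 = sg b * (\<i> * x $ Z3) \<and> x $ Z1 = sg c * (of_real (sqrt 2) * x $ C)"

text \<open>With \<open>True\<close> for \<open>+ 1\<close>, the boolean \<open>a = c\<close> codes
  the product of two signs and \<open>a \<noteq> c\<close> its negative. Such products arise when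
  the coordinate in the third equation is replaced by means of the first.\<close>

fun code_S :: "code \<Rightarrow> code" where
  "code_S (W1W2, a, b, c) = (W2W3, \<not> a, b, a \<noteq> c)"
| "code_S (W1W3, a, b, c) = (W1W3, a, b, a = c)"
| "code_S (W2W3, a, b, c) = (W1W2, \<not> a, b, a = c)"
| "code_S (CW3, a, b, c) = (CW1, a, \<not> b, c)"
| "code_S (CW2, a, b, c) = (CW2, \<not> a, \<not> b, c)"
| "code_S (CW1, a, b, c) = (CW3, a, \<not> b, c)"

fun code_T :: "code \<Rightarrow> code" where
  "code_T (W1W2, a, b, c) = (W1W2, a, b, c)"
| "code_T (W1W3, a, b, c) = (CW1, \<not> a, \<not> b, a = c)"
| "code_T (W2W3, a, b, c) = (CW2, \<not> a, \<not> b, a = c)"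
| "code_T (CW3, a, b, c) = (CW3, \<not> a, \<not> b, a \<noteq> c)"
| "code_T (CW2, a, b, c) = (W2W3, a, b, a = c)"
| "code_T (CW1, a, b, c) = (W1W3, a, b, a = c)"

fun code_Q :: "code \<Rightarrow> code" where
  "code_Q (W1W2, a, b, c) = (W1W2, \<not> a, b, a \<noteq> c)"
| "code_Q (W1W3, a, b, c) = (CW2, \<not> a, \<not> b, a = c)"
| "code_Q (W2W3, a, b, c) = (CW1, a, \<not> b, a = c)"
| "code_Q (CW3, a, b, c) = (CW3, \<not> a, b, a \<noteq> c)"
| "code_Q (CW2, a, b, c) = (W1W3, \<not> a, b, a \<noteq> c)"
| "code_Q (CW1, a, b, c) = (W2W3, a, b, a = c)"

lemma code_S_square: "code_S (code_S d) = d"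
  and code_T_power4: "code_T (code_T (code_T (code_T d))) = d"
  and code_Q_power4: "code_Q (code_Q (code_Q (code_Q d))) = d"
proof -
  obtain s a b c where "d = (s, a, b, c)" by (cases d) auto
  then show "code_S (code_S d) = d" "code_T (code_T (code_T (code_T d))) = d" "code_Q (code_Q (code_Q (code_Q d))) = d"
    by (cases s; cases a; cases c; simp)+
qed

lemma code_equations_S: "code_equations d x \<Longrightarrow> code_equations (code_S d) (box_S *v x)"
  and code_equations_T: "code_equations d x \<Longrightarrow> code_equations (code_T d) (box_T *v x)"
  and code_equations_Q: "code_equations d x \<Longrightarrow> code_equations (code_Q d) (box_Q *v x)"
proof -
  obtain s a b c where d: "d = (s, a, b, c)" by (cases d) auto
  assume *: "code_equations d x"
  show "code_equations (code_S d) (box_S *v x)"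
    using * unfolding d by (cases s; cases a; cases b; cases c; simp add: box_S_nth sg_def i_times_i i_times_scaled_i)
  show "code_equations (code_T d) (box_T *v x)"
    using * unfolding d by (cases s; cases a; cases b; cases c; simp add: box_T_nth sg_def i_times_i i_times_scaled_i)
  show "code_equations (code_Q d) (box_Q *v x)"
    using * unfolding d by (cases s; cases a; cases b; cases c; simp add: box_Q_nth sg_def i_times_i i_times_scaled_i)
qed

lemma code_equations_smult: "code_equations d x \<Longrightarrow> code_equations d (k *s x)"
proof -
  obtain s a b c where d: "d = (s, a, b, c)" by (cases d) auto
  assume "code_equations d x"
  then show ?thesis unfolding d by (cases s; simp)
qed

text \<open>This is transitivity of the generators on codes. Words that fix the shape
  \<open>W1W2\<close> change its signs: \<open>Q\<close> twice flips the third, and \<open>Q\<close>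
  twice conjugated by \<open>S\<close> flips the second. The other shapes are then reached with
  arbitrary signs.\<close>

lemma code_induct [case_names base S T Q]:
  assumes base: "X (W1W2, True, True, True)"
    and S: "\<And>d. X d \<Longrightarrow> X (code_S d)" and T: "\<And>d. X d \<Longrightarrow> X (code_T d)" and Q: "\<And>d. X d \<Longrightarrow> X (code_Q d)"
  shows "X d"
proof -
  have Q1: "X (W1W2, \<not> a, b, a \<noteq> c)" if "X (W1W2, a, b, c)" for a b c using Q[OF that] by simp
  have Q2: "X (W1W2, a, b, \<not> c)" if "X (W1W2, a, b, c)" for a b c
    using Q1[OF Q1[OF that]] by (cases a; cases c; simp)
  have S2: "X (W1W2, a, \<not> b, c)" if "X (W1W2, a, b, c)" for a b c
    using S[OF Q[OF Q[OF S[OF that]]]] by (cases a; cases b; cases c; simp)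
  have b: "X (W1W2, True, b, True)" for b using base S2[OF base] by (cases b) simp_all
  have bc: "X (W1W2, True, b, c)" for b c using b Q2[OF b, of b] by (cases c) simp_all
  have 12: "X (W1W2, a, b, c)" for a b c
    using bc[of b c] Q1[OF bc[of b "\<not> c"]] by (cases a; cases c; simp)
  have 23: "X (W2W3, a, b, c)" for a b c
    using S[OF 12[of "\<not> a" b "a = c"]] by (cases a; cases c; simp)
  have 01: "X (CW1, a, b, c)" for a b c
    using Q[OF 23[of a "\<not> b" "a = c"]] by (cases a; cases c; simp)
  have 02: "X (CW2, a, b, c)" for a b c
    using T[OF 23[of "\<not> a" "\<not> b" "a \<noteq> c"]] by (cases a; cases c; simp)
  have 13: "X (W1W3, a, b, c)" for a b c
    using T[OF 01[of a b "a = c"]] by (cases a; cases c; simp)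
  have 03: "X (CW3, a, b, c)" for a b c
    using S[OF 01[of a "\<not> b" c]] by simp
  obtain s a b c where "d = (s, a, b, c)" by (cases d) auto
  then show ?thesis using 12 23 01 02 13 03 by (cases s) simp_all
qed

definition box_curve :: "code \<Rightarrow> coord proj set" where
  "box_curve d = {pt x | x. x \<noteq> 0 \<and> x \<in> box_cone \<and> code_equations d x}"

lemma mem_box_curve_iff:
  assumes "x \<noteq> 0"
  shows "pt x \<in> box_curve d \<longleftrightarrow> x \<in> box_cone \<and> code_equations d x"
proof
  assume "pt x \<in> box_curve d"
  then obtain x' where x': "x' \<noteq> 0" "x' \<in> box_cone" "code_equations d x'" "pt x' = pt x"
    by (auto simp: box_curve_def)
  then obtain k where "x = k *s x'" using pt_eq_iff[OF x'(1) assms] by auto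
  then show "x \<in> box_cone \<and> code_equations d x" using x' box_cone_smult code_equations_smult by simp
next
  assume "x \<in> box_cone \<and> code_equations d x"
  with assms show "pt x \<in> box_curve d" unfolding box_curve_def by blast
qed

lemma shift_curve_eq_box_curve: "shift_curve = box_curve (W1W2, True, True, True)"
proof (rule set_eqI)
  fix p :: "coord proj"
  obtain x where x: "x \<noteq> 0" "p = pt x" by (rule proj_cases)
  have "code_equations (W1W2, True, True, True) x \<longleftrightarrow>
      x $ W1 = x $ W2 \<and> x $ Z1 = x $ Z2 \<and> of_real (sqrt 2) * x $ W1 = x $ Z3"
    by (auto simp: sg_def)
  then show "p \<in> shift_curve \<longleftrightarrow> p \<in> box_curve (W1W2, True, True, True)"
    unfolding x(2) mem_shift_curve_iff(1)[OF x(1)] mem_box_curve_iff[OF x(1)] by (simp only:)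
qed

text \<open>The second half provides a right inverse that respects box cone and codes as well. It
  turns the inclusion of the image of a curve into an equality and makes \<open>\<alpha>\<close>
  injective.\<close>

definition box_automorphism :: "complex ^ coord ^ coord \<Rightarrow> (code \<Rightarrow> code) \<Rightarrow> bool" where
  "box_automorphism P \<alpha> \<longleftrightarrow> invertible_matrix P \<and> (\<forall>x\<in>box_cone. P *v x \<in> box_cone) \<and>
     (\<forall>d x. code_equations d x \<longrightarrow> code_equations (\<alpha> d) (P *v x)) \<and>
     (\<exists>R \<beta>. P ** R = mat 1 \<and> (\<forall>d. \<alpha> (\<beta> d) = d \<and> \<beta> (\<alpha> d) = d) \<and> (\<forall>x\<in>box_cone. R *v x \<in> box_cone) \<and>
       (\<forall>d x. code_equations d x \<longrightarrow> code_equations (\<beta> d) (R *v x)))"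

lemma box_automorphism_generators:
  "box_automorphism box_S code_S" "box_automorphism box_T code_T" "box_automorphism box_Q code_Q"
proof -
  show "box_automorphism box_S code_S"
    unfolding box_automorphism_def
    by (intro conjI exI[of _ box_S] exI[of _ code_S])
      (simp_all add: invertible_box_S box_cone_automorphism code_equations_S box_S_square code_S_square)
  show "box_automorphism box_T code_T"
    unfolding box_automorphism_def
    by (intro conjI exI[of _ "box_T ** (box_T ** box_T)"] exI[of _ "\<lambda>d. code_T (code_T (code_T d))"])
      (simp_all add: invertible_box_T box_cone_automorphism code_equations_T box_T_power4 code_T_power4
        flip: matrix_vector_mul_assoc)
  show "box_automorphism box_Q code_Q"
    unfolding box_automorphism_def
    by (intro conjI exI[of _ "box_Q ** (box_Q ** box_Q)"] exI[of _ "\<lambda>d. code_Q (code_Q (code_Q d))"])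
      (simp_all add: invertible_box_Q box_cone_automorphism code_equations_Q box_Q_power4 code_Q_power4
        flip: matrix_vector_mul_assoc)
qed

lemma box_automorphism_one: "box_automorphism (mat 1) (\<lambda>d. d)"
  unfolding box_automorphism_def invertible_matrix_def
  by (intro conjI exI[of _ "mat 1"] exI[of _ "\<lambda>d. d"]) simp_all

lemma box_automorphism_mult:
  assumes "box_automorphism P \<alpha>" "box_automorphism P' \<alpha>'"
  shows "box_automorphism (P ** P') (\<lambda>d. \<alpha> (\<alpha>' d))"
proof -
  obtain R \<beta> where 1: "P ** R = mat 1" "\<forall>d. \<alpha> (\<beta> d) = d \<and> \<beta> (\<alpha> d) = d" "\<forall>x\<in>box_cone. R *v x \<in> box_cone"
      "\<forall>d x. code_equations d x \<longrightarrow> code_equations (\<beta> d) (R *v x)"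
    using assms(1) unfolding box_automorphism_def by blast
  obtain R' \<beta>' where 2: "P' ** R' = mat 1" "\<forall>d. \<alpha>' (\<beta>' d) = d \<and> \<beta>' (\<alpha>' d) = d" "\<forall>x\<in>box_cone. R' *v x \<in> box_cone"
      "\<forall>d x. code_equations d x \<longrightarrow> code_equations (\<beta>' d) (R' *v x)"
    using assms(2) unfolding box_automorphism_def by blast
  have "(P ** P') ** (R' ** R) = P ** (P' ** R') ** R" by (simp only: matrix_mul_assoc)
  also have "\<dots> = mat 1" by (simp add: 1 2)
  finally have "(P ** P') ** (R' ** R) = mat 1" .
  note PR = this
  note P = assms(1)[unfolded box_automorphism_def] and P' = assms(2)[unfolded box_automorphism_def]
  note inv = P[THEN conjunct1] P'[THEN conjunct1]
  note cone = P[THEN conjunct2, THEN conjunct1, rule_format] P'[THEN conjunct2, THEN conjunct1, rule_format]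
    1(3)[rule_format] 2(3)[rule_format]
  note code = P[THEN conjunct2, THEN conjunct2, THEN conjunct1, rule_format]
    P'[THEN conjunct2, THEN conjunct2, THEN conjunct1, rule_format] 1(4)[rule_format] 2(4)[rule_format]
  note inverse = 1(2)[rule_format, THEN conjunct1] 1(2)[rule_format, THEN conjunct2]
    2(2)[rule_format, THEN conjunct1] 2(2)[rule_format, THEN conjunct2]
  show ?thesis
    unfolding box_automorphism_def
  proof (intro conjI exI[of _ "R' ** R"] exI[of _ "\<lambda>d. \<beta>' (\<beta> d)"] ballI allI impI)
  qed (simp_all add: PR inv invertible_matrix_mult cone code inverse flip: matrix_vector_mul_assoc)
qed

lemma box_automorphism_image:
  assumes "box_automorphism P \<alpha>"
  shows "proj_map P ` box_variety \<subseteq> box_variety" "proj_map P ` box_curve d = box_curve (\<alpha> d)"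
    "inj (proj_map P)" "inj \<alpha>"
proof -
  obtain R \<beta> where inv: "invertible_matrix P" and cone: "\<And>x. x \<in> box_cone \<Longrightarrow> P *v x \<in> box_cone"
      "\<And>x. x \<in> box_cone \<Longrightarrow> R *v x \<in> box_cone"
    and code: "\<And>d x. code_equations d x \<Longrightarrow> code_equations (\<alpha> d) (P *v x)"
      "\<And>d x. code_equations d x \<Longrightarrow> code_equations (\<beta> d) (R *v x)"
    and PR: "P ** R = mat 1" and \<beta>: "\<And>d. \<alpha> (\<beta> d) = d" "\<And>d. \<beta> (\<alpha> d) = d"
    using assms unfolding box_automorphism_def by blast
  have P: "proj_map P (pt x) = pt (P *v x)" "P *v x \<noteq> 0" if "x \<noteq> 0" for x
    using that inv by (simp_all add: proj_map_pt invertible_matrix_eq_0_iff)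
  show "proj_map P ` box_variety \<subseteq> box_variety"
  proof (intro subsetI, elim imageE)
    fix q p assume p: "q = proj_map P p" "p \<in> box_variety"
    obtain x where x: "x \<noteq> 0" "p = pt x" by (rule proj_cases)
    with p(2) have "x \<in> box_cone" by (simp add: mem_box_variety_iff)
    then show "q \<in> box_variety" using p(1) x P cone(1) by (simp add: mem_box_variety_iff)
  qed
  show "proj_map P ` box_curve d = box_curve (\<alpha> d)"
  proof (intro equalityI subsetI)
    fix q assume "q \<in> proj_map P ` box_curve d"
    then obtain p where p: "q = proj_map P p" "p \<in> box_curve d" by blast
    obtain x where x: "x \<noteq> 0" "p = pt x" by (rule proj_cases)
    with p(2) have "x \<in> box_cone" "code_equations d x" by (simp_all add: mem_box_curve_iff)
    then show "q \<in> box_curve (\<alpha> d)" using p(1) x P cone(1) code(1) by (simp add: mem_box_curve_iff)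
  next
    fix q assume q: "q \<in> box_curve (\<alpha> d)"
    obtain y where y: "y \<noteq> 0" "q = pt y" by (rule proj_cases)
    have PR': "P *v (R *v y) = y" by (simp add: matrix_vector_mul_assoc PR)
    then have nz: "R *v y \<noteq> 0" using y(1) by auto
    from q y have "y \<in> box_cone" "code_equations (\<alpha> d) y" by (simp_all add: mem_box_curve_iff)
    then have "R *v y \<in> box_cone" "code_equations d (R *v y)" using cone(2) code(2)[of "\<alpha> d" y] by (simp_all add: \<beta>)
    then have "pt (R *v y) \<in> box_curve d" using nz by (simp add: mem_box_curve_iff)
    moreover have "q = proj_map P (pt (R *v y))" using P(1)[OF nz] by (simp add: y(2) PR')
    ultimately show "q \<in> proj_map P ` box_curve d" by (rule rev_image_eqI)
  qed
  show "inj \<alpha>" by (rule inj_on_inverseI[of _ \<beta>]) (rule \<beta>(2))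
  obtain P' where P': "P ** P' = mat 1" "P' ** P = mat 1" using inv by (auto simp: invertible_matrix_def)
  then have "invertible_matrix P'" by (auto simp: invertible_matrix_def)
  show "inj (proj_map P)"
  proof (rule inj_on_inverseI)
    fix p show "proj_map P' (proj_map P p) = p"
      using proj_map_mult[OF \<open>invertible_matrix P'\<close> inv, of p] by (simp add: P' proj_map_one)
  qed
qed

section \<open>The 48 curves are distinct\<close>

text \<open>A point of the base curve with enough asymmetry to lie on no other curve:
  \<open>W3\<close> differs from \<open>W1\<close> and \<open>W2\<close> even up to sign,
  \<open>(x $ C)\<^sup>2 = 6\<close> is not the negative of \<open>1\<close> or \<open>4\<close>,
  and nonzero coordinates fix the three signs.\<close>

lemma witness_point:
  obtains x where "x \<noteq> 0" "x \<in> box_cone" "x $ W1 = 1" "x $ W2 = 1" "x $ W3 = 2" "x $ Z1 = x $ Z2" "x $ Z1 \<noteq> 0"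
    "x $ Z3 = of_real (sqrt 2)" "(x $ C)\<^sup>2 = 6"
proof -
  define p q where "p = csqrt 5" and "q = csqrt 6"
  have pq: "p\<^sup>2 = 5" "q\<^sup>2 = 6" by (simp_all only: p_def q_def power2_csqrt)
  define x :: "complex ^ coord" where
    "x = (\<chi> i. case i of Z1 \<Rightarrow> p | Z2 \<Rightarrow> p | Z3 \<Rightarrow> of_real (sqrt 2) | W1 \<Rightarrow> 1 | W2 \<Rightarrow> 1 | W3 \<Rightarrow> 2 | C \<Rightarrow> q)"
  have x: "x $ W1 = 1" "x $ W2 = 1" "x $ W3 = 2" "x $ Z1 = p" "x $ Z2 = p"
    "x $ Z3 = of_real (sqrt 2)" "x $ C = q"
    by (simp_all add: x_def)
  have sq: "(of_real (sqrt 2))\<^sup>2 = (2 :: complex)" using of_real_sqrt2_squared[of 1] by simp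
  have "x \<noteq> 0" using x(1) by (metis zero_index zero_neq_one)
  moreover have "x \<in> box_cone" by (simp add: box_cone_def x sq pq)
  moreover have "p \<noteq> 0" using pq(1) by auto
  ultimately show ?thesis using that x pq(2) by simp
qed

lemma box_curve_base_eqD:
  assumes "box_curve (W1W2, True, True, True) = box_curve d"
  shows "d = (W1W2, True, True, True)"
proof -
  obtain x where x: "x \<noteq> 0" "x \<in> box_cone" "x $ W1 = 1" "x $ W2 = 1" "x $ W3 = 2" "x $ Z1 = x $ Z2" "x $ Z1 \<noteq> 0"
    "x $ Z3 = of_real (sqrt 2)" "(x $ C)\<^sup>2 = 6"
    by (rule witness_point)
  then have "pt x \<in> box_curve (W1W2, True, True, True)" by (simp add: mem_box_curve_iff sg_def)
  then have d: "code_equations d x" using x(1) assms by (simp add: mem_box_curve_iff)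
  obtain s a b c where abc: "d = (s, a, b, c)" by (cases d) auto
  have sq: "(sg a)\<^sup>2 = 1" by (simp add: sg_def)
  have nC: "x $ C \<noteq> sg a * (\<i> * y)" if "y\<^sup>2 = 1 \<or> y\<^sup>2 = 4" for y
  proof
    assume "x $ C = sg a * (\<i> * y)"
    then have "(x $ C)\<^sup>2 = - y\<^sup>2" by (simp add: power_mult_distrib sq)
    then show False using that x(9) by auto
  qed
  have s: "s = W1W2"
    using d nC[of "x $ W1"] nC[of "x $ W2"] nC[of "x $ W3"] x(3-5) unfolding abc
    by (cases s) (auto simp: sg_def split: if_splits)
  have "x $ Z2 \<noteq> - (x $ Z2)" using x(6,7) by simp
  then show ?thesis
    using d x(3-8) unfolding abc s by (auto simp: sg_def split: if_splits)
qed

text \<open>The base case is decided by the witness point. The generators carry it over to all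
  codes, since their projective maps are injective and their maps of codes surjective.\<close>

lemma inj_box_curve: "inj box_curve"
proof (rule injI)
  fix d d' assume "box_curve d = box_curve d'"
  have step: "\<forall>d'. box_curve (\<alpha> d) = box_curve d' \<longrightarrow> \<alpha> d = d'"
    if d: "\<forall>d'. box_curve d = box_curve d' \<longrightarrow> d = d'" and P: "box_automorphism P \<alpha>" and "surj \<alpha>" for P \<alpha> d
  proof (intro allI impI)
    fix d' assume eq: "box_curve (\<alpha> d) = box_curve d'"
    obtain d0 where d0: "d' = \<alpha> d0" using \<open>surj \<alpha>\<close> by blast
    have "proj_map P ` box_curve d = proj_map P ` box_curve d0"
      unfolding box_automorphism_image(2)[OF P] eq d0 ..
    then have "box_curve d = box_curve d0" using box_automorphism_image(3)[OF P] by (simp add: inj_image_eq_iff)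
    with d have "d = d0" by blast
    then show "\<alpha> d = d'" by (simp add: d0)
  qed
  have surj: "surj code_S" "surj code_T" "surj code_Q"
    by (rule surjI, rule code_S_square code_T_power4 code_Q_power4)+
  have "\<forall>d'. box_curve d = box_curve d' \<longrightarrow> d = d'"
  proof (induction d rule: code_induct)
    case base
    then show ?case using box_curve_base_eqD by metis
  next
    case (S d)
    then show ?case by (rule step) (rule box_automorphism_generators surj)+
  next
    case (T d)
    then show ?case by (rule step) (rule box_automorphism_generators surj)+
  next
    case (Q d)
    then show ?case by (rule step) (rule box_automorphism_generators surj)+
  qed
  then show "d = d'" using \<open>box_curve d = box_curve d'\<close> by blast
qed

lemma card_box_curves: "card (range box_curve) = 48"
proof -
  have shapes: "(UNIV :: shape set) = {W1W2, W1W3, W2W3, CW3, CW2, CW1}" using shape.exhaust by blast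
  have "card (UNIV :: shape set) = 6" unfolding shapes by simp
  then have "card (UNIV :: code set) = 48"
    by (simp only: UNIV_Times_UNIV[symmetric] card_cartesian_product card_UNIV_bool)
  then show ?thesis using inj_box_curve by (simp add: card_image)
qed

section \<open>The orbit of the curve\<close>

text \<open>The invariant carried by two inductions: over \<open>gen_pairs\<close>, so that every
  group element is realized, and over codes, so that every curve is reached. The matrix model gives
  ellipticity and the code gives the count.\<close>

definition realizes :: "(coord proj \<Rightarrow> coord proj) \<Rightarrow> code \<Rightarrow> int ^ 2 ^ 2 \<Rightarrow> int ^ 2 ^ 2 \<Rightarrow> bool" where
  "realizes f d M N \<longleftrightarrow> (M, N) \<in> gen_pairs \<and>
     (\<forall>z w. Im z > 0 \<longrightarrow> Im w > 0 \<longrightarrow> f (theta_map z w) = theta_map (moebius M z) (moebius N w)) \<and>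
     continuous_on UNIV f \<and> f ` box_variety \<subseteq> box_variety \<and> f ` shift_curve = box_curve d \<and>
     (\<exists>A B. embedded_quartic A B \<and> f ` shift_curve = quartic_curve A)"

lemma realizesD:
  assumes "realizes f d M N"
  shows "(M, N) \<in> Delta 1 2"
    and "Im z > 0 \<Longrightarrow> Im w > 0 \<Longrightarrow> f (theta_map z w) = theta_map (moebius M z) (moebius N w)"
    and "continuous_on X f" and "f ` box_variety \<subseteq> box_variety" and "f ` shift_curve = box_curve d"
    and "\<exists>A B. embedded_quartic A B \<and> f ` shift_curve = quartic_curve A"
proof -
  note r = assms[unfolded realizes_def]
  show "(M, N) \<in> Delta 1 2" unfolding gen_pairs_eq_Delta[symmetric] by (rule r[THEN conjunct1])
  show "f (theta_map z w) = theta_map (moebius M z) (moebius N w)" if "Im z > 0" "Im w > 0"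
    by (rule r[THEN conjunct2, THEN conjunct1, rule_format, OF that])
  show "continuous_on X f"
    by (rule continuous_on_subset[OF r[THEN conjunct2, THEN conjunct2, THEN conjunct1] subset_UNIV])
  from r show "f ` box_variety \<subseteq> box_variety" by (elim conjE)
  from r show "f ` shift_curve = box_curve d" by (elim conjE)
  from r show "\<exists>A B. embedded_quartic A B \<and> f ` shift_curve = quartic_curve A" by (elim conjE)
qed

lemma realizes_step:
  assumes f: "realizes f d M N" and P: "box_automorphism P \<alpha>" and XY: "(X ** M, Y ** N) \<in> gen_pairs"
    and th: "\<And>z w. Im z > 0 \<Longrightarrow> Im w > 0 \<Longrightarrow> theta_map (moebius X z) (moebius Y w) = proj_map P (theta_map z w)"
  shows "realizes (\<lambda>p. proj_map P (f p)) (\<alpha> d) (X ** M) (Y ** N)"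
  unfolding realizes_def
proof (intro conjI allI impI XY)
  note f = realizesD[OF f]
  have inv: "invertible_matrix P" using P by (simp add: box_automorphism_def)
  show "proj_map P (f (theta_map z w)) = theta_map (moebius (X ** M) z) (moebius (Y ** N) w)"
    if zw: "Im z > 0" "Im w > 0" for z w
  proof -
    have "det M = 1" "det N = 1" using f(1) by (simp_all add: Delta_def Gamma_def)
    moreover have "Im (moebius M z) > 0" "Im (moebius N w) > 0" using Delta_moebius_pos[OF f(1) zw] by simp_all
    ultimately show ?thesis using zw by (simp add: f(2) th moebius_mult)
  qed
  show "continuous_on UNIV (\<lambda>p. proj_map P (f p))"
    by (rule continuous_on_compose2[OF continuous_on_proj_map[OF inv] f(3)]) simp
  show "(\<lambda>p. proj_map P (f p)) ` box_variety \<subseteq> box_variety"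
    using f(4) box_automorphism_image(1)[OF P] by (auto simp: image_subset_iff)
  have im: "(\<lambda>p. proj_map P (f p)) ` shift_curve = proj_map P ` (f ` shift_curve)" by (simp add: image_image)
  then show "(\<lambda>p. proj_map P (f p)) ` shift_curve = box_curve (\<alpha> d)"
    by (simp only: f(5) box_automorphism_image(2)[OF P])
  obtain A B where AB: "embedded_quartic A B" "f ` shift_curve = quartic_curve A" using f(6) by blast
  have "(\<lambda>p. proj_map P (f p)) ` shift_curve = quartic_curve (P ** A)"
    unfolding im AB(2) by (rule proj_map_quartic_curve[OF AB(1) inv])
  then show "\<exists>A B. embedded_quartic A B \<and> (\<lambda>p. proj_map P (f p)) ` shift_curve = quartic_curve A"
    using proj_map_quartic_curve(1)[OF AB(1) inv] by blast
qed

lemma realizes_one: "realizes (\<lambda>p. p) (W1W2, True, True, True) (mat 1) (mat 1)"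
  unfolding realizes_def
proof (intro conjI allI impI gen_pairs.one continuous_on_id)
  show "(\<lambda>p. p) ` shift_curve = box_curve (W1W2, True, True, True)" by (simp add: shift_curve_eq_box_curve)
  show "\<exists>A B. embedded_quartic A B \<and> (\<lambda>p. p) ` shift_curve = quartic_curve A"
    using shift.embedded_quartic_axioms shift_curve_eq by auto
qed (simp_all add: mat_1_eq_mat2 moebius_def)

lemma realizes_generators:
  assumes "realizes f d M N"
  shows "realizes (\<lambda>p. proj_map box_S (f p)) (code_S d) (matS ** M) (matS ** N)"
    and "realizes (\<lambda>p. proj_map box_T (f p)) (code_T d) (matT 1 ** M) (matT 1 ** N)"
    and "realizes (\<lambda>p. proj_map box_Q (f p)) (code_Q d) M (matT 2 ** N)"
    and "\<exists>g d'. realizes g d' (matT (- 1) ** M) (matT (- 1) ** N)"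
    and "\<exists>g d'. realizes g d' M (matT (- 2) ** N)"
    and "\<exists>g d'. realizes g d' M (mat2 (- 1) 0 0 (- 1) ** N)"
proof -
  have MN: "(M, N) \<in> gen_pairs" unfolding gen_pairs_eq_Delta by (rule realizesD[OF assms])
  have one: "moebius (mat 1) z = z" for z by (simp add: mat_1_eq_mat2 moebius_def)
  show "realizes (\<lambda>p. proj_map box_S (f p)) (code_S d) (matS ** M) (matS ** N)"
    by (rule realizes_step[OF assms box_automorphism_generators(1) gen_pairs.S[OF MN]])
      (simp only: moebius_matS theta_map_S)
  show "realizes (\<lambda>p. proj_map box_T (f p)) (code_T d) (matT 1 ** M) (matT 1 ** N)"
    by (rule realizes_step[OF assms box_automorphism_generators(2) gen_pairs.T[OF MN]])
      (simp add: moebius_matT theta_map_T)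
  have Q: "(mat 1 ** M, matT 2 ** N) \<in> gen_pairs" "(mat 1 ** M, matT (- 2) ** N) \<in> gen_pairs"
    "(mat 1 ** M, mat2 (- 1) 0 0 (- 1) ** N) \<in> gen_pairs"
    using MN by (simp_all add: gen_pairs.Q gen_pairs.Q' gen_pairs.neg)
  have "realizes (\<lambda>p. proj_map box_Q (f p)) (code_Q d) (mat 1 ** M) (matT 2 ** N)"
    by (rule realizes_step[OF assms box_automorphism_generators(3) Q(1)])
      (simp add: moebius_matT one theta_map_Q)
  then show "realizes (\<lambda>p. proj_map box_Q (f p)) (code_Q d) M (matT 2 ** N)" by simp
  have cancel: "proj_map (P ** (P ** P)) (proj_map P p) = p"
    if P: "invertible_matrix P" "P ** (P ** (P ** P)) = mat 1" for P :: "complex ^ coord ^ coord" and p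
  proof -
    have "proj_map (P ** (P ** P)) (proj_map P p) = proj_map (P ** (P ** (P ** P))) p"
      by (simp add: proj_map_mult P(1) invertible_matrix_mult)
    then show ?thesis by (simp add: P(2) proj_map_one)
  qed
  \<comment> \<open>Both matrices have order four, so their cubes realize the inverse
    translations.\<close>
  let ?T3 = "box_T ** (box_T ** box_T)" and ?Q3 = "box_Q ** (box_Q ** box_Q)"
  have T3: "box_automorphism ?T3 (\<lambda>d. code_T (code_T (code_T d)))"
    and Q3: "box_automorphism ?Q3 (\<lambda>d. code_Q (code_Q (code_Q d)))"
    by (rule box_automorphism_mult box_automorphism_generators)+
  have "realizes (\<lambda>p. proj_map ?T3 (f p)) (code_T (code_T (code_T d))) (matT (- 1) ** M) (matT (- 1) ** N)"
  proof (rule realizes_step[OF assms T3 gen_pairs.T'[OF MN]])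
    fix z w :: complex assume "Im z > 0" "Im w > 0"
    then have "theta_map z w = proj_map box_T (theta_map (z - 1) (w - 1))"
      using theta_map_T[of "z - 1" "w - 1"] by simp
    then show "theta_map (moebius (matT (- 1)) z) (moebius (matT (- 1)) w) = proj_map ?T3 (theta_map z w)"
      by (simp add: cancel[OF invertible_box_T box_T_power4] moebius_matT)
  qed
  then show "\<exists>g d'. realizes g d' (matT (- 1) ** M) (matT (- 1) ** N)" by blast
  have "realizes (\<lambda>p. proj_map ?Q3 (f p)) (code_Q (code_Q (code_Q d))) (mat 1 ** M) (matT (- 2) ** N)"
  proof (rule realizes_step[OF assms Q3 Q(2)])
    fix z w :: complex assume "Im z > 0" "Im w > 0"
    then have "theta_map z w = proj_map box_Q (theta_map z (w - 2))"
      using theta_map_Q[of z "w - 2"] by simp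
    then show "theta_map (moebius (mat 1) z) (moebius (matT (- 2)) w) = proj_map ?Q3 (theta_map z w)"
      by (simp add: cancel[OF invertible_box_Q box_Q_power4] moebius_matT one)
  qed
  then show "\<exists>g d'. realizes g d' M (matT (- 2) ** N)" by (simp only: matrix_mul_lid) blast
  \<comment> \<open>The negative identity acts trivially on the upper half plane, so the same map
    and the same code remain valid.\<close>
  have "realizes (\<lambda>p. proj_map (mat 1) (f p)) d (mat 1 ** M) (mat2 (- 1) 0 0 (- 1) ** N)"
    by (rule realizes_step[OF assms box_automorphism_one Q(3)]) (simp only: one moebius_neg proj_map_one)
  then show "\<exists>g d'. realizes g d' M (mat2 (- 1) 0 0 (- 1) ** N)" by (simp only: matrix_mul_lid) blast
qed

lemma Delta_realized:
  assumes "(M, N) \<in> Delta 1 2"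
  shows "\<exists>f d. realizes f d M N"
  using assms unfolding gen_pairs_eq_Delta[symmetric]
proof (induction rule: gen_pairs.induct)
  case one
  then show ?case using realizes_one by blast
next
  case (S M N)
  then show ?case using realizes_generators(1) by blast
next
  case (T M N)
  then show ?case using realizes_generators(2) by blast
next
  case (T' M N)
  then show ?case using realizes_generators(4) by blast
next
  case (Q M N)
  then show ?case using realizes_generators(3) by blast
next
  case (Q' M N)
  then show ?case using realizes_generators(5) by blast
next
  case (neg M N)
  then show ?case using realizes_generators(6) by blast
qed

lemma code_realized: "\<exists>f M N. realizes f d M N"
proof (induction d rule: code_induct)
  case base
  then show ?case using realizes_one by blast
next
  case (S d)
  then show ?case using realizes_generators(1) by blast
next
  case (T d)
  then show ?case using realizes_generators(2) by blast
next
  case (Q d)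
  then show ?case using realizes_generators(3) by blast
qed

text \<open>The map \<open>f\<close> shows that the choice in \<open>box_action\<close> has a
  candidate. The chosen map takes the same values as \<open>f\<close> at the theta points of the
  curve, hence on their closure.\<close>

lemma box_action_shift_curve:
  assumes "realizes f d M N"
  shows "box_action (M, N) ` shift_curve = f ` shift_curve"
proof -
  note f = realizesD[OF assms]
  define Pr where "Pr g \<longleftrightarrow> continuous_on box_variety g \<and> g ` box_variety \<subseteq> box_variety \<and>
     (\<forall>z\<in>upper_half_plane. \<forall>w\<in>upper_half_plane. g (theta_map z w) = theta_map (moebius M z) (moebius N w))" for g
  define g where "g = box_action (M, N)"
  have "Pr f" by (simp add: Pr_def upper_half_plane_def f)
  then have "Pr (SOME g. Pr g)" by (rule someI[of Pr f])
  moreover have "g = (SOME g. Pr g)" unfolding Pr_def g_def box_action_def fst_conv snd_conv ..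
  ultimately have "Pr g" by (simp only:)
  note g = this[unfolded Pr_def]
  let ?T = "{theta_map z w | z w. z \<in> upper_half_plane \<and> w \<in> upper_half_plane \<and> w = z + 1}"
  have cl: "closure ?T = shift_curve" by (simp only: shift_curve_def)
  have "g p = f p" if "p \<in> shift_curve" for p
  proof (rule continuous_agree_on_closure[of ?T g f p])
    show "continuous_on (closure ?T) g" "continuous_on (closure ?T) f" unfolding cl
      by (rule continuous_on_subset[OF g[THEN conjunct1] shift_curve_subset_box], rule f(3))
    show "p \<in> closure ?T" unfolding cl by (rule that)
    fix q assume "q \<in> ?T"
    then obtain z w where "q = theta_map z w" "Im z > 0" "Im w > 0" by (auto simp: upper_half_plane_def)
    then show "g q = f q" using g by (simp add: upper_half_plane_def f(2))
  qed
  then show ?thesis unfolding g_def by (rule image_cong[OF refl])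
qed

lemma orbit_eq: "{box_action M ` shift_curve | M. M \<in> Delta 1 2} = range box_curve"
proof (intro equalityI subsetI)
  fix X assume "X \<in> {box_action M ` shift_curve | M. M \<in> Delta 1 2}"
  then obtain M N where MN: "(M, N) \<in> Delta 1 2" "X = box_action (M, N) ` shift_curve" by auto
  then obtain f d where r: "realizes f d M N" using Delta_realized by blast
  have "X = box_curve d" unfolding MN(2) box_action_shift_curve[OF r] by (rule realizesD(5)[OF r])
  then show "X \<in> range box_curve" by simp
next
  fix X assume "X \<in> range box_curve"
  then obtain d where "X = box_curve d" by blast
  moreover obtain f M N where r: "realizes f d M N" using code_realized by blast
  ultimately have "X = box_action (M, N) ` shift_curve" by (simp only: box_action_shift_curve[OF r] realizesD(5)[OF r])
  moreover have "(M, N) \<in> Delta 1 2" by (rule realizesD[OF r])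
  ultimately show "X \<in> {box_action M ` shift_curve | M. M \<in> Delta 1 2}" by blast
qed

theorem mainTheorem6:
  shows "shift_curve \<subseteq> box_variety \<and> elliptic_curve shift_curve \<and>
    shift_curve = {p \<in> box_variety. \<exists>x. x \<noteq> 0 \<and> p = pt x \<and>
       x $ W1 = x $ W2 \<and> x $ Z1 = x $ Z2 \<and> of_real (sqrt 2) * x $ W1 = x $ Z3 \<and>
       (x $ W3)\<^sup>2 + (x $ Z3)\<^sup>2 - (x $ C)\<^sup>2 = 0 \<and>
       2 * (x $ Z2)\<^sup>2 + (x $ Z3)\<^sup>2 - 2 * (x $ C)\<^sup>2 = 0} \<and>
    card {box_action M ` shift_curve | M. M \<in> Delta 1 2} = 48 \<and>
    (\<forall>M \<in> Delta 1 2. box_action M ` shift_curve \<subseteq> box_variety \<and>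
       elliptic_curve (box_action M ` shift_curve))"
proof (intro conjI ballI)
  show "shift_curve \<subseteq> box_variety" by (rule shift_curve_subset_box)
  show "elliptic_curve shift_curve" unfolding shift_curve_eq by (rule shift.elliptic)
  show "shift_curve = {p \<in> box_variety. \<exists>x. x \<noteq> 0 \<and> p = pt x \<and>
       x $ W1 = x $ W2 \<and> x $ Z1 = x $ Z2 \<and> of_real (sqrt 2) * x $ W1 = x $ Z3 \<and>
       (x $ W3)\<^sup>2 + (x $ Z3)\<^sup>2 - (x $ C)\<^sup>2 = 0 \<and>
       2 * (x $ Z2)\<^sup>2 + (x $ Z3)\<^sup>2 - 2 * (x $ C)\<^sup>2 = 0}"
    using shift_curve_equations unfolding shift_equations_def .
  show "card {box_action M ` shift_curve | M. M \<in> Delta 1 2} = 48"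
    unfolding orbit_eq by (rule card_box_curves)
next
  fix MN assume "MN \<in> Delta 1 2"
  then obtain M N f d where MN: "MN = (M, N)" and r: "realizes f d M N"
    using Delta_realized by (cases MN) blast
  have eq: "box_action MN ` shift_curve = f ` shift_curve" unfolding MN by (rule box_action_shift_curve[OF r])
  show "box_action MN ` shift_curve \<subseteq> box_variety"
    unfolding eq using realizesD(4)[OF r] shift_curve_subset_box by blast
  obtain A B where AB: "embedded_quartic A B" "f ` shift_curve = quartic_curve A" using realizesD(6)[OF r] by blast
  interpret embedded_quartic A B by (rule AB(1))
  show "elliptic_curve (box_action MN ` shift_curve)" unfolding eq AB(2) by (rule elliptic)
qed

end
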